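(* Let $(\Omega,\mathcal F,(\mathcal F_t)_{t\in\mathbb R_+})$ be a filtered space with right-continuous filtration and $\mathcal F=\bigvee_t\mathcal F_t$, and let $\mu,\nu$ be two probability measures on it. Let $S$ be the first time when one of the density processes of $\mu,\nu$ with respect to $Q=\frac12(\mu+\nu)$ vanishes, and let $h$ be the Hellinger process in the strict sense of order $\frac12$ between $\mu$ and $\nu$ (both defined in the context). Let $T$ be a stopping time. Set $$E=\big(\{T<S\}\cup\{T=S,\ T=\infty\}\big)\cap\{h_T<\infty\},$$ $$E^c=\big(\{S<T\}\cup\{S\le T,\ T<\infty\}\big)\cup\{h_T=\infty\}.$$ Then $\mu_T\sim\nu_T$ on the set $E$, and $\mu_T\perp\nu_T$ on the set $E^c$.
   Context: Stopping times take values in $[0,\infty]$. For a stopping time $T$, $\mu_T,\nu_T$ denote the restrictions of $\mu,\nu$ to $\mathcal F_T$. $\sim$ denotes mutual absolute continuity and $\perp$ singularity; "on the set $E$" means for the measures restricted to $E$. $Q=\frac12(\mu+\nu)$; $z$ and $z'$ are the right-continuous versions with left limits of the density processes of $\mu$ and $\nu$ with respect to $Q$ (so $z_t=d\mu_t/dQ_t$, $z'_t=d\nu_t/dQ_t$, $z_\infty=d\mu/dQ$, $z'_\infty=d\nu/dQ$). Convention: $z_{0-}=z_0$, $z_{t-}=\lim_{s\uparrow t}z_s$, similarly for $z'$. $S=\inf\{t: z_t=0\text{ or }z'_t=0\}$, with $\inf\varnothing=\infty$. $Y=\sqrt{zz'}$ is a $Q$-supermartingale of class $(D)$; $Y=M-A$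 is its Doob–Meyer decomposition ($M$ a martingale, $A$ predictable increasing with $A_0=0$). The Hellinger process in the strict sense of order $\frac12$ between $\mu$ and $\nu$ is the predictable increasing $[0,\infty]$-valued process $h$, unique up to $Q$-indistinguishability, such that $h_0=0$ and $$A=Y_-\bullet h,\qquad h=\Big(\tfrac1{Y_-}1_{\Gamma''}\Big)\bullet A,\qquad \Gamma''=\big(\{z_->0\}\cap\{z'_->0\}\big)\cup[0],$$ where $\bullet$ denotes the (pathwise Stieltjes) integral process and $[0]=\Omega\times\{0\}$. $h_\infty=\lim_{t\to\infty}h_t$. *)

theory Defs
  imports "HOL-Probability.Probability"
begin

text \<open>
  Conventions. Time ranges over \<^typ>\<open>ennreal\<close>, that is over [0,\<infinity>]; the time set of the
  filtration proper is {t. t < \<infinity>}, and F \<infinity> is the full sigma-algebra. With this choice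
  \<^const>\<open>stopping_time\<close> and \<^const>\<open>filtration.pre_sigma\<close> are the notions for stopping times with
  values in [0,\<infinity>]. The filtration is not assumed to be complete, so path properties are required
  for Q-almost every path.
\<close>

definition filtered_space :: "'a set \<Rightarrow> (ennreal \<Rightarrow> 'a measure) \<Rightarrow> bool" where
  "filtered_space \<Omega> F \<longleftrightarrow>
     filtration \<Omega> F \<and>
     (\<forall>t<\<infinity>. sets (F t) = (\<Inter>s\<in>{t<..<\<infinity>}. sets (F s))) \<and>
     sets (F \<infinity>) = sigma_sets \<Omega> (\<Union>t\<in>{..<\<infinity>}. sets (F t))"

definition mean_measure :: "'a measure \<Rightarrow> 'a measure \<Rightarrow> 'a measure" where
  "mean_measure M N =
     measure_of (space M) (sets M) (\<lambda>A. (emeasure M A + emeasure N A) / 2)"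

definition cadlag :: "(ennreal \<Rightarrow> real) \<Rightarrow> bool" where
  "cadlag x \<longleftrightarrow>
     (\<forall>t<\<infinity>. (x \<longlongrightarrow> x t) (at_right t) \<and> (\<exists>l. (x \<longlongrightarrow> l) (at_left t)))"

definition left_limit :: "(ennreal \<Rightarrow> real) \<Rightarrow> ennreal \<Rightarrow> real" where
  "left_limit x t = (if t = 0 then x 0 else Lim (at_left t) x)"

definition increasing_path :: "(ennreal \<Rightarrow> 'b::{linorder_topology, zero}) \<Rightarrow> bool" where
  "increasing_path x \<longleftrightarrow>
     x 0 = 0 \<and> mono_on {..<\<infinity>} x \<and> (\<forall>t<\<infinity>. (x \<longlongrightarrow> x t) (at_right t))"

definition predictable_sigma :: "'a set \<Rightarrow> (ennreal \<Rightarrow> 'a measure) \<Rightarrow> ('a \<times> ennreal) measure" where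
  "predictable_sigma \<Omega> F = sigma (\<Omega> \<times> {..<\<infinity>})
     ({A \<times> {0} | A. A \<in> sets (F 0)} \<union>
      {A \<times> {s<..t} | A s t. s \<le> t \<and> t < \<infinity> \<and> A \<in> sets (F s)})"

definition predictable_process ::
    "'a set \<Rightarrow> (ennreal \<Rightarrow> 'a measure) \<Rightarrow> (ennreal \<Rightarrow> 'a \<Rightarrow> 'b::topological_space) \<Rightarrow> bool" where
  "predictable_process \<Omega> F X \<longleftrightarrow> (\<lambda>(\<omega>, t). X t \<omega>) \<in> borel_measurable (predictable_sigma \<Omega> F)"

definition martingale :: "(ennreal \<Rightarrow> 'a measure) \<Rightarrow> 'a measure \<Rightarrow> (ennreal \<Rightarrow> 'a \<Rightarrow> real) \<Rightarrow> bool" where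
  "martingale F Q M \<longleftrightarrow>
     (\<forall>t<\<infinity>. M t \<in> borel_measurable (F t) \<and> integrable Q (M t)) \<and>
     (\<forall>s t. s \<le> t \<longrightarrow> t < \<infinity> \<longrightarrow> (AE \<omega> in Q. real_cond_exp Q (F s) (M t) \<omega> = M s \<omega>))"

text \<open>
  The Stieltjes integral of f \<ge> 0 over [0,t] with respect to an increasing right-continuous g with
  values in [0,\<infinity>]. The measures induced by the bounded functions min g n increase with n; their
  supremum is the measure that gives ]r,s] the mass g s - g r whenever g r < \<infinity>, and that does
  not charge the times s with g (s-) = \<infinity>. As \<^term>\<open>ennreal s = 0\<close> for s < 0, there is no
  mass at 0.
\<close>

definition stieltjes :: "(ennreal \<Rightarrow> ennreal) \<Rightarrow> (ennreal \<Rightarrow> ennreal) \<Rightarrow> ennreal \<Rightarrow> ennreal" where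
  "stieltjes f g t =
     (SUP n::nat. \<integral>\<^sup>+ s. f (ennreal s) * indicator {s. 0 \<le> s \<and> ennreal s \<le> t} s
        \<partial>interval_measure (\<lambda>s. enn2real (min (g (ennreal s)) (of_nat n))))"

definition density_process ::
    "(ennreal \<Rightarrow> 'a measure) \<Rightarrow> 'a measure \<Rightarrow> 'a measure \<Rightarrow> (ennreal \<Rightarrow> 'a \<Rightarrow> real) \<Rightarrow> bool" where
  "density_process F Q M z \<longleftrightarrow>
     (\<forall>t. z t \<in> borel_measurable (F t)) \<and>
     (\<forall>t. density (restr_to_subalg Q (F t)) (\<lambda>\<omega>. ennreal (z t \<omega>)) = restr_to_subalg M (F t)) \<and>
     (AE \<omega> in Q. (\<forall>t. 0 \<le> z t \<omega>) \<and> cadlag (\<lambda>t. z t \<omega>))"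

definition first_zero :: "(ennreal \<Rightarrow> 'a \<Rightarrow> real) \<Rightarrow> (ennreal \<Rightarrow> 'a \<Rightarrow> real) \<Rightarrow> 'a \<Rightarrow> ennreal" where
  "first_zero z z' \<omega> = Inf {t. t < \<infinity> \<and> (z t \<omega> = 0 \<or> z' t \<omega> = 0)}"

definition doob_meyer ::
    "'a set \<Rightarrow> (ennreal \<Rightarrow> 'a measure) \<Rightarrow> 'a measure \<Rightarrow> (ennreal \<Rightarrow> 'a \<Rightarrow> real) \<Rightarrow>
     (ennreal \<Rightarrow> 'a \<Rightarrow> real) \<Rightarrow> (ennreal \<Rightarrow> 'a \<Rightarrow> real) \<Rightarrow> bool" where
  "doob_meyer \<Omega> F Q Y M A \<longleftrightarrow>
     martingale F Q M \<and>
     predictable_process \<Omega> F A \<and>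
     (AE \<omega> in Q. increasing_path (\<lambda>t. A t \<omega>)) \<and>
     (AE \<omega> in Q. \<forall>t<\<infinity>. Y t \<omega> = M t \<omega> - A t \<omega>)"

definition hellinger_process ::
    "'a set \<Rightarrow> (ennreal \<Rightarrow> 'a measure) \<Rightarrow> 'a measure \<Rightarrow> (ennreal \<Rightarrow> 'a \<Rightarrow> real) \<Rightarrow>
     (ennreal \<Rightarrow> 'a \<Rightarrow> real) \<Rightarrow> (ennreal \<Rightarrow> 'a \<Rightarrow> ennreal) \<Rightarrow> bool" where
  "hellinger_process \<Omega> F Q z z' h \<longleftrightarrow>
     (let Y = (\<lambda>t \<omega>. sqrt (z t \<omega> * z' t \<omega>));
          Y_left = (\<lambda>t \<omega>. left_limit (\<lambda>s. Y s \<omega>) t);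
          \<Gamma> = {(\<omega>, t). 0 < left_limit (\<lambda>s. z s \<omega>) t \<and> 0 < left_limit (\<lambda>s. z' s \<omega>) t} \<union> UNIV \<times> {0}
      in \<exists>M A. doob_meyer \<Omega> F Q Y M A \<and>
         predictable_process \<Omega> F h \<and>
         (AE \<omega> in Q. increasing_path (\<lambda>t. h t \<omega>)) \<and>
         (AE \<omega> in Q. \<forall>t<\<infinity>.
            ennreal (A t \<omega>) = stieltjes (\<lambda>s. ennreal (Y_left s \<omega>)) (\<lambda>s. h s \<omega>) t) \<and>
         (AE \<omega> in Q. \<forall>t<\<infinity>.
            h t \<omega> = stieltjes (\<lambda>s. inverse (ennreal (Y_left s \<omega>)) * indicator \<Gamma> (\<omega>, s))
                      (\<lambda>s. ennreal (A s \<omega>)) t) \<and>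
         (AE \<omega> in Q. ((\<lambda>t. h t \<omega>) \<longlongrightarrow> h \<infinity> \<omega>) (at_left \<infinity>)))"

text \<open>
  Equivalence and singularity of M and N, both restricted first to the sigma-algebra of G and then to E.
  Without completeness of the filtration the sets E of interest belong to G only up to a null set,
  so a set is read as null when it is contained in a measurable null set, which is what
  \<^const>\<open>almost_everywhere\<close> expresses. The lemmas below show that for E in \<^term>\<open>sets G\<close> these are
  the usual notions for restricted measures.
\<close>

definition equivalent_on :: "'a measure \<Rightarrow> 'a measure \<Rightarrow> 'a measure \<Rightarrow> 'a set \<Rightarrow> bool" where
  "equivalent_on M N G E \<longleftrightarrow>
     (\<forall>A\<in>sets G. (AE \<omega> in M. \<omega> \<notin> A \<inter> E) \<longleftrightarrow> (AE \<omega> in N. \<omega> \<notin> A \<inter> E))"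

definition singular_on :: "'a measure \<Rightarrow> 'a measure \<Rightarrow> 'a measure \<Rightarrow> 'a set \<Rightarrow> bool" where
  "singular_on M N G E \<longleftrightarrow>
     (\<exists>A\<in>sets G. (AE \<omega> in M. \<omega> \<notin> A \<inter> E) \<and> (AE \<omega> in N. \<omega> \<notin> E - A))"

lemma
  assumes "sets N = sets M"
  shows sets_mean_measure [simp]: "sets (mean_measure M N) = sets M"
    and space_mean_measure [simp]: "space (mean_measure M N) = space M"
    and emeasure_mean_measure:
      "A \<in> sets M \<Longrightarrow> emeasure (mean_measure M N) A = (emeasure M A + emeasure N A) / 2"
proof -
  show "sets (mean_measure M N) = sets M" "space (mean_measure M N) = space M"
    by (simp_all add: mean_measure_def)
  show "emeasure (mean_measure M N) A = (emeasure M A + emeasure N A) / 2" if "A \<in> sets M"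
    unfolding mean_measure_def
  proof (rule emeasure_measure_of_sigma)
    show "countably_additive (sets M) (\<lambda>A. (emeasure M A + emeasure N A) / 2)"
    proof (rule countably_additiveI)
      fix B :: "nat \<Rightarrow> 'a set"
      assume B: "range B \<subseteq> sets M" "disjoint_family B"
      have "(\<Sum>i. (emeasure M (B i) + emeasure N (B i)) / 2) =
          ((\<Sum>i. emeasure M (B i)) + (\<Sum>i. emeasure N (B i))) / 2"
        by (simp add: ennreal_suminf_divide suminf_add)
      also have "\<dots> = (emeasure M (\<Union>i. B i) + emeasure N (\<Union>i. B i)) / 2"
        using B assms by (simp add: suminf_emeasure)
      finally show "(\<Sum>i. (emeasure M (B i) + emeasure N (B i)) / 2) =
          (emeasure M (\<Union>i. B i) + emeasure N (\<Union>i. B i)) / 2" .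
    qed
  qed (use that in \<open>auto simp: positive_def sets.sigma_algebra_axioms\<close>)
qed

lemma AE_notin_iff_null_sets_restrict:
  assumes "subalgebra M G" "E \<in> sets G" "B \<in> sets G" "B \<subseteq> E"
  shows "(AE \<omega> in M. \<omega> \<notin> B) \<longleftrightarrow> B \<in> null_sets (restrict_space (restr_to_subalg M G) E)"
proof -
  have B: "B \<in> sets M" and E: "E \<in> sets (restr_to_subalg M G)"
    using assms by (auto simp: subalgebra_def sets_restr_to_subalg)
  have "(AE \<omega> in M. \<omega> \<notin> B) \<longleftrightarrow> emeasure M B = 0"
    using AE_iff_null_sets[OF B] B by (auto simp: null_sets_def)
  also have "\<dots> \<longleftrightarrow> B \<in> null_sets (restr_to_subalg M G)"
    using assms by (auto simp: null_sets_def sets_restr_to_subalg emeasure_restr_to_subalg)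
  also have "\<dots> \<longleftrightarrow> B \<in> null_sets (restrict_space (restr_to_subalg M G) E)"
    using assms by (simp add: null_sets_restrict_space[OF E])
  finally show ?thesis .
qed

lemma equivalent_on_iff:
  assumes "subalgebra M G" "subalgebra N G" "E \<in> sets G"
  shows "equivalent_on M N G E \<longleftrightarrow>
    absolutely_continuous (restrict_space (restr_to_subalg M G) E) (restrict_space (restr_to_subalg N G) E) \<and>
    absolutely_continuous (restrict_space (restr_to_subalg N G) E) (restrict_space (restr_to_subalg M G) E)"
proof -
  let ?n = "\<lambda>L. null_sets (restrict_space (restr_to_subalg L G) E)"
  have sub: "B \<in> sets G \<and> B \<inter> E = B" if "B \<in> ?n L" "subalgebra L G" for B L
    using that assms(3) by (auto simp: null_sets_def sets_restrict_space sets_restr_to_subalg)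
  have ae: "(AE \<omega> in L. \<omega> \<notin> A \<inter> E) \<longleftrightarrow> A \<inter> E \<in> ?n L" if "A \<in> sets G" "subalgebra L G" for A L
    using that assms(3) by (intro AE_notin_iff_null_sets_restrict) auto
  have "equivalent_on M N G E \<longleftrightarrow> (\<forall>A\<in>sets G. A \<inter> E \<in> ?n M \<longleftrightarrow> A \<inter> E \<in> ?n N)"
    unfolding equivalent_on_def by (intro ball_cong refl) (simp only: ae assms)
  also have "\<dots> \<longleftrightarrow> ?n M = ?n N"
  proof
    assume *: "\<forall>A\<in>sets G. A \<inter> E \<in> ?n M \<longleftrightarrow> A \<inter> E \<in> ?n N"
    show "?n M = ?n N"
    proof (rule set_eqI)
      fix B show "B \<in> ?n M \<longleftrightarrow> B \<in> ?n N"
        using * sub[of B M] sub[of B N] assms by metis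
    qed
  qed simp
  finally show ?thesis
    by (auto simp: absolutely_continuous_def)
qed

lemma singular_on_iff:
  assumes "subalgebra M G" "subalgebra N G" "E \<in> sets G"
  shows "singular_on M N G E \<longleftrightarrow>
    (\<exists>B \<in> null_sets (restrict_space (restr_to_subalg M G) E).
       E - B \<in> null_sets (restrict_space (restr_to_subalg N G) E))"
proof -
  let ?n = "\<lambda>L. null_sets (restrict_space (restr_to_subalg L G) E)"
  have ae: "(AE \<omega> in L. \<omega> \<notin> B) \<longleftrightarrow> B \<in> ?n L" if "B \<in> sets G" "B \<subseteq> E" "subalgebra L G" for B L
    using that assms(3) by (intro AE_notin_iff_null_sets_restrict) auto
  have "singular_on M N G E \<longleftrightarrow> (\<exists>A\<in>sets G. A \<inter> E \<in> ?n M \<and> E - A \<in> ?n N)"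
    unfolding singular_on_def
  proof (intro bex_cong refl)
    fix A assume "A \<in> sets G"
    then show "(AE \<omega> in M. \<omega> \<notin> A \<inter> E) \<and> (AE \<omega> in N. \<omega> \<notin> E - A) \<longleftrightarrow>
        A \<inter> E \<in> ?n M \<and> E - A \<in> ?n N"
      using ae[of "A \<inter> E" M] ae[of "E - A" N] assms by auto
  qed
  also have "\<dots> \<longleftrightarrow> (\<exists>B\<in>?n M. E - B \<in> ?n N)"
  proof
    assume "\<exists>A\<in>sets G. A \<inter> E \<in> ?n M \<and> E - A \<in> ?n N"
    then obtain A where "A \<inter> E \<in> ?n M" "E - A \<in> ?n N" by blast
    moreover have "E - A \<inter> E = E - A" by blast
    ultimately show "\<exists>B\<in>?n M. E - B \<in> ?n N" by metis
  next
    assume "\<exists>B\<in>?n M. E - B \<in> ?n N"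
    then obtain B where B: "B \<in> ?n M" "E - B \<in> ?n N" by blast
    moreover have "B \<in> sets G \<and> B \<inter> E = B"
      using B(1) assms by (auto simp: null_sets_def sets_restrict_space sets_restr_to_subalg)
    ultimately show "\<exists>A\<in>sets G. A \<inter> E \<in> ?n M \<and> E - A \<in> ?n N" by metis
  qed
  finally show ?thesis .
qed

end

theory Submission
  imports Defs
begin

text \<open>
  Write \<open>Y = sqrt (z z')\<close>. The maximal inequality for \<open>1/z\<close> under \<open>\<mu>\<close> shows that \<open>z\<close> is bounded away from
  zero \<open>\<mu>\<close>-almost everywhere, so zero is absorbing. If both densities stay above a positive constant on
  \<open>[0,T]\<close>, then \<open>Y_-\<close> does too, and \<open>h_T\<close> is at most a multiple of \<open>A_T\<close>, which is finite because the mean of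
  \<open>A\<close> is at most one. Hence on \<open>E\<^sup>c\<close> the infimum of \<open>z\<close> or of \<open>z'\<close> vanishes, and the event that the infimum of \<open>z\<close>
  vanishes separates the two measures.

  For the equivalence on \<open>E\<close> the only nontrivial point is that \<open>z_\<infinity> > 0\<close> when \<open>z\<close> never vanishes and
  \<open>h_\<infinity> < \<infinity>\<close>. Start at a time \<open>t\<close> at which \<open>z_t \<approx> p\<^sup>2\<close> is small, \<open>z'_t \<approx> 2\<close>, and at most \<open>1/64\<close> of \<open>h_\<infinity>\<close> is
  left. As long as \<open>z \<le> 32 p\<^sup>2\<close>, \<open>Y\<close> is at most \<open>8p\<close>, so \<open>A = Y_- \<bullet> h\<close> grows by at most \<open>p/8\<close> and the mean of \<open>Y\<close>
  remains of order \<open>p\<close>. The mean of \<open>z\<close> is \<open>p\<^sup>2\<close>, so by the inequality of Cauchy and Schwarz \<open>Y\<close> cannot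
  live on a set of small conditional probability: conditionally on \<open>F_t\<close>, the event that \<open>z_\<infinity> = 0\<close> and \<open>h\<close> stays
  below its level misses a fixed fraction of the mass. Approximating that event by events of the past shows that
  it is null. Predictability of \<open>h\<close> enters when the process is stopped just before \<open>h\<close> exceeds its level,
  where \<open>h\<close> may have a large jump.
\<close>

subsection \<open>Approximation of measurable sets\<close>

text \<open>The filtration is not complete and path properties hold only almost everywhere, so first
  entry times of paths need not be stopping times. Random times are therefore replaced by rational
  times, where first-entry arguments are exact, and by finite grids, where stopping only involves
  events of \<open>F\<close> at grid points. The decomposition \<open>Y = M - A\<close> enters
  through means of increments over sets of the past.

  The numerical constants balance at the scale p. At the start \<open>Y\<close> is at least p/2, and
  the growth of \<open>A\<close> leaves a mean of 3p/8 times the mass of the starting event. The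
  inequality of Cauchy and Schwarz is used in the linear form \<open>Y \<le> z/(8p) + 2p z'\<close>.
  Its first term accounts for p/8 of that mass; the remaining p/4 must sit on an exceptional set,
  where the second term is at most 4p because \<open>z' \<le> 2\<close>. So the exceptional set has
  at least 1/16 of the mass. The level 32 is chosen so that the paths on which \<open>z\<close>
  overshoots fill at most half of this. The resulting fraction 1/32 does not depend on p, which
  allows summation over all scales of \<open>z\<close>.\<close>

lemma (in finite_measure) approx_by_algebra:
  assumes alg: "algebra (space M) \<A>" and gen: "sets M = sigma_sets (space M) \<A>"
    and B: "B \<in> sets M" and e: "0 < (e::real)"
  shows "\<exists>C\<in>\<A>. measure M ((B - C) \<union> (C - B)) < e"
proof -
  interpret A: algebra "space M" \<A> by fact
  have AM: "\<A> \<subseteq> sets M" using gen by auto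
  \<comment> \<open>The error is quantified inside the induction because the union case calls the
    hypothesis with a smaller one.\<close>
  have "\<forall>e>0. \<exists>C\<in>\<A>. measure M ((B - C) \<union> (C - B)) < e"
    using B unfolding gen
  proof (induction rule: sigma_sets.induct)
    case (Basic a)
    then show ?case by (auto intro!: bexI[of _ a])
  next
    case Empty
    then show ?case by (auto intro!: bexI[of _ "{}"])
  next
    case (Compl a)
    have a: "a \<subseteq> space M" using Compl(1) gen sets.sets_into_space by blast
    show ?case
    proof (intro allI impI)
      fix e :: real assume "0 < e"
      with Compl obtain C where C: "C \<in> \<A>" "measure M ((a - C) \<union> (C - a)) < e" by blast
      have "(space M - a - (space M - C)) \<union> (space M - C - (space M - a)) = (a - C) \<union> (C - a)"
        using a C(1) A.space_closed by auto
      with C show "\<exists>C\<in>\<A>. measure M ((space M - a - C) \<union> (C - (space M - a))) < e"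
        by (intro bexI[of _ "space M - C"]) auto
    qed
  next
    case (Union a)
    have aM [measurable]: "a i \<in> sets M" for i using Union(1) gen by auto
    show ?case
    proof (intro allI impI)
      fix e :: real assume e: "0 < e"
      \<comment> \<open>An algebra is closed under finite unions only, so the union is cut off at
        the cost of e/2; the other half of the error is shared by the n remaining sets, with n + 1
        in the denominator to allow n = 0.\<close>
      define U where "U n = (\<Union>i\<in>{..<n}. a i)" for n :: nat
      have [measurable]: "U n \<in> sets M" for n unfolding U_def by auto
      have "(\<lambda>n. measure M (U n)) \<longlonglongrightarrow> measure M (\<Union>n. U n)"
        by (intro finite_Lim_measure_incseq) (auto simp: incseq_def U_def intro: less_le_trans)
      moreover have UU: "(\<Union>n. U n) = (\<Union>i. a i)" by (auto simp: U_def)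
      ultimately have "\<forall>\<^sub>F n in sequentially. dist (measure M (U n)) (measure M (\<Union>i. a i)) < e/2"
        using e by (intro tendstoD) auto
      then obtain n where n: "dist (measure M (U n)) (measure M (\<Union>i. a i)) < e/2"
        by (auto simp: eventually_sequentially)
      have sub: "U n \<subseteq> (\<Union>i. a i)" by (auto simp: U_def)
      have m1: "measure M ((\<Union>i. a i) - U n) < e/2"
        using n sub finite_measure_mono[OF sub]
        by (subst finite_measure_Diff) (auto simp: dist_real_def)
      have "0 < e / (2 * (real n + 1))" using e by simp
      then have "\<forall>i. \<exists>C\<in>\<A>. measure M ((a i - C) \<union> (C - a i)) < e / (2 * (real n + 1))"
        using Union by blast
      then obtain C where C: "\<And>i. C i \<in> \<A>"
        "\<And>i. measure M ((a i - C i) \<union> (C i - a i)) < e / (2 * (real n + 1))" by metis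
      have [measurable]: "C i \<in> sets M" for i using C AM by auto
      let ?C = "\<Union>i<n. C i"
      let ?D = "\<lambda>i. (a i - C i) \<union> (C i - a i)"
      have "measure M (((\<Union>i. a i) - ?C) \<union> (?C - (\<Union>i. a i)))
          \<le> measure M (((\<Union>i. a i) - U n) \<union> (\<Union>i<n. ?D i))"
        by (intro finite_measure_mono) (auto simp: U_def)
      also have "\<dots> \<le> measure M ((\<Union>i. a i) - U n) + measure M (\<Union>i<n. ?D i)"
        by (intro measure_Un_le) auto
      also have "measure M (\<Union>i<n. ?D i) \<le> (\<Sum>i<n. measure M (?D i))"
        by (intro measure_UNION_le) auto
      also have "\<dots> \<le> (\<Sum>i<n. e / (2 * (real n + 1)))"
        by (intro sum_mono less_imp_le C)
      also have "\<dots> \<le> e/2"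
        using e by (simp add: field_simps)
      finally have "measure M (((\<Union>i. a i) - ?C) \<union> (?C - (\<Union>i. a i))) < e"
        using m1 by linarith
      moreover have "?C \<in> \<A>" using C by auto
      ultimately show "\<exists>C\<in>\<A>. measure M ((\<Union>(range a) - C) \<union> (C - \<Union>(range a))) < e" by blast
    qed
  qed
  with e show ?thesis by blast
qed

text \<open>The argument is the one for Borel sets: those sets that can be approximated from outside
  together with their complements form a sigma-algebra. Carrying the complement along in the
  induction makes the complement case trivial, at the price of the second base case. The
  intersection with \<open>V\<close> is there because open predictable sets never contain the time
  0.\<close>

lemma (in finite_measure) outer_regular:
  assumes gen: "sets M = sigma_sets (space M) \<G>" and UM: "\<U> \<subseteq> sets M"
    and un: "\<And>W :: nat \<Rightarrow> 'a set. range W \<subseteq> \<U> \<Longrightarrow> (\<Union>i. W i) \<in> \<U>"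
    and int: "\<And>a b. a \<in> \<U> \<Longrightarrow> b \<in> \<U> \<Longrightarrow> a \<inter> b \<in> \<U>"
    and E: "{} \<in> \<U>" and V: "V \<in> \<U>"
    and base: "\<And>G e. G \<in> \<G> \<Longrightarrow> 0 < (e::real) \<Longrightarrow> \<exists>U\<in>\<U>. G \<inter> V \<subseteq> U \<and> measure M (U - G) < e"
    and base': "\<And>G e. G \<in> \<G> \<Longrightarrow> 0 < (e::real) \<Longrightarrow>
      \<exists>U\<in>\<U>. (space M - G) \<inter> V \<subseteq> U \<and> measure M (U - (space M - G)) < e"
    and X: "X \<in> sets M" and e: "0 < (e::real)"
  shows "\<exists>U\<in>\<U>. X \<inter> V \<subseteq> U \<and> measure M (U - X) < e"
proof -
  define P where "P X \<longleftrightarrow> (\<forall>e>0. \<exists>U\<in>\<U>. X \<inter> V \<subseteq> U \<and> measure M (U - X) < (e::real))" for X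
  have "P X \<and> P (space M - X)"
    using X unfolding gen
  proof (induction rule: sigma_sets.induct)
    case (Basic a)
    then show ?case using base base' by (auto simp: P_def)
  next
    case Empty
    have d: "V - space M = {}" using V UM sets.sets_into_space by blast
    have "measure M (V - space M) = 0" unfolding d by simp
    then have "P (space M)" unfolding P_def by (intro allI impI bexI[OF _ V] conjI Int_lower2) (simp only:)
    moreover have "P {}" using E unfolding P_def by (intro allI impI bexI[of _ "{}"]) auto
    ultimately show ?case by simp
  next
    case (Compl a)
    have "space M - (space M - a) = a" using Compl(1) gen sets.sets_into_space by blast
    then show ?case using Compl by simp
  next
    case (Union a)
    have aM [measurable]: "a i \<in> sets M" for i using Union(1) gen by auto
    have "P (\<Union>i. a i)" unfolding P_def
    proof (intro allI impI)
      fix e :: real assume e: "0 < e"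
      have "\<forall>i. \<exists>U\<in>\<U>. a i \<inter> V \<subseteq> U \<and> measure M (U - a i) < (e/2) * (1/2)^(Suc i)"
      proof
        fix i
        have "P (a i)" using Union(2) by blast
        moreover have "0 < (e/2) * (1/2)^(Suc i)" using e by simp
        ultimately show "\<exists>U\<in>\<U>. a i \<inter> V \<subseteq> U \<and> measure M (U - a i) < (e/2) * (1/2)^(Suc i)"
          unfolding P_def by blast
      qed
      then obtain U where U: "\<And>i. U i \<in> \<U>" "\<And>i. a i \<inter> V \<subseteq> U i"
        "\<And>i. measure M (U i - a i) < (e/2) * (1/2)^(Suc i)" by metis
      have [measurable]: "U i \<in> sets M" for i using U UM by auto
      have s: "(\<lambda>i. (e/2) * (1/2)^(Suc i)) sums (e/2)"
        using sums_mult[OF power_half_series, of "e/2"] by simp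
      have sm: "summable (\<lambda>i. measure M (U i - a i))"
        by (rule summable_comparison_test'[OF sums_summable[OF s], of 0])
          (use U(3) in \<open>auto intro: less_imp_le\<close>)
      have "measure M ((\<Union>i. U i) - (\<Union>i. a i)) \<le> measure M (\<Union>i. U i - a i)"
        by (intro finite_measure_mono) auto
      also have "\<dots> \<le> (\<Sum>i. measure M (U i - a i))"
        by (intro finite_measure_subadditive_countably sm) auto
      also have "\<dots> \<le> (\<Sum>i. (e/2) * (1/2)^(Suc i))"
        by (intro suminf_le sm sums_summable[OF s] less_imp_le U(3))
      also have "\<dots> < e" using s e by (simp add: sums_iff)
      finally show "\<exists>U\<in>\<U>. \<Union> (range a) \<inter> V \<subseteq> U \<and> measure M (U - \<Union> (range a)) < e"
        using U un[of U] by (intro bexI[of _ "\<Union>i. U i"]) auto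
    qed
    moreover have "P (space M - (\<Union>i. a i))" unfolding P_def
    proof (intro allI impI)
      fix e :: real assume e: "0 < e"
      \<comment> \<open>Dually to the union case, \<U> is closed under finite intersections only, so
        the complement is first replaced by that of a finite union.\<close>
      define c where "c n = space M - (\<Union>i<n. a i)" for n :: nat
      have [measurable]: "c n \<in> sets M" for n unfolding c_def by auto
      have "(\<lambda>n. measure M (c n)) \<longlonglongrightarrow> measure M (\<Inter>n. c n)"
        by (intro finite_Lim_measure_decseq) (auto simp: decseq_def c_def)
      moreover have cc: "(\<Inter>n. c n) = space M - (\<Union>i. a i)" by (auto simp: c_def)
      ultimately have "\<forall>\<^sub>F n in sequentially. dist (measure M (c n)) (measure M (space M - (\<Union>i. a i))) < e/2"
        using e by (intro tendstoD) auto
      then obtain n where n: "dist (measure M (c n)) (measure M (space M - (\<Union>i. a i))) < e/2"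
        by (auto simp: eventually_sequentially)
      have sub: "space M - (\<Union>i. a i) \<subseteq> c n" by (auto simp: c_def)
      have m1: "measure M (c n - (space M - (\<Union>i. a i))) < e/2"
        using n sub finite_measure_mono[OF sub]
        by (subst finite_measure_Diff) (auto simp: dist_real_def)
      have "0 < e / (2 * (real n + 1))" using e by simp
      then have "\<forall>i. \<exists>U\<in>\<U>. (space M - a i) \<inter> V \<subseteq> U \<and> measure M (U - (space M - a i)) < e / (2 * (real n + 1))"
        using Union(2) unfolding P_def by blast
      then obtain U where U: "\<And>i. U i \<in> \<U>" "\<And>i. (space M - a i) \<inter> V \<subseteq> U i"
        "\<And>i. measure M (U i - (space M - a i)) < e / (2 * (real n + 1))" by metis
      have [measurable]: "U i \<in> sets M" for i using U UM by auto
      define W where "W k = V \<inter> (\<Inter>i<k. U i)" for k :: nat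
      have W: "W k \<in> \<U>" for k
      proof (induction k)
        case (Suc k)
        have "W (Suc k) = W k \<inter> U k" by (auto simp: W_def lessThan_Suc)
        with Suc int U show ?case by simp
      qed (simp add: W_def V)
      have [measurable]: "V \<in> sets M" using V UM by auto
      have "measure M (W n - (space M - (\<Union>i. a i)))
          \<le> measure M ((c n - (space M - (\<Union>i. a i))) \<union> (\<Union>i<n. U i - (space M - a i)))"
        using sets.sets_into_space[OF \<open>V \<in> sets M\<close>]
        by (intro finite_measure_mono) (auto simp: W_def c_def)
      also have "\<dots> \<le> measure M (c n - (space M - (\<Union>i. a i))) + measure M (\<Union>i<n. U i - (space M - a i))"
        by (intro measure_Un_le) auto
      also have "measure M (\<Union>i<n. U i - (space M - a i)) \<le> (\<Sum>i<n. measure M (U i - (space M - a i)))"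
        by (intro measure_UNION_le) auto
      also have "\<dots> \<le> (\<Sum>i<n. e / (2 * (real n + 1)))"
        by (intro sum_mono less_imp_le U)
      also have "\<dots> \<le> e/2"
        using e by (simp add: field_simps)
      finally have "measure M (W n - (space M - (\<Union>i. a i))) < e"
        using m1 by linarith
      moreover have "(space M - (\<Union>i. a i)) \<inter> V \<subseteq> W n" using U(2) by (auto simp: W_def)
      ultimately show "\<exists>U\<in>\<U>. (space M - \<Union> (range a)) \<inter> V \<subseteq> U \<and> measure M (U - (space M - \<Union> (range a))) < e"
        using W by (intro bexI[of _ "W n"]) auto
    qed
    ultimately show ?case by simp
  qed
  then show ?thesis using e by (auto simp: P_def)
qed

text \<open>The common core of both maximal inequalities. A finite union is split according to the
  first index at which \<open>C\<close> occurs; the piece belonging to q lies in \<open>F q\<close>,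
  where the two measures can be compared. A countable dense index set has no first entry, hence the
  detour through finite subsets and a monotone limit.\<close>

lemma (in filtration) emeasure_first_entry_le:
  assumes D: "countable D" and M1: "\<And>i. sets (F i) \<subseteq> sets M1" and M2: "\<And>i. sets (F i) \<subseteq> sets M2"
    and C: "\<And>q. q \<in> D \<Longrightarrow> C q \<in> sets (F q)"
    and le: "\<And>q X. q \<in> D \<Longrightarrow> X \<in> sets (F q) \<Longrightarrow> X \<subseteq> C q \<Longrightarrow> emeasure M1 X \<le> emeasure M2 X"
  shows "emeasure M1 (\<Union>q\<in>D. C q) \<le> emeasure M2 (\<Union>q\<in>D. C q)"
proof -
  have fin: "emeasure M1 (\<Union>q\<in>R. C q) \<le> emeasure M2 (\<Union>q\<in>R. C q)" if R: "finite R" "R \<subseteq> D" for R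
  proof -
    define B where "B q = C q - (\<Union>r\<in>{r\<in>R. r < q}. C r)" for q
    have "C r \<in> sets (F q)" if "r \<in> R" "r < q" for r q
      using C[of r] sets_F_mono[of r q] that R by (auto intro: less_imp_le)
    then have BF: "B q \<in> sets (F q)" if "q \<in> R" for q
      unfolding B_def using C that R by (intro sets.Diff sets.finite_UN) auto
    have dis: "disjoint_family_on B R"
      by (auto simp: disjoint_family_on_def B_def) (metis linorder_neqE)
    have UB: "(\<Union>q\<in>R. C q) = (\<Union>q\<in>R. B q)"
    proof (intro equalityI subsetI)
      fix w assume "w \<in> (\<Union>q\<in>R. C q)"
      then have ne: "{q\<in>R. w \<in> C q} \<noteq> {}" by auto
      let ?q = "Min {q\<in>R. w \<in> C q}"
      have q: "?q \<in> {q\<in>R. w \<in> C q}" using ne R by (intro Min_in) auto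
      have "\<not> r < ?q" if "r \<in> R" "w \<in> C r" for r
      proof -
        have "?q \<le> r" by (rule Min_le) (use that R in auto)
        then show ?thesis by (rule leD)
      qed
      with q have "w \<in> B ?q" unfolding B_def by blast
      with q show "w \<in> (\<Union>q\<in>R. B q)" by blast
    qed (auto simp: B_def)
    have s1: "emeasure M1 (\<Union>q\<in>R. B q) = (\<Sum>q\<in>R. emeasure M1 (B q))"
      using BF M1 R dis by (intro sum_emeasure[symmetric]) auto
    have s2: "emeasure M2 (\<Union>q\<in>R. B q) = (\<Sum>q\<in>R. emeasure M2 (B q))"
      using BF M2 R dis by (intro sum_emeasure[symmetric]) auto
    have "(\<Sum>q\<in>R. emeasure M1 (B q)) \<le> (\<Sum>q\<in>R. emeasure M2 (B q))"
      using le BF R by (intro sum_mono) (auto simp: B_def)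
    then show ?thesis by (simp add: UB s1 s2)
  qed
  show ?thesis
  proof (cases "D = {}")
    case False
    define R where "R n = from_nat_into D ` {..<n}" for n :: nat
    have R: "finite (R n)" "R n \<subseteq> D" for n
      using from_nat_into[OF False] by (auto simp: R_def)
    have UR: "(\<Union>n. \<Union>q\<in>R n. C q) = (\<Union>q\<in>D. C q)"
    proof -
      have "(\<Union>n. R n) = from_nat_into D ` (\<Union>n. {..<n})" by (simp add: R_def image_UN)
      also have "(\<Union>n::nat. {..<n}) = UNIV" using lessI by (intro equalityI subset_UNIV subsetI UN_I[of "Suc _"]) auto
      finally have "(\<Union>n. R n) = D" by (simp only: range_from_nat_into[OF False D])
      then show ?thesis by (metis UN_UN_flatten)
    qed
    have inc: "incseq (\<lambda>n. \<Union>q\<in>R n. C q)"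
      unfolding incseq_def R_def by (intro allI impI UN_mono image_mono) auto
    have me: "(\<Union>q\<in>R n. C q) \<in> sets M" if "\<And>i. sets (F i) \<subseteq> sets M" for n and M :: "'a measure"
    proof (rule sets.finite_UN[OF R(1)])
      show "C q \<in> sets M" if "q \<in> R n" for q
        using C[of q] R(2)[of n] \<open>q \<in> R n\<close> \<open>\<And>i. sets (F i) \<subseteq> sets M\<close> by (meson subsetD)
    qed
    have "emeasure M1 (\<Union>q\<in>D. C q) = (SUP n. emeasure M1 (\<Union>q\<in>R n. C q))"
      by (subst UR[symmetric], rule SUP_emeasure_incseq[OF _ inc, symmetric], intro image_subsetI me[OF M1])
    also have "\<dots> \<le> (SUP n. emeasure M2 (\<Union>q\<in>R n. C q))"
      by (rule SUP_mono, rule bexI, rule fin[OF R], rule UNIV_I)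
    also have "\<dots> = emeasure M2 (\<Union>q\<in>D. C q)"
      by (subst UR[symmetric], rule SUP_emeasure_incseq[OF _ inc], intro image_subsetI me[OF M2])
    finally show ?thesis .
  qed simp
qed

subsection \<open>Rational times and predictable sets\<close>

text \<open>Since \<open>ennreal\<close> sends negative numbers to 0, the range over all rationals
  consists of the finite nonnegative rational times, 0 included.\<close>

definition rat_times :: "ennreal set" where
  "rat_times = range (\<lambda>r::rat. ennreal (real_of_rat r))"

lemma countable_rat_times [simp, intro]: "countable rat_times"
  by (simp add: rat_times_def)

lemma rat_times_finite: "q \<in> rat_times \<Longrightarrow> q < \<infinity>"
  by (auto simp: rat_times_def)

lemma rat_times_dense:
  fixes s t :: ennreal
  assumes "s < t"
  shows "\<exists>q\<in>rat_times. s < q \<and> q < t"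
  using ennreal_rat_dense[OF assms] by (auto simp: rat_times_def)

abbreviation predictable_generator :: "'a set \<Rightarrow> (ennreal \<Rightarrow> 'a measure) \<Rightarrow> ('a \<times> ennreal) set set" where
  "predictable_generator \<Omega> F \<equiv> {A \<times> {0} | A. A \<in> sets (F 0)} \<union>
      {A \<times> {s<..t} | A s t. s \<le> t \<and> t < \<infinity> \<and> A \<in> sets (F s)}"

lemma predictable_generator_closed:
  assumes "filtration \<Omega> F"
  shows "predictable_generator \<Omega> F \<subseteq> Pow (\<Omega> \<times> {..<\<infinity>})"
proof -
  interpret filtration \<Omega> F by fact
  have "A \<subseteq> \<Omega>" if "A \<in> sets (F s)" for A s
    using sets.sets_into_space[OF that] by (simp add: space_F)
  then show ?thesis by (auto simp: subset_eq)
qed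

lemma sets_predictable_sigma:
  assumes "filtration \<Omega> F"
  shows "sets (predictable_sigma \<Omega> F) = sigma_sets (\<Omega> \<times> {..<\<infinity>}) (predictable_generator \<Omega> F)"
  unfolding predictable_sigma_def by (rule sets_measure_of[OF predictable_generator_closed[OF assms]])

lemma space_predictable_sigma:
  assumes "filtration \<Omega> F"
  shows "space (predictable_sigma \<Omega> F) = \<Omega> \<times> {..<\<infinity>}"
  unfolding predictable_sigma_def by (rule space_measure_of[OF predictable_generator_closed[OF assms]])

lemma predictable_sigma_Ioc:
  assumes "filtration \<Omega> F" "A \<in> sets (F s)" "t < \<infinity>"
  shows "A \<times> {s<..t} \<in> sets (predictable_sigma \<Omega> F)"
proof (cases "s \<le> t")
  case True
  then show ?thesis unfolding sets_predictable_sigma[OF assms(1)] using assms by blast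
qed simp

lemma predictable_sigma_Ioo:
  assumes F: "filtration \<Omega> F" and "A \<in> sets (F s)"
  shows "A \<times> {s<..<t} \<in> sets (predictable_sigma \<Omega> F)"
proof -
  have "A \<times> {s<..<t} = (\<Union>q\<in>{q\<in>rat_times. q < t}. A \<times> {s<..q})"
    using rat_times_dense by (fastforce intro: less_imp_le)
  also have "\<dots> \<in> sets (predictable_sigma \<Omega> F)"
    using predictable_sigma_Ioc[OF assms] rat_times_finite
    by (intro sets.countable_UN'') auto
  finally show ?thesis .
qed

lemma measurable_section_time:
  assumes F: "filtration \<Omega> F" and "w \<in> \<Omega>"
  shows "(\<lambda>s::real. (w, ennreal s)) \<in> borel \<rightarrow>\<^sub>M predictable_sigma \<Omega> F"
  unfolding predictable_sigma_def
proof (rule measurable_measure_of[OF predictable_generator_closed[OF F]])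
  show "(\<lambda>s::real. (w, ennreal s)) \<in> space borel \<rightarrow> \<Omega> \<times> {..<\<infinity>}" using assms by auto
  have "(\<lambda>s. (w, ennreal s)) -` (A \<times> I) = (if w \<in> A then ennreal -` I else {})" for A I by auto
  then show "(\<lambda>s. (w, ennreal s)) -` y \<inter> space borel \<in> sets borel"
    if "y \<in> predictable_generator \<Omega> F" for y
    using that by (auto intro!: measurable_sets_borel[OF measurable_ennreal])
qed

lemma measurable_section_sample:
  assumes F: "filtration \<Omega> F" and "t < \<infinity>"
  shows "(\<lambda>w. (w, t)) \<in> F t \<rightarrow>\<^sub>M predictable_sigma \<Omega> F"
proof -
  interpret filtration \<Omega> F by fact
  show ?thesis unfolding predictable_sigma_def
  proof (rule measurable_measure_of[OF predictable_generator_closed[OF F]])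
    show "(\<lambda>w. (w, t)) \<in> space (F t) \<rightarrow> \<Omega> \<times> {..<\<infinity>}" using assms by (auto simp: space_F)
    have "(\<lambda>w. (w, t)) -` (A \<times> I) \<inter> space (F t) \<in> sets (F t)"
      if "A \<in> sets (F s)" "t \<in> I \<Longrightarrow> s \<le> t" for A s I
    proof (cases "t \<in> I")
      case True
      then have "A \<in> sets (F t)" using that sets_F_mono[of s t] by auto
      moreover have "(\<lambda>w. (w, t)) -` (A \<times> I) = A" using True by auto
      ultimately show ?thesis by simp
    next
      case False
      then have "(\<lambda>w. (w, t)) -` (A \<times> I) = {}" by auto
      then show ?thesis by simp
    qed
    note * = this
    show "(\<lambda>w. (w, t)) -` y \<inter> space (F t) \<in> sets (F t)"
      if "y \<in> predictable_generator \<Omega> F" for y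
      using that
    proof (elim UnE CollectE exE conjE)
      fix A assume "y = A \<times> {0}" "A \<in> sets (F 0)"
      then show ?thesis using *[of A 0 "{0}"] by simp
    next
      fix A s u assume "y = A \<times> {s<..u}" "A \<in> sets (F s)"
      then show ?thesis using *[of A s "{s<..u}"] by (auto split: if_splits)
    qed
  qed
qed

lemma predictable_process_measurable:
  assumes F: "filtration \<Omega> F" and X: "predictable_process \<Omega> F X" and t: "t < \<infinity>"
  shows "X t \<in> borel_measurable (F t)"
  using measurable_compose[OF measurable_section_sample[OF F t] X[unfolded predictable_process_def]]
  by simp

section \<open>Open predictable sets and outer regularity\<close>

abbreviation open_rectangles :: "(ennreal \<Rightarrow> 'a measure) \<Rightarrow> ('a \<times> ennreal) set set" where
  "open_rectangles F \<equiv> {A \<times> {s<..<t} | A s t. s < \<infinity> \<and> A \<in> sets (F s)}"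

text \<open>A sample in A, observed at time s, certifies membership in the rectangle all the way up
  to t. This foresight is what makes it possible to stop before a predictable set is left. The right
  end may be \<infinity>.\<close>

definition open_predictable :: "'a set \<Rightarrow> (ennreal \<Rightarrow> 'a measure) \<Rightarrow> ('a \<times> ennreal) set set" where
  "open_predictable \<Omega> F = {\<Union>R | R. countable R \<and> R \<subseteq> open_rectangles F}"

lemma open_predictable_rect:
  assumes "A \<in> sets (F s)" "s < \<infinity>"
  shows "A \<times> {s<..<t} \<in> open_predictable \<Omega> F"
proof -
  have "A \<times> {s<..<t} \<in> open_rectangles F"
    using assms by (intro CollectI exI[of _ A] exI[of _ s] exI[of _ t]) simp
  then show ?thesis
    unfolding open_predictable_def by (intro CollectI exI[of _ "{A \<times> {s<..<t}}"] conjI) simp_all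
qed

lemma open_predictable_UN:
  assumes I: "countable I" and W: "\<And>i. i \<in> I \<Longrightarrow> W i \<in> open_predictable \<Omega> F"
  shows "(\<Union>i\<in>I. W i) \<in> open_predictable \<Omega> F"
proof -
  have "\<exists>R. countable R \<and> R \<subseteq> open_rectangles F \<and> W i = \<Union>R" if "i \<in> I" for i
    using W[OF that] unfolding open_predictable_def mem_Collect_eq by (elim exE conjE) (intro exI conjI)
  then have "\<forall>i\<in>I. \<exists>R. countable R \<and> R \<subseteq> open_rectangles F \<and> W i = \<Union>R" ..
  from bchoice[OF this] obtain R where R: "\<forall>i\<in>I. countable (R i) \<and> R i \<subseteq> open_rectangles F \<and> W i = \<Union>(R i)" ..
  have "(\<Union>i\<in>I. W i) = (\<Union>i\<in>I. \<Union>(R i))" using R by (intro SUP_cong refl) simp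
  then have "(\<Union>i\<in>I. W i) = \<Union>(\<Union>i\<in>I. R i)" by blast
  moreover have "countable (\<Union>i\<in>I. R i)" using I R by (intro countable_UN) simp_all
  moreover have "(\<Union>i\<in>I. R i) \<subseteq> open_rectangles F" using R by (intro UN_least) simp
  ultimately show ?thesis unfolding open_predictable_def by (intro CollectI exI conjI)
qed

lemma open_predictable_Un:
  "a \<in> open_predictable \<Omega> F \<Longrightarrow> b \<in> open_predictable \<Omega> F \<Longrightarrow> a \<union> b \<in> open_predictable \<Omega> F"
  using open_predictable_UN[of "{a, b}" "\<lambda>x. x"] by auto

lemma open_predictableE:
  assumes "a \<in> open_predictable \<Omega> F"
  obtains R where "countable R" "a = \<Union>R"
    "\<forall>X\<in>R. \<exists>A s t. X = A \<times> {s<..<t} \<and> s < \<infinity> \<and> A \<in> sets (F s)"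
proof -
  obtain R where R: "a = \<Union>R" "countable R" "R \<subseteq> open_rectangles F"
    using assms unfolding open_predictable_def mem_Collect_eq by (elim exE conjE)
  have "\<exists>A s t. X = A \<times> {s<..<t} \<and> s < \<infinity> \<and> A \<in> sets (F s)" if "X \<in> R" for X
    using subsetD[OF R(3) that] unfolding mem_Collect_eq by (elim exE conjE) (intro exI conjI)
  then show thesis
    by (intro that[OF R(2,1)] ballI)
qed

lemma open_predictable_Int:
  assumes F: "filtration \<Omega> F" and ab: "a \<in> open_predictable \<Omega> F" "b \<in> open_predictable \<Omega> F"
  shows "a \<inter> b \<in> open_predictable \<Omega> F"
proof -
  interpret filtration \<Omega> F by fact
  from ab(1) obtain R where R: "countable R" "a = \<Union>R"
    "\<forall>X\<in>R. \<exists>A s t. X = A \<times> {s<..<t} \<and> s < \<infinity> \<and> A \<in> sets (F s)"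
    by (rule open_predictableE)
  from ab(2) obtain R' where R': "countable R'" "b = \<Union>R'"
    "\<forall>X\<in>R'. \<exists>A s t. X = A \<times> {s<..<t} \<and> s < \<infinity> \<and> A \<in> sets (F s)"
    by (rule open_predictableE)
  have "X \<inter> Y \<in> open_predictable \<Omega> F" if XY: "X \<in> R" "Y \<in> R'" for X Y
  proof -
    obtain A s t where X: "X = A \<times> {s<..<t}" "s < \<infinity>" "A \<in> sets (F s)" using bspec[OF R(3) XY(1)] by metis
    obtain B s' t' where Y: "Y = B \<times> {s'<..<t'}" "s' < \<infinity>" "B \<in> sets (F s')" using bspec[OF R'(3) XY(2)] by metis
    have "A \<in> sets (F (max s s'))" "B \<in> sets (F (max s s'))"
      using subsetD[OF sets_F_mono[of s "max s s'"]] subsetD[OF sets_F_mono[of s' "max s s'"]] X(3) Y(3)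
      by simp_all
    then have "A \<inter> B \<in> sets (F (max s s'))" by (rule sets.Int)
    moreover have "max s s' < \<infinity>" using X(2) Y(2) by simp
    ultimately have "(A \<inter> B) \<times> {max s s'<..<min t t'} \<in> open_predictable \<Omega> F"
      by (rule open_predictable_rect)
    moreover have "X \<inter> Y = (A \<inter> B) \<times> {max s s'<..<min t t'}"
      unfolding X(1) Y(1) by (simp only: Times_Int_Times Int_greaterThanLessThan)
    ultimately show ?thesis by simp
  qed
  then have "(\<Union>X\<in>R. \<Union>Y\<in>R'. X \<inter> Y) \<in> open_predictable \<Omega> F"
    by (intro open_predictable_UN R(1) R'(1))
  moreover have "a \<inter> b = (\<Union>X\<in>R. \<Union>Y\<in>R'. X \<inter> Y)" unfolding R(2) R'(2) by blast
  ultimately show ?thesis by simp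
qed

lemma open_predictable_sets:
  assumes F: "filtration \<Omega> F"
  shows "open_predictable \<Omega> F \<subseteq> sets (predictable_sigma \<Omega> F)"
proof
  fix U assume "U \<in> open_predictable \<Omega> F"
  then obtain R where R: "countable R" "U = \<Union>R"
    "\<forall>X\<in>R. \<exists>A s t. X = A \<times> {s<..<t} \<and> s < \<infinity> \<and> A \<in> sets (F s)"
    by (rule open_predictableE)
  have "R \<subseteq> sets (predictable_sigma \<Omega> F)"
  proof
    fix X assume "X \<in> R"
    then obtain A s t where X: "X = A \<times> {s<..<t}" "A \<in> sets (F s)" using R(3) by blast
    show "X \<in> sets (predictable_sigma \<Omega> F)" unfolding X(1) by (rule predictable_sigma_Ioo[OF F X(2)])
  qed
  then show "U \<in> sets (predictable_sigma \<Omega> F)"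
    unfolding R(2) using R(1) by (rule sets.countable_Union[rotated])
qed

lemma predictable_outer_regular:
  assumes F: "filtration \<Omega> F" and m: "finite_measure m" "sets m = sets (predictable_sigma \<Omega> F)"
    and X: "X \<in> sets m" and e: "0 < (e::real)"
  shows "\<exists>U\<in>open_predictable \<Omega> F. X \<inter> (\<Omega> \<times> {0<..<\<infinity>}) \<subseteq> U \<and> measure m (U - X) < e"
proof -
  interpret filtration \<Omega> F by fact
  interpret finite_measure m by fact
  have sp: "space m = \<Omega> \<times> {..<\<infinity>}"
    using sets_eq_imp_space_eq[OF m(2)] space_predictable_sigma[OF F] by simp
  have \<Omega>: "\<Omega> \<in> sets (F s)" for s using sets.top[of "F s"] by (simp add: space_F)
  have [measurable]: "A \<times> {s<..<t} \<in> sets m" if "A \<in> sets (F s)" for A s t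
    using predictable_sigma_Ioo[OF F that] m(2) by simp
  \<comment> \<open>Generators are closed on the right, open rectangles are not; a strip just after
    s shrinks to the empty set, so the overshoot costs arbitrarily little.\<close>
  have small: "\<exists>s'>s. measure m (\<Omega> \<times> {s<..<s'}) < e" if "s < \<infinity>" "0 < e" for s and e :: real
  proof -
    define W where "W n = \<Omega> \<times> {s<..<s + ennreal (1 / Suc n)}" for n
    have "(\<lambda>n. measure m (W n)) \<longlonglongrightarrow> measure m (\<Inter>n. W n)"
    proof (intro finite_Lim_measure_decseq)
      show "range W \<subseteq> sets m" using \<Omega> by (auto simp: W_def)
      show "decseq W" unfolding W_def decseq_def
      proof (intro allI impI Sigma_mono order_refl subsetI)
        fix k n :: nat and x assume "k \<le> n" "x \<in> {s<..<s + ennreal (1 / real (Suc n))}"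
        moreover from \<open>k \<le> n\<close> have "s + ennreal (1 / real (Suc n)) \<le> s + ennreal (1 / real (Suc k))"
          by (intro add_left_mono ennreal_leI divide_left_mono) auto
        ultimately show "x \<in> {s<..<s + ennreal (1 / real (Suc k))}"
          by (meson greaterThanLessThan_iff less_le_trans)
      qed
    qed
    moreover have "(\<Inter>n. W n) = {}"
    proof (rule ccontr)
      assume "(\<Inter>n. W n) \<noteq> {}"
      then obtain y where y: "\<And>n. y \<in> W n" by blast
      define x where "x = snd y"
      have x: "s < x" "\<And>n. x < s + ennreal (1 / Suc n)"
        using y unfolding W_def x_def by (auto simp: mem_Times_iff simp del: of_nat_Suc)
      from x(1) have "0 < x - s" using diff_gr0_ennreal by blast
      from ennreal_rat_dense[OF this] obtain q :: rat
        where q: "0 < ennreal (real_of_rat q)" "ennreal (real_of_rat q) < x - s" by blast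
      define r where "r = real_of_rat q"
      have r: "0 < r" "ennreal r < x - s" using q by (simp_all add: r_def)
      from r(1) obtain n where "1 / real (Suc n) < r" using nat_approx_posE by blast
      then have "ennreal (1 / real (Suc n)) < x - s" using r
        by (intro le_less_trans[OF ennreal_leI r(2)]) simp
      then have "s + ennreal (1 / real (Suc n)) < s + (x - s)"
        using that by (simp add: ennreal_add_left_cancel_less)
      also have "\<dots> = x" using x(1) by (simp add: add_diff_inverse_ennreal less_imp_le)
      finally show False using x(2)[of n] by simp
    qed
    ultimately have "(\<lambda>n. measure m (W n)) \<longlonglongrightarrow> 0" by simp
    from order_tendstoD(2)[OF this that(2)] obtain n where n: "measure m (W n) < e"
      by (auto simp: eventually_sequentially)
    have "s < s + ennreal (1 / real (Suc n))" using that(1) ennreal_add_left_cancel_less[of s 0 "ennreal (1 / real (Suc n))"]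
      by (simp del: of_nat_Suc)
    with n show ?thesis unfolding W_def by blast
  qed
  have V: "\<Omega> \<times> {0<..<\<infinity>} \<in> open_predictable \<Omega> F" using \<Omega> by (intro open_predictable_rect) auto
  have E: "{} \<in> open_predictable \<Omega> F" using open_predictable_UN[of "{}"] by auto
  show ?thesis
  proof (rule outer_regular[OF _ _ _ _ E V _ _ X e])
    show "sets m = sigma_sets (space m) (predictable_generator \<Omega> F)"
      unfolding sp m(2) by (rule sets_predictable_sigma[OF F])
    show "open_predictable \<Omega> F \<subseteq> sets m" using open_predictable_sets[OF F] m(2) by simp
    show "(\<Union>i. W i) \<in> open_predictable \<Omega> F" if "range W \<subseteq> open_predictable \<Omega> F" for W :: "nat \<Rightarrow> _"
      using that by (intro open_predictable_UN) auto
    show "a \<inter> b \<in> open_predictable \<Omega> F" if "a \<in> open_predictable \<Omega> F" "b \<in> open_predictable \<Omega> F" for a b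
      using open_predictable_Int[OF F that] .
    fix G and e :: real assume G: "G \<in> predictable_generator \<Omega> F" and e: "0 < e"
    show "\<exists>U\<in>open_predictable \<Omega> F. G \<inter> (\<Omega> \<times> {0<..<\<infinity>}) \<subseteq> U \<and> measure m (U - G) < e"
      using G
    proof (elim UnE CollectE exE conjE)
      fix A assume "G = A \<times> {0}"
      then have "G \<inter> (\<Omega> \<times> {0<..<\<infinity>}) = {}" by auto
      with e E show ?thesis by (intro bexI[of _ "{}"]) auto
    next
      fix A s t assume *: "G = A \<times> {s<..t}" "s \<le> t" "t < \<infinity>" "A \<in> sets (F s)"
      then have s: "s < \<infinity>" by auto
      from small[OF *(3) e] obtain t' where t': "t < t'" "measure m (\<Omega> \<times> {t<..<t'}) < e" by auto
      have "A \<subseteq> \<Omega>" using sets.sets_into_space[OF *(4)] by (simp add: space_F)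
      then have "A \<times> {s<..<t'} - G \<subseteq> \<Omega> \<times> {t<..<t'}" unfolding * by auto
      then have "measure m (A \<times> {s<..<t'} - G) \<le> measure m (\<Omega> \<times> {t<..<t'})"
        using \<Omega> by (intro finite_measure_mono) auto
      moreover have "G \<subseteq> A \<times> {s<..<t'}" unfolding * using t' by auto
      ultimately show ?thesis using t'(2) open_predictable_rect[where F=F and s=s and A=A and t=t' and \<Omega>=\<Omega>, OF *(4) s]
        by (intro bexI[of _ "A \<times> {s<..<t'}"]) auto
    qed
    show "\<exists>U\<in>open_predictable \<Omega> F. (space m - G) \<inter> (\<Omega> \<times> {0<..<\<infinity>}) \<subseteq> U \<and> measure m (U - (space m - G)) < e"
      using G
    proof (elim UnE CollectE exE conjE)
      fix A assume G: "G = A \<times> {0}"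
      have "(\<Omega> \<times> {0<..<\<infinity>}) - (space m - G) = {}" unfolding sp G by auto
      then have "measure m ((\<Omega> \<times> {0<..<\<infinity>}) - (space m - G)) < e" using e by (simp only: measure_empty)
      then show ?thesis using V by blast
    next
      fix A s t assume *: "G = A \<times> {s<..t}" "s \<le> t" "t < \<infinity>" "A \<in> sets (F s)"
      then have s: "s < \<infinity>" by auto
      from small[OF s e] obtain s' where s': "s < s'" "measure m (\<Omega> \<times> {s<..<s'}) < e" by auto
      have Ac: "\<Omega> - A \<in> sets (F s)" using *(4) \<Omega> by auto
      \<comment> \<open>The complement of \<open>A \<times> {s<..t}\<close> at positive times
        consists of the samples outside A after s, the times up to s, and the times after t. Only
        the times up to s fail to be open; they are enlarged to s'.\<close>
      let ?U = "((\<Omega> - A) \<times> {s<..<\<infinity>} \<union> \<Omega> \<times> {0<..<s'}) \<union> \<Omega> \<times> {t<..<\<infinity>}"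
      have U: "?U \<in> open_predictable \<Omega> F"
        using Ac \<Omega> s *(3) by (intro open_predictable_Un open_predictable_rect) simp_all
      have "p \<in> ?U" if pp: "p \<in> space m - G" "p \<in> \<Omega> \<times> {0<..<\<infinity>}" for p
      proof -
        obtain a b where p: "p = (a, b)" "a \<in> \<Omega>" "0 < b" "b < \<infinity>" using pp(2) by auto
        have "\<not> (a \<in> A \<and> s < b \<and> b \<le> t)" using pp(1) unfolding sp *(1) p by simp
        moreover have "b < s'" if "b \<le> s" using that s'(1) by (rule le_less_trans)
        ultimately have "(a \<notin> A \<and> s < b) \<or> b < s' \<or> t < b" by (meson not_le)
        then show ?thesis using p(2-4) unfolding p(1) by (elim disjE) simp_all
      qed
      then have sub: "(space m - G) \<inter> (\<Omega> \<times> {0<..<\<infinity>}) \<subseteq> ?U" by blast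
      have "p \<in> \<Omega> \<times> {s<..<s'}" if "p \<in> ?U" "p \<notin> space m - G" for p
        using that unfolding sp *(1) by (cases p) (auto simp: less_top[symmetric])
      then have "measure m (?U - (space m - G)) \<le> measure m (\<Omega> \<times> {s<..<s'})"
        using \<Omega> by (intro finite_measure_mono subsetI) simp_all
      with s'(2) have "measure m (?U - (space m - G)) < e" by simp
      with U sub show ?thesis by blast
    qed
  qed
qed

section \<open>The measure induced by an increasing process on the predictable sigma-algebra\<close>

abbreviation path_measure :: "(real \<Rightarrow> 'a \<Rightarrow> real) \<Rightarrow> 'a \<Rightarrow> real measure" where
  "path_measure B w \<equiv> interval_measure (\<lambda>s. B s w)"

text \<open>This is the Doleans measure of B on ]t0,u], which maps X to the mean of the integral of
  the indicator of X along dB. Monotonicity and right-continuity are required for every sample in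
  \<Omega>, so that each path has an interval measure and no null set has to be carried
  along.\<close>

lemma stieltjes_kernel_measure:
  fixes B :: "real \<Rightarrow> 'a \<Rightarrow> real"
  assumes F: "filtration \<Omega> F" and Q: "space Q = \<Omega>" "\<And>t. sets (F t) \<subseteq> sets Q"
    and mono: "\<And>w. w \<in> \<Omega> \<Longrightarrow> mono (\<lambda>s. B s w)"
    and rc: "\<And>w s. w \<in> \<Omega> \<Longrightarrow> continuous (at_right s) (\<lambda>s. B s w)"
    and meas: "\<And>s. B s \<in> borel_measurable Q" and tu: "t0 \<le> u" "0 \<le> t0"
    and fin: "(\<integral>\<^sup>+w. ennreal (B u w - B t0 w) \<partial>Q) < \<infinity>"
  obtains m where "sets m = sets (predictable_sigma \<Omega> F)" "finite_measure m"
    "\<And>X. X \<in> sets m \<Longrightarrow> emeasure m X =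
      (\<integral>\<^sup>+w. emeasure (path_measure B w) {s\<in>{t0<..u}. (w, ennreal s) \<in> X} \<partial>Q)"
proof -
  interpret filtration \<Omega> F by fact
  note [measurable] = meas
  define \<kappa> where "\<kappa> X w = emeasure (path_measure B w) {s\<in>{t0<..u}. (w, ennreal s) \<in> X}" for X w
  let ?P = "predictable_sigma \<Omega> F"
  have sec: "{s\<in>{t0<..u}. (w, ennreal s) \<in> X} \<in> sets borel" if "w \<in> \<Omega>" "X \<in> sets ?P" for X w
  proof -
    have "{s\<in>{t0<..u}. (w, ennreal s) \<in> X} = {t0<..u} \<inter> ((\<lambda>s. (w, ennreal s)) -` X \<inter> space borel)" by auto
    also have "\<dots> \<in> sets borel"
      using measurable_sets[OF measurable_section_time[OF F that(1)] that(2)] by auto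
    finally show ?thesis .
  qed
  have Ioc: "emeasure (path_measure B w) {a<..b} = (if a \<le> b then ennreal (B b w - B a w) else 0)"
    if "w \<in> \<Omega>" for w a b
    using mono[OF that] rc[OF that] by (subst emeasure_interval_measure_Ioc_eq) (auto simp: mono_def)
  have \<kappa>_UN: "\<kappa> (\<Union>i. X i) w = (\<Sum>i. \<kappa> (X i) w)"
    if disj: "disjoint_family X" and X: "\<And>i. X i \<in> sets ?P" and w: "w \<in> \<Omega>"
    for X :: "nat \<Rightarrow> ('a \<times> ennreal) set" and w
  proof -
    have "disjoint_family (\<lambda>i. {s\<in>{t0<..u}. (w, ennreal s) \<in> X i})"
      using disj unfolding disjoint_family_on_def
      by (intro ballI impI equals0I) (metis (no_types, lifting) IntE IntI UNIV_I empty_iff mem_Collect_eq)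
    then have "(\<Sum>i. \<kappa> (X i) w) = emeasure (path_measure B w) (\<Union>i. {s \<in> {t0<..u}. (w, ennreal s) \<in> X i})"
      unfolding \<kappa>_def using sec[OF w X] by (intro suminf_emeasure image_subsetI) simp_all
    also have "(\<Union>i. {s \<in> {t0<..u}. (w, ennreal s) \<in> X i}) = {s \<in> {t0<..u}. (w, ennreal s) \<in> (\<Union>i. X i)}" by auto
    finally show ?thesis by (simp add: \<kappa>_def)
  qed
  \<comment> \<open>Dynkin's argument: the generator is stable under intersection, the empty set
    being \<open>{} \<times> {0}\<close>. The complement case may subtract because every path has
    finite mass on ]t0,u].\<close>
  have \<kappa>meas: "\<kappa> X \<in> borel_measurable Q" if "X \<in> sets ?P" for X
  proof -
    have IS: "Int_stable (predictable_generator \<Omega> F)"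
    proof (rule Int_stableI)
      fix a b assume "a \<in> predictable_generator \<Omega> F" "b \<in> predictable_generator \<Omega> F"
      then show "a \<inter> b \<in> predictable_generator \<Omega> F"
      proof (elim UnE CollectE exE conjE)
        fix A B assume "a = A \<times> {0}" "A \<in> sets (F 0)" "b = B \<times> {0}" "B \<in> sets (F 0)"
        then have "a \<inter> b = (A \<inter> B) \<times> {0}" "A \<inter> B \<in> sets (F 0)" by auto
        then show ?thesis by blast
      next
        fix A B s t assume "a = A \<times> {0}" "b = B \<times> {s<..t}"
        then have "a \<inter> b = {} \<times> {0}" by auto
        then show ?thesis by blast
      next
        fix A B s t assume "a = B \<times> {s<..t}" "b = A \<times> {0}"
        then have "a \<inter> b = {} \<times> {0}" by auto
        then show ?thesis by blast
      next
        fix A B s t s' t' assume *: "a = A \<times> {s<..t}" "b = B \<times> {s'<..t'}"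
          "A \<in> sets (F s)" "B \<in> sets (F s')" "t < \<infinity>" "t' < \<infinity>"
        show ?thesis
        proof (cases "max s s' \<le> min t t'")
          case True
          have "A \<inter> B \<in> sets (F (max s s'))"
            using * sets_F_mono[of s "max s s'"] sets_F_mono[of s' "max s s'"] by auto
          moreover have "a \<inter> b = (A \<inter> B) \<times> {max s s'<..min t t'}" unfolding * by auto
          moreover have "min t t' < \<infinity>" using *(5) by (rule min.strict_coboundedI1)
          ultimately show ?thesis using True by blast
        next
          case False
          then have "a \<inter> b = {} \<times> {0}" unfolding * by auto
          then show ?thesis by blast
        qed
      qed
    qed
    show ?thesis
    using that unfolding sets_predictable_sigma[OF F]
  proof (induction rule: sigma_sets_induct_disjoint[OF IS predictable_generator_closed[OF F], consumes 1, case_names basic empty compl union])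
    case (basic X)
    then show ?case
    proof (elim UnE CollectE exE conjE)
      fix A assume X: "X = A \<times> {0}"
      have "{s \<in> {t0<..u}. (w, ennreal s) \<in> X} = {}" for w using tu by (auto simp: X ennreal_eq_0_iff)
      then have "\<kappa> X = (\<lambda>_. 0)" unfolding \<kappa>_def by (simp only: emeasure_empty)
      then show ?thesis by simp
    next
      fix A s t assume *: "X = A \<times> {s<..t}" "s \<le> t" "t < \<infinity>" "A \<in> sets (F s)"
      then obtain s' t' where st: "s = ennreal s'" "t = ennreal t'" "0 \<le> s'" "0 \<le> t'"
        by (metis ennreal_cases infinity_ennreal_def leD top_greatest)
      have A: "A \<in> sets Q" using *(4) Q by auto
      have eq: "{x \<in> {t0<..u}. (w, ennreal x) \<in> X} = (if w \<in> A then {max t0 s'<..min u t'} else {})" for w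
        unfolding * st using tu st(3,4) by (auto simp: ennreal_less_iff ennreal_le_iff)
      have "\<kappa> X w = (if w \<in> A then (if max t0 s' \<le> min u t' then ennreal (B (min u t') w - B (max t0 s') w) else 0) else 0)"
        if "w \<in> space Q" for w
        unfolding \<kappa>_def eq using Ioc[of w] that Q(1) by simp
      then show ?thesis using A by (simp cong: measurable_cong)
    qed
  next
    case empty
    then show ?case unfolding \<kappa>_def by simp
  next
    case (compl X)
    have X: "X \<in> sets ?P" using compl(1) unfolding sets_predictable_sigma[OF F] .
    have "\<kappa> (\<Omega> \<times> {..<\<infinity>} - X) w = ennreal (B u w - B t0 w) - \<kappa> X w" if "w \<in> space Q" for w
    proof -
      have w: "w \<in> \<Omega>" using that Q(1) by simp
      let ?\<iota> = "path_measure B w" and ?S = "{s \<in> {t0<..u}. (w, ennreal s) \<in> X}"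
      have eq: "{s \<in> {t0<..u}. (w, ennreal s) \<in> \<Omega> \<times> {..<\<infinity>} - X} = {t0<..u} - ?S"
        using w by (simp add: set_eq_iff) blast
      have S: "?S \<in> sets ?\<iota>" using sec[OF w X] by simp
      have le: "emeasure ?\<iota> ?S \<le> emeasure ?\<iota> {t0<..u}" by (intro emeasure_mono subsetI) simp_all
      have "emeasure ?\<iota> ?S < top" by (rule le_less_trans[OF le]) (simp add: Ioc[OF w] tu)
      then have "emeasure ?\<iota> ?S \<noteq> \<infinity>" by simp
      then show ?thesis unfolding \<kappa>_def eq using Ioc[OF w, of t0 u] tu
        S by (subst emeasure_Diff) (simp_all add: subset_eq)
    qed
    then show ?case using compl(2) by (simp cong: measurable_cong)
  next
    case (union X)
    have X: "X i \<in> sets ?P" for i using union(2) unfolding sets_predictable_sigma[OF F] by auto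
    have "\<kappa> (\<Union>i. X i) w = (\<Sum>i. \<kappa> (X i) w)" if "w \<in> space Q" for w
      using that by (intro \<kappa>_UN[OF union(1) X]) (simp add: Q(1))
    then show ?case using union(3) by (simp cong: measurable_cong)
  qed
  qed
  define m where "m = measure_of (space ?P) (sets ?P) (\<lambda>X. \<integral>\<^sup>+w. \<kappa> X w \<partial>Q)"
  have sm: "sets m = sets ?P" by (simp add: m_def)
  have em: "emeasure m X = (\<integral>\<^sup>+w. \<kappa> X w \<partial>Q)" if "X \<in> sets ?P" for X
    unfolding m_def
  proof (rule emeasure_measure_of_sigma[OF sets.sigma_algebra_axioms _ _ that])
    show "positive (sets ?P) (\<lambda>X. \<integral>\<^sup>+w. \<kappa> X w \<partial>Q)" by (simp add: positive_def \<kappa>_def)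
    show "countably_additive (sets ?P) (\<lambda>X. \<integral>\<^sup>+w. \<kappa> X w \<partial>Q)"
    proof (rule countably_additiveI)
      fix X :: "nat \<Rightarrow> _" assume X: "range X \<subseteq> sets ?P" "disjoint_family X"
      have "\<kappa> (\<Union>i. X i) w = (\<Sum>i. \<kappa> (X i) w)" if "w \<in> space Q" for w
        using that X(1) by (intro \<kappa>_UN[OF X(2)]) (auto simp: Q(1))
      then have "(\<integral>\<^sup>+w. \<kappa> (\<Union>i. X i) w \<partial>Q) = (\<integral>\<^sup>+w. (\<Sum>i. \<kappa> (X i) w) \<partial>Q)"
        by (intro nn_integral_cong)
      also have "\<dots> = (\<Sum>i. \<integral>\<^sup>+w. \<kappa> (X i) w \<partial>Q)"
        using X \<kappa>meas by (intro nn_integral_suminf) auto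
      finally show "(\<Sum>i. \<integral>\<^sup>+w. \<kappa> (X i) w \<partial>Q) = (\<integral>\<^sup>+w. \<kappa> (\<Union>i. X i) w \<partial>Q)" ..
    qed
  qed
  have "finite_measure m"
  proof
    have "emeasure m (space m) = (\<integral>\<^sup>+w. \<kappa> (space m) w \<partial>Q)" using em sm by auto
    also have "\<dots> \<le> (\<integral>\<^sup>+w. ennreal (B u w - B t0 w) \<partial>Q)"
    proof (intro nn_integral_mono)
      fix w assume "w \<in> space Q"
      then have "\<kappa> (space m) w \<le> emeasure (path_measure B w) {t0<..u}"
        unfolding \<kappa>_def by (intro emeasure_mono) auto
      then show "\<kappa> (space m) w \<le> ennreal (B u w - B t0 w)"
        using Ioc[of w t0 u] tu \<open>w \<in> space Q\<close> Q(1) by simp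
    qed
    finally show "emeasure m (space m) \<noteq> \<infinity>" using fin by (auto simp: top_unique)
  qed
  with sm em show thesis by (intro that) (auto simp: \<kappa>_def)
qed

subsection \<open>Increasing paths and their Stieltjes integrals\<close>

lemma filterlim_ennreal_at_right:
  assumes "0 \<le> s"
  shows "filterlim ennreal (at_right (ennreal s)) (at_right s)"
  unfolding filterlim_at
proof
  show "\<forall>\<^sub>F x in at_right s. ennreal x \<in> {ennreal s<..} \<and> ennreal x \<noteq> ennreal s"
    using assms by (auto simp: eventually_at_filter ennreal_less_iff intro!: always_eventually)
  show "(ennreal \<longlongrightarrow> ennreal s) (at_right s)"
    by (intro tendsto_ennrealI tendsto_ident_at)
qed

text \<open>Negative s have to be treated because interval measures live on the whole real line;
  there \<open>ennreal s\<close> is 0 and the path is constant.\<close>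

lemma increasing_path_continuous:
  assumes "increasing_path x"
  shows "((\<lambda>s. x (ennreal s)) \<longlongrightarrow> x (ennreal s)) (at_right s)"
proof (cases "0 \<le> s")
  case True
  have "(x \<longlongrightarrow> x (ennreal s)) (at_right (ennreal s))"
    using assms by (auto simp: increasing_path_def)
  then show ?thesis using filterlim_compose[OF _ filterlim_ennreal_at_right[OF True]] by blast
next
  case False
  have "\<forall>\<^sub>F r in at_right s. r < 0" using False by (intro eventually_at_rightI[of _ 0]) auto
  then have "\<forall>\<^sub>F r in at_right s. x (ennreal s) = x (ennreal r)"
    by eventually_elim (use False in \<open>simp add: ennreal_neg\<close>)
  then show ?thesis by (rule tendsto_eventually[OF eventually_mono]) simp
qed

lemma increasing_path_mono:
  assumes "increasing_path x" "s \<le> t" "t < \<infinity>"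
  shows "x s \<le> x t"
  using assms mono_onD[of "{..<\<infinity>}" x s t] unfolding increasing_path_def by (auto intro: le_less_trans)

lemma interval_measure_truncation:
  fixes x :: "ennreal \<Rightarrow> ennreal" and n :: nat
  assumes x: "increasing_path x" and ab: "a \<le> b"
  shows "emeasure (interval_measure (\<lambda>s. enn2real (min (x (ennreal s)) (of_nat n)))) {a<..b}
    = min (x (ennreal b)) (of_nat n) - min (x (ennreal a)) (of_nat n)"
proof -
  let ?g = "\<lambda>s. enn2real (min (x (ennreal s)) (of_nat n))"
  have fin: "min y (of_nat n) < (top::ennreal)" for y
    by (simp add: min_less_iff_disj ennreal_of_nat_eq_real_of_nat)
  have mono: "?g s \<le> ?g t" if "s \<le> t" for s t
    using that by (intro enn2real_mono fin min.mono increasing_path_mono[OF x] ennreal_leI) auto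
  have rc: "continuous (at_right s) ?g" for s
    unfolding continuous_within using fin
    by (intro tendsto_enn2real) (auto simp: ennreal_enn2real intro!: tendsto_min increasing_path_continuous[OF x])
  have "emeasure (interval_measure ?g) {a<..b} = ennreal (?g b - ?g a)"
    using ab mono rc by (subst emeasure_interval_measure_Ioc) auto
  also have "\<dots> = ennreal (?g b) - ennreal (?g a)" by (simp add: ennreal_minus)
  finally show ?thesis using fin by (simp add: ennreal_enn2real)
qed

text \<open>The integrand is not assumed to be measurable, so additivity of the integral is unavailable.\<close>

lemma nn_integral_le_split:
  assumes A: "A \<in> sets M" and B: "B \<in> sets M"
    and le: "\<And>x. x \<in> space M \<Longrightarrow> f x \<le> (if x \<in> A then g x else if x \<in> B then c else 0)"
    and le0: "\<And>x. x \<in> space M \<Longrightarrow> x \<in> A \<Longrightarrow> g x \<le> k x"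
  shows "(\<integral>\<^sup>+x. f x \<partial>M) \<le> (\<integral>\<^sup>+x. k x \<partial>M) + c * emeasure M B"
proof -
  have "integral\<^sup>S M s \<le> (\<integral>\<^sup>+x. k x \<partial>M) + c * emeasure M B" if s: "simple_function M s" "s \<le> f" for s
  proof -
    \<comment> \<open>Simple functions below f are measurable, so additivity holds for them; the
      integral of f is the supremum of their integrals.\<close>
    have [measurable]: "s \<in> borel_measurable M" using s(1) by (rule borel_measurable_simple_function)
    note [measurable] = A B
    have "integral\<^sup>S M s = (\<integral>\<^sup>+x. s x \<partial>M)" using s(1) by (rule nn_integral_eq_simple_integral[symmetric])
    also have "\<dots> \<le> (\<integral>\<^sup>+x. s x * indicator A x + c * indicator B x \<partial>M)"
    proof (intro nn_integral_mono)
      fix x assume "x \<in> space M"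
      with le[of x] s(2) have "s x \<le> (if x \<in> A then g x else if x \<in> B then c else 0)"
        by (meson le_funD order_trans)
      then show "s x \<le> s x * indicator A x + c * indicator B x"
        by (auto simp: indicator_def split: if_splits)
    qed
    also have "\<dots> = (\<integral>\<^sup>+x. s x * indicator A x \<partial>M) + c * emeasure M B"
      by (subst nn_integral_add) (auto simp: nn_integral_cmult_indicator)
    also have "(\<integral>\<^sup>+x. s x * indicator A x \<partial>M) \<le> (\<integral>\<^sup>+x. k x \<partial>M)"
    proof (intro nn_integral_mono)
      fix x assume "x \<in> space M"
      with le[of x] le0[of x] s(2) show "s x * indicator A x \<le> k x"
        by (auto simp: le_fun_def indicator_def split: if_splits) (meson order_trans)
    qed
    finally show ?thesis by simp
  qed
  then show ?thesis unfolding nn_integral_def[of M f] by (auto intro!: SUP_least)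
qed

lemma stieltjes_le:
  assumes x: "increasing_path x" and r: "0 \<le> r"
    and f: "\<And>s. 0 \<le> s \<Longrightarrow> s \<le> r \<Longrightarrow> f (ennreal s) \<le> c"
  shows "stieltjes f x (ennreal r) \<le> c * x (ennreal r)"
  unfolding stieltjes_def
proof (rule SUP_least)
  fix n :: nat
  \<comment> \<open>The half-open interval in the bound below must contain 0. Any negative left end
    would do: -1 is mapped to time 0, so the interval has the full mass up to r.\<close>
  let ?M = "interval_measure (\<lambda>s. enn2real (min (x (ennreal s)) (of_nat n)))"
  have "(\<integral>\<^sup>+ s. f (ennreal s) * indicator {s. 0 \<le> s \<and> ennreal s \<le> ennreal r} s \<partial>?M)
    \<le> (\<integral>\<^sup>+s. c * indicator {-1<..r} s \<partial>?M)"
    using f r by (intro nn_integral_mono) (auto simp: indicator_def ennreal_le_iff)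
  also have "\<dots> = c * (min (x (ennreal r)) (of_nat n) - min (x (ennreal (-1))) (of_nat n))"
    using interval_measure_truncation[OF x, of "-1" r n] r by (subst nn_integral_cmult_indicator) auto
  also have "\<dots> \<le> c * x (ennreal r)"
    by (intro mult_left_mono order_trans[OF diff_le_self_ennreal]) auto
  finally show "(\<integral>\<^sup>+ s. f (ennreal s) * indicator {s. 0 \<le> s \<and> ennreal s \<le> ennreal r} s \<partial>?M) \<le> c * x (ennreal r)" .
qed

lemma stieltjes_le_add:
  assumes x: "increasing_path x" and r: "0 \<le> r" "r \<le> t" and fin: "x (ennreal t) < \<infinity>"
    and f: "\<And>s. r < s \<Longrightarrow> s \<le> t \<Longrightarrow> f (ennreal s) \<le> c"
  shows "stieltjes f x (ennreal t) \<le> stieltjes f x (ennreal r) + c * (x (ennreal t) - x (ennreal r))"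
  unfolding stieltjes_def[of f x "ennreal t"]
proof (rule SUP_least)
  fix n :: nat
  let ?M = "interval_measure (\<lambda>s. enn2real (min (x (ennreal s)) (of_nat n)))"
  have 1: "(\<integral>\<^sup>+ s. f (ennreal s) * indicator {s. 0 \<le> s \<and> ennreal s \<le> ennreal t} s \<partial>?M)
    \<le> (\<integral>\<^sup>+ s. f (ennreal s) * indicator {s. 0 \<le> s \<and> ennreal s \<le> ennreal r} s \<partial>?M) + c * emeasure ?M {r<..t}"
  proof (rule nn_integral_le_split[where A = "{0..r}" and g = "\<lambda>s. f (ennreal s)"])
    fix s :: real
    show "f (ennreal s) * indicator {s. 0 \<le> s \<and> ennreal s \<le> ennreal t} s
       \<le> (if s \<in> {0..r} then f (ennreal s) else if s \<in> {r<..t} then c else 0)"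
      using f r by (auto simp: indicator_def ennreal_le_iff)
    show "f (ennreal s) \<le> f (ennreal s) * indicator {s. 0 \<le> s \<and> ennreal s \<le> ennreal r} s" if "s \<in> {0..r}"
      using that r by (auto simp: indicator_def ennreal_le_iff)
  qed auto
  have 2: "(\<integral>\<^sup>+ s. f (ennreal s) * indicator {s. 0 \<le> s \<and> ennreal s \<le> ennreal r} s \<partial>?M) \<le> stieltjes f x (ennreal r)"
    unfolding stieltjes_def by (rule SUP_upper) simp
  \<comment> \<open>Truncation at n can only shrink an increment; it becomes zero once the path is
    above n at r.\<close>
  have 3: "emeasure ?M {r<..t} \<le> x (ennreal t) - x (ennreal r)"
  proof -
    have le: "x (ennreal r) \<le> x (ennreal t)" using r by (intro increasing_path_mono[OF x] ennreal_leI) auto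
    have "min (x (ennreal t)) (of_nat n) - min (x (ennreal r)) (of_nat n) \<le> x (ennreal t) - x (ennreal r)"
    proof (cases "x (ennreal r) \<le> of_nat n")
      case True
      then show ?thesis by (auto simp: min_def intro!: ennreal_minus_mono)
    next
      case False
      then have "min (x (ennreal t)) (of_nat n) = of_nat n" "min (x (ennreal r)) (of_nat n) = of_nat n"
        using le by (auto simp: min_def)
      then show ?thesis by (simp add: ennreal_of_nat_eq_real_of_nat)
    qed
    then show ?thesis using interval_measure_truncation[OF x r(2), of n] by simp
  qed
  show "(\<integral>\<^sup>+ s. f (ennreal s) * indicator {s. 0 \<le> s \<and> ennreal s \<le> ennreal t} s \<partial>?M)
    \<le> stieltjes f x (ennreal r) + c * (x (ennreal t) - x (ennreal r))"
    by (rule order_trans[OF 1]) (intro add_mono mult_left_mono 2 3 zero_le)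
qed

subsection \<open>Right-continuous paths with left limits\<close>

lemma at_left_ennreal_neq_bot:
  fixes s :: ennreal
  assumes "0 < s"
  shows "at_left s \<noteq> bot"
proof
  assume "at_left s = bot"
  then have "eventually (\<lambda>_. False) (at_left s)" by simp
  then obtain b where b: "b < s" "\<And>y. b < y \<Longrightarrow> y < s \<Longrightarrow> False"
    using assms by (subst (asm) eventually_at_left[OF assms]) blast
  then show False using dense[OF b(1)] by blast
qed

lemma cadlag_closed:
  assumes x: "cadlag x" and K: "closed K"
    and q: "\<And>q. q \<in> rat_times \<Longrightarrow> a \<le> q \<Longrightarrow> q < v \<Longrightarrow> x q \<in> K"
    and s: "a \<le> s" "s < v"
  shows "x s \<in> K"
proof (rule ccontr)
  assume "x s \<notin> K"
  have "s < \<infinity>" using s(2) by (rule less_le_trans) simp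
  then have "(x \<longlongrightarrow> x s) (at_right s)" using x by (simp add: cadlag_def)
  moreover have "open (- K)" using K by (simp add: open_Compl)
  moreover have "x s \<in> - K" using \<open>x s \<notin> K\<close> by simp
  ultimately have "eventually (\<lambda>y. x y \<in> - K) (at_right s)" by (rule topological_tendstoD)
  then obtain b where b: "s < b" "\<And>y. s < y \<Longrightarrow> y < b \<Longrightarrow> x y \<notin> K"
    by (subst (asm) eventually_at_right[OF s(2)]) auto
  have "s < min b v" using b s by simp
  from rat_times_dense[OF this] obtain q' where q': "q' \<in> rat_times" "s < q'" "q' < b" "q' < v" by auto
  have "x q' \<in> K" by (rule q) (use q' s in auto)
  with b(2)[OF q'(2,3)] show False by simp
qed

lemma cadlag_left_limit_tendsto:
  assumes "cadlag x" "0 < s" "s < \<infinity>"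
  shows "(x \<longlongrightarrow> left_limit x s) (at_left s)"
proof -
  obtain l where l: "(x \<longlongrightarrow> l) (at_left s)" using assms by (auto simp: cadlag_def)
  then have "Lim (at_left s) x = l" using at_left_ennreal_neq_bot[OF assms(2)] by (intro tendsto_Lim)
  with l show ?thesis using assms(2) by (auto simp: left_limit_def)
qed

lemma left_limit_closed:
  assumes x: "cadlag x" and K: "closed K"
    and q: "\<And>q. q \<in> rat_times \<Longrightarrow> a \<le> q \<Longrightarrow> q < s \<Longrightarrow> x q \<in> K"
    and s: "a < s" "s < \<infinity>"
  shows "left_limit x s \<in> K"
proof -
  have s0: "0 < s" using s(1) by (rule le_less_trans[rotated]) simp
  have "eventually (\<lambda>r. x r \<in> K) (at_left s)"
    unfolding eventually_at_left[OF s0]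
    using s(1) cadlag_closed[OF x K q] by (intro exI[of _ a]) auto
  then show ?thesis
    using K at_left_ennreal_neq_bot[OF s0] cadlag_left_limit_tendsto[OF x s0 s(2)]
    by (intro Lim_in_closed_set)
qed

lemma cadlag_sqrt_mult:
  assumes "cadlag x" "cadlag y"
  shows "cadlag (\<lambda>t. sqrt (x t * y t))"
  unfolding cadlag_def
proof (intro allI impI conjI)
  fix t :: ennreal assume t: "t < \<infinity>"
  show "((\<lambda>t. sqrt (x t * y t)) \<longlongrightarrow> sqrt (x t * y t)) (at_right t)"
    using assms t by (intro tendsto_real_sqrt tendsto_mult) (simp_all add: cadlag_def)
  obtain l k where "(x \<longlongrightarrow> l) (at_left t)" "(y \<longlongrightarrow> k) (at_left t)" using assms t by (metis cadlag_def)
  then have "((\<lambda>t. sqrt (x t * y t)) \<longlongrightarrow> sqrt (l * k)) (at_left t)"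
    by (intro tendsto_real_sqrt tendsto_mult)
  then show "\<exists>l. ((\<lambda>t. sqrt (x t * y t)) \<longlongrightarrow> l) (at_left t)" ..
qed

subsection \<open>Density processes\<close>

locale density_pair =
  fixes \<Omega> :: "'a set" and F :: "ennreal \<Rightarrow> 'a measure" and \<mu> \<nu> Q :: "'a measure"
    and z z' :: "ennreal \<Rightarrow> 'a \<Rightarrow> real"
  assumes fs: "filtered_space \<Omega> F"
    and \<mu>: "prob_space \<mu>" "sets \<mu> = sets (F \<infinity>)"
    and \<nu>: "prob_space \<nu>" "sets \<nu> = sets (F \<infinity>)"
    and Q: "Q = mean_measure \<mu> \<nu>"
    and z: "density_process F Q \<mu> z" and z': "density_process F Q \<nu> z'"

sublocale density_pair \<subseteq> filtration \<Omega> F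
  using fs by (simp add: filtered_space_def)

context density_pair
begin

lemma filt: "filtration \<Omega> F" ..

lemma swap: "density_pair \<Omega> F \<nu> \<mu> Q z' z"
proof -
  have "mean_measure \<nu> \<mu> = mean_measure \<mu> \<nu>"
    using \<mu>(2) \<nu>(2) sets_eq_imp_space_eq[of \<mu> \<nu>] unfolding mean_measure_def by (simp add: add.commute)
  then show ?thesis using fs \<mu> \<nu> Q z z' by (simp add: density_pair_def)
qed

lemma sets_Q: "sets Q = sets (F \<infinity>)"
  unfolding Q using \<mu>(2) \<nu>(2) by simp

lemma space_Q: "space Q = \<Omega>"
  using sets_eq_imp_space_eq[OF sets_Q] space_F by simp

lemma space_\<mu>: "space \<mu> = \<Omega>"
  using sets_eq_imp_space_eq[OF \<mu>(2)] space_F by simp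

lemma sets_F_Q: "sets (F t) \<subseteq> sets Q"
  unfolding sets_Q by (rule sets_F_mono) simp

lemma sets_F_QD: "B \<in> sets (F t) \<Longrightarrow> B \<in> sets Q"
  using sets_F_Q by blast

lemma subalg_Q: "subalgebra Q (F t)"
  using sets_F_Q space_Q space_F by (simp add: subalgebra_def)

lemma subalg_\<mu>: "subalgebra \<mu> (F t)"
  using sets_F_Q[of t] sets_Q \<mu>(2) space_\<mu> space_F by (simp add: subalgebra_def)

lemma emeasure_Q: "A \<in> sets Q \<Longrightarrow> emeasure Q A = (emeasure \<mu> A + emeasure \<nu> A) / 2"
  unfolding Q using \<mu>(2) \<nu>(2) by (subst emeasure_mean_measure) simp_all

lemma prob_space_Q: "prob_space Q"
proof
  have "emeasure \<mu> \<Omega> = 1" "emeasure \<nu> \<Omega> = 1"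
    using prob_space.emeasure_space_1[OF \<mu>(1)] prob_space.emeasure_space_1[OF \<nu>(1)]
      space_\<mu> sets_eq_imp_space_eq[OF \<nu>(2)] space_F by simp_all
  then show "emeasure Q (space Q) = 1"
    using emeasure_Q[of \<Omega>] sets.top[of Q] by (simp add: space_Q ennreal_divide_self)
qed

sublocale Q: prob_space Q by (rule prob_space_Q)

lemma null_Q_\<mu>: "N \<in> null_sets Q \<Longrightarrow> N \<in> null_sets \<mu>"
  using emeasure_Q[of N] sets_Q \<mu>(2) by (auto simp: null_sets_def ennreal_divide_eq_0_iff)

lemma AE_Q_\<mu>: "AE w in Q. P w \<Longrightarrow> AE w in \<mu>. P w"
  using null_Q_\<mu> space_Q space_\<mu> by (auto simp: eventually_ae_filter)

lemma measurable_F_Q: "f \<in> borel_measurable (F t) \<Longrightarrow> f \<in> borel_measurable Q"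
  by (rule measurable_from_subalg[OF subalg_Q])

lemma z_F: "z t \<in> borel_measurable (F t)"
  using z by (simp add: density_process_def)

lemma z_Q [measurable]: "z t \<in> borel_measurable Q"
  by (rule measurable_F_Q[OF z_F])

lemma z_mono: "s \<le> t \<Longrightarrow> z s \<in> borel_measurable (F t)"
  using z_F[of s] sets_F_mono[of s t] space_F by (auto simp: measurable_def)

lemma AE_z: "AE w in Q. (\<forall>t. 0 \<le> z t w) \<and> cadlag (\<lambda>t. z t w)"
  using z by (simp add: density_process_def)

lemma AE_z_nonneg: "AE w in Q. 0 \<le> z t w"
  using AE_z by eventually_elim simp

lemma emeasure_\<mu>:
  assumes B: "B \<in> sets (F t)"
  shows "emeasure \<mu> B = (\<integral>\<^sup>+w. ennreal (z t w) * indicator B w \<partial>Q)"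
proof -
  have m: "(\<lambda>w. ennreal (z t w)) \<in> borel_measurable (restr_to_subalg Q (F t))"
    using z_F[of t] by (intro measurable_in_subalg[OF subalg_Q] measurable_compose[OF _ measurable_ennreal])
  have "emeasure \<mu> B = emeasure (restr_to_subalg \<mu> (F t)) B"
    using B by (simp add: emeasure_restr_to_subalg[OF subalg_\<mu>])
  also have "restr_to_subalg \<mu> (F t) = density (restr_to_subalg Q (F t)) (\<lambda>w. ennreal (z t w))"
    using z by (simp add: density_process_def)
  also have "emeasure \<dots> B = (\<integral>\<^sup>+w. ennreal (z t w) * indicator B w \<partial>restr_to_subalg Q (F t))"
    using m B by (intro emeasure_density) (simp_all add: sets_restr_to_subalg[OF subalg_Q])
  also have "\<dots> = (\<integral>\<^sup>+w. ennreal (z t w) * indicator B w \<partial>Q)"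
    by (intro nn_integral_subalgebra2[OF subalg_Q] borel_measurable_times_ennreal
        measurable_compose[OF z_F measurable_ennreal] borel_measurable_indicator B)
  finally show ?thesis .
qed

lemma integrable_z: "integrable Q (z t)"
proof -
  have "(\<integral>\<^sup>+w. ennreal (z t w) \<partial>Q) = emeasure \<mu> (space (F t))"
    unfolding emeasure_\<mu>[OF sets.top] by (intro nn_integral_cong) (simp add: space_F space_Q)
  also have "\<dots> < \<infinity>" using finite_measure.emeasure_finite[OF prob_space.finite_measure[OF \<mu>(1)]]
    by (simp add: less_top[symmetric])
  finally show ?thesis using AE_z_nonneg by (intro integrableI_nonneg) simp_all
qed

lemma measure_\<mu>:
  assumes B: "B \<in> sets (F t)"
  shows "(\<integral>w. indicator B w * z t w \<partial>Q) = measure \<mu> B"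
proof -
  note [measurable] = sets_F_QD[OF B]
  have "(\<integral>w. indicator B w * z t w \<partial>Q) = enn2real (\<integral>\<^sup>+w. ennreal (indicator B w * z t w) \<partial>Q)"
    by (intro integral_eq_nn_integral) (use AE_z_nonneg[of t] in \<open>auto\<close>)
  also have "(\<integral>\<^sup>+w. ennreal (indicator B w * z t w) \<partial>Q) = emeasure \<mu> B"
    unfolding emeasure_\<mu>[OF B] by (intro nn_integral_cong) (simp add: indicator_def)
  finally show ?thesis by (simp add: measure_def)
qed

end

text \<open>Both sides are densities of \<mu> + \<nu> = 2 Q on \<open>F t\<close>. Uniqueness is
  applied in the restricted space, since the densities are compared on sets of \<open>F t\<close>
  only.\<close>

lemma (in density_pair) AE_sum: "AE w in Q. z t w + z' t w = 2"
proof -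
  interpret s: density_pair \<Omega> F \<nu> \<mu> Q z' z by (rule swap)
  let ?R = "restr_to_subalg Q (F t)"
  interpret R: prob_space ?R by (rule prob_space_restr_to_subalg[OF subalg_Q prob_space_Q])
  have zR: "z t \<in> borel_measurable ?R" "z' t \<in> borel_measurable ?R"
    by (intro measurable_in_subalg[OF subalg_Q] z_F s.z_F)+
  have "AE w in ?R. ennreal (z t w) + ennreal (z' t w) = 2"
  proof (rule R.density_unique_finite_measure)
    show "(\<lambda>w. ennreal (z t w) + ennreal (z' t w)) \<in> borel_measurable ?R" using zR by measurable
    fix B assume "B \<in> sets ?R"
    then have B: "B \<in> sets (F t)" by (simp add: sets_restr_to_subalg[OF subalg_Q])
    note [measurable] = sets_F_QD[OF B] z_F s.z_F B
    have half: "2 * (x / 2) = x" for x :: ennreal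
      by (simp add: ennreal_times_divide mult.commute[of 2] mult_divide_eq_ennreal)
    have "(\<integral>\<^sup>+w. (ennreal (z t w) + ennreal (z' t w)) * indicator B w \<partial>?R)
        = (\<integral>\<^sup>+w. (ennreal (z t w) + ennreal (z' t w)) * indicator B w \<partial>Q)"
      by (intro nn_integral_subalgebra2[OF subalg_Q]) measurable
    also have "\<dots> = (\<integral>\<^sup>+w. ennreal (z t w) * indicator B w + ennreal (z' t w) * indicator B w \<partial>Q)"
      by (intro nn_integral_cong) (simp add: distrib_right)
    also have "\<dots> = emeasure \<mu> B + emeasure \<nu> B"
      by (subst nn_integral_add) (simp_all add: emeasure_\<mu>[OF B] s.emeasure_\<mu>[OF B])
    also have "\<dots> = 2 * emeasure Q B"
      by (simp only: emeasure_Q[OF sets_F_QD[OF B]] half)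
    also have "\<dots> = 2 * emeasure ?R B" using emeasure_restr_to_subalg[OF subalg_Q B] by simp
    also have "\<dots> = (\<integral>\<^sup>+w. 2 * indicator B w \<partial>?R)"
      using B by (subst nn_integral_cmult_indicator) (simp_all add: sets_restr_to_subalg[OF subalg_Q])
    finally show "(\<integral>\<^sup>+w. (ennreal (z t w) + ennreal (z' t w)) * indicator B w \<partial>?R) = (\<integral>\<^sup>+w. 2 * indicator B w \<partial>?R)" .
  qed simp_all
  from AE_restr_to_subalg[OF subalg_Q this] AE_z_nonneg[of t] s.AE_z_nonneg[of t]
  show ?thesis
  proof eventually_elim
    case (elim w)
    then have "ennreal (z t w + z' t w) = ennreal 2" by (simp add: ennreal_plus)
    then show ?case using elim by (subst (asm) ennreal_inj) auto
  qed
qed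

text \<open>The maximal inequality for 1/z under \<mu>: where z first falls below c, \<mu> is at
  most c Q on events of that time. Scaling \<open>Q\<close> turns this into a comparison of two
  measures.\<close>

lemma (in density_pair) low_values:
  assumes D: "countable D" and c: "0 \<le> c"
  shows "emeasure \<mu> (\<Union>q\<in>D. {w\<in>\<Omega>. z q w < c}) \<le> ennreal c"
proof -
  have C: "{w\<in>\<Omega>. z q w < c} \<in> sets (F q)" for q
    using z_F[of q] measurable_sets[OF z_F[of q], of "{..<c}"] by (simp add: vimage_def Int_def space_F conj_commute)
  have "emeasure \<mu> (\<Union>q\<in>D. {w\<in>\<Omega>. z q w < c}) \<le> emeasure (scale_measure (ennreal c) Q) (\<Union>q\<in>D. {w\<in>\<Omega>. z q w < c})"
  proof (rule emeasure_first_entry_le[OF D _ _ C])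
    show "sets (F i) \<subseteq> sets \<mu>" for i using sets_F_Q[of i] sets_Q \<mu>(2) by simp
    show "sets (F i) \<subseteq> sets (scale_measure (ennreal c) Q)" for i using sets_F_Q[of i] by simp
    fix q X assume X: "X \<in> sets (F q)" "X \<subseteq> {w\<in>\<Omega>. z q w < c}"
    have "emeasure \<mu> X \<le> (\<integral>\<^sup>+w. ennreal c * indicator X w \<partial>Q)"
      unfolding emeasure_\<mu>[OF X(1)] using X(2)
      by (intro nn_integral_mono) (auto simp: indicator_def subset_eq intro!: ennreal_leI intro: less_imp_le)
    also have "\<dots> = ennreal c * emeasure Q X" using X(1) sets_F_Q by (intro nn_integral_cmult_indicator) auto
    finally show "emeasure \<mu> X \<le> emeasure (scale_measure (ennreal c) Q) X" by simp
  qed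
  also have "\<dots> \<le> ennreal c * 1" unfolding emeasure_scale_measure by (intro mult_left_mono Q.emeasure_le_1) simp
  finally show ?thesis by simp
qed

text \<open>Doob's maximal inequality for the Q-martingale z started at time t, localized to an
  event G of that time.\<close>

lemma (in density_pair) high_values:
  assumes D: "countable D" "\<And>q. q \<in> D \<Longrightarrow> t \<le> q" and c: "0 \<le> c" and G: "G \<in> sets (F t)"
  shows "ennreal c * emeasure Q (\<Union>q\<in>D. {w\<in>G. c < z q w}) \<le> emeasure \<mu> G"
proof -
  have G': "G \<in> sets (F q)" if "q \<in> D" for q using D(2)[OF that] sets_F_mono G by blast
  have G\<Omega>: "G \<subseteq> \<Omega>" using sets.sets_into_space[OF G] by (simp add: space_F)
  have C: "{w\<in>G. c < z q w} \<in> sets (F q)" if "q \<in> D" for q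
  proof -
    have "{w\<in>G. c < z q w} = G \<inter> (z q -` {c<..} \<inter> space (F q))" using G\<Omega> by (auto simp: space_F)
    also have "\<dots> \<in> sets (F q)" using G'[OF that] measurable_sets[OF z_F[of q], of "{c<..}"] by simp
    finally show ?thesis .
  qed
  have \<mu>s: "sets (F i) \<subseteq> sets \<mu>" for i using sets_F_Q[of i] sets_Q \<mu>(2) by simp
  let ?U = "\<Union>q\<in>D. {w\<in>G. c < z q w}"
  have "emeasure (scale_measure (ennreal c) Q) ?U \<le> emeasure \<mu> ?U"
  proof (rule emeasure_first_entry_le[OF D(1) _ \<mu>s C])
    show "sets (F i) \<subseteq> sets (scale_measure (ennreal c) Q)" for i using sets_F_Q[of i] by simp
    fix q X assume X: "X \<in> sets (F q)" "X \<subseteq> {w\<in>G. c < z q w}"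
    have "ennreal c * emeasure Q X = (\<integral>\<^sup>+w. ennreal c * indicator X w \<partial>Q)"
      using X(1) sets_F_Q by (intro nn_integral_cmult_indicator[symmetric]) auto
    also have "\<dots> \<le> emeasure \<mu> X"
      unfolding emeasure_\<mu>[OF X(1)] using X(2)
      by (intro nn_integral_mono) (auto simp: indicator_def subset_eq intro!: ennreal_leI intro: less_imp_le)
    finally show "emeasure (scale_measure (ennreal c) Q) X \<le> emeasure \<mu> X" by simp
  qed
  also have "emeasure \<mu> ?U \<le> emeasure \<mu> G"
    using G \<mu>s by (intro emeasure_mono) auto
  finally show ?thesis by simp
qed

lemma (in density_pair) AE_\<mu>_inf_pos: "AE w in \<mu>. \<exists>e>0. \<forall>q\<in>rat_times. e \<le> z q w"
proof -
  define B where "B n = (\<Union>q\<in>rat_times. {w\<in>\<Omega>. z q w < 1 / real (Suc n)})" for n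
  have Bs: "B n \<in> sets \<mu>" for n
  proof -
    have "{w\<in>space Q. z q w < 1 / real (Suc n)} \<in> sets Q" for q by measurable
    then show ?thesis unfolding B_def using sets_Q \<mu>(2) space_Q
      by (intro sets.countable_UN') auto
  qed
  have "emeasure \<mu> (\<Inter>n. B n) \<le> ennreal (1 / real (Suc n))" for n
  proof -
    have "emeasure \<mu> (\<Inter>n. B n) \<le> emeasure \<mu> (B n)" using Bs by (intro emeasure_mono) auto
    also have "\<dots> \<le> ennreal (1 / real (Suc n))" unfolding B_def by (rule low_values) auto
    finally show ?thesis .
  qed
  then have "emeasure \<mu> (\<Inter>n. B n) \<le> 0"
    by (intro LIMSEQ_le_const[OF tendsto_ennrealI[OF LIMSEQ_inverse_real_of_nat, simplified ennreal_0]])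
      (auto simp: inverse_eq_divide)
  then have "(\<Inter>n. B n) \<in> null_sets \<mu>" using Bs by (auto simp: null_sets_def)
  then have "AE w in \<mu>. w \<notin> (\<Inter>n. B n)" by (rule AE_not_in)
  with AE_space show ?thesis
  proof eventually_elim
    case (elim w)
    then obtain n where "w \<notin> B n" by blast
    then have "\<forall>q\<in>rat_times. 1 / real (Suc n) \<le> z q w" using elim by (auto simp: B_def space_\<mu> not_less)
    then show ?case by (intro exI[of _ "1 / real (Suc n)"]) simp
  qed
qed

context density_pair
begin

text \<open>The event that the infimum of z over the rational times up to t is not positive; it also
  catches left limits that vanish at positive times up to t. Being built from countably many
  conditions, it lies in \<open>F t\<close> itself and not just up to a null set.\<close>

definition inf_zero :: "ennreal \<Rightarrow> 'a set" where
  "inf_zero t = {w\<in>\<Omega>. \<forall>n::nat. \<exists>q\<in>rat_times \<inter> {..t}. z q w < 1 / real (Suc n)}"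

lemma inf_zero_F: "inf_zero t \<in> sets (F t)"
proof -
  have "{w\<in>space (F t). z q w < 1 / real (Suc n)} \<in> sets (F t)" if "q \<le> t" for q n
    using z_mono[OF that] by measurable
  then have "(\<Inter>n. \<Union>q\<in>rat_times \<inter> {..t}. {w\<in>space (F t). z q w < 1 / real (Suc n)}) \<in> sets (F t)"
    by (intro sets.countable_INT' image_subsetI sets.countable_UN') auto
  also have "(\<Inter>n. \<Union>q\<in>rat_times \<inter> {..t}. {w\<in>space (F t). z q w < 1 / real (Suc n)}) = inf_zero t"
    by (auto simp: inf_zero_def space_F)
  finally show ?thesis .
qed

lemma not_inf_zero:
  assumes "w \<in> \<Omega>" "w \<notin> inf_zero t"
  shows "\<exists>e>0. \<forall>q\<in>rat_times. q \<le> t \<longrightarrow> e \<le> z q w"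
proof -
  obtain n :: nat where "\<forall>q\<in>rat_times \<inter> {..t}. 1 / real (Suc n) \<le> z q w"
    using assms by (auto simp: inf_zero_def not_less)
  then show ?thesis by (intro exI[of _ "1 / real (Suc n)"]) simp
qed

lemma null_\<mu>_z:
  assumes N: "N \<in> sets (F t)" and null: "emeasure \<mu> N = 0"
  shows "AE w in Q. w \<in> N \<longrightarrow> z t w \<le> 0"
proof -
  note [measurable] = sets_F_QD[OF N]
  have "(\<integral>\<^sup>+w. ennreal (z t w) * indicator N w \<partial>Q) = 0" using null unfolding emeasure_\<mu>[OF N] .
  then have "AE w in Q. ennreal (z t w) * indicator N w = 0"
    by (subst (asm) nn_integral_0_iff_AE) measurable
  then show ?thesis by eventually_elim (auto simp: indicator_def ennreal_eq_0_iff)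
qed

lemma AE_not_inf_zero: "AE w in \<mu>. w \<notin> inf_zero t"
  using AE_\<mu>_inf_pos
proof eventually_elim
  case (elim w)
  then obtain e where e: "0 < e" "\<forall>q\<in>rat_times. e \<le> z q w" by blast
  from nat_approx_posE[OF e(1)] obtain n where "1 / real (Suc n) < e" by blast
  with e(2) show ?case unfolding inf_zero_def by (auto simp: not_less intro!: exI[of _ n])
qed

text \<open>The martingale property makes zero absorbing, also when it is only reached as a left limit.\<close>

lemma AE_inf_pos:
  "AE w in Q. 0 < z t w \<longrightarrow> (\<exists>e>0. \<forall>q\<in>rat_times. q \<le> t \<longrightarrow> e \<le> z q w)"
proof -
  have "emeasure \<mu> (inf_zero t) = 0"
    using AE_not_inf_zero[of t] inf_zero_F[of t] sets_F_Q[of t] sets_Q \<mu>(2)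
    by (subst (asm) AE_iff_null_sets[symmetric]) auto
  from null_\<mu>_z[OF inf_zero_F this] AE_space show ?thesis
  proof eventually_elim
    case (elim w)
    then show ?case using not_inf_zero[of w t] by (force simp: space_Q)
  qed
qed

end

subsection \<open>The Hellinger process\<close>

text \<open>\<open>Y\<close> is a parameter with a defining equation so that exchanging \<mu> and
  \<nu> leaves \<open>h\<close>, \<open>M\<close>, \<open>A\<close> and \<open>Y\<close> literally
  unchanged. The explicit formula for h is recorded as the upper bound \<open>h_le\<close>, with the
  indicator estimated by 1.\<close>

locale hellinger_pair = density_pair +
  fixes h :: "ennreal \<Rightarrow> 'a \<Rightarrow> ennreal" and M A Y :: "ennreal \<Rightarrow> 'a \<Rightarrow> real"
  assumes Y: "\<And>t w. Y t w = sqrt (z t w * z' t w)"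
    and dm: "doob_meyer \<Omega> F Q Y M A"
    and h_pred: "predictable_process \<Omega> F h"
    and h_inc: "AE w in Q. increasing_path (\<lambda>t. h t w)"
    and A_eq: "AE w in Q. \<forall>t<\<infinity>. ennreal (A t w) =
      stieltjes (\<lambda>s. ennreal (left_limit (\<lambda>r. Y r w) s)) (\<lambda>s. h s w) t"
    and h_le: "AE w in Q. \<forall>t<\<infinity>. h t w \<le>
      stieltjes (\<lambda>s. inverse (ennreal (left_limit (\<lambda>r. Y r w) s))) (\<lambda>s. ennreal (A s w)) t"
    and h_lim: "AE w in Q. ((\<lambda>t. h t w) \<longlongrightarrow> h \<infinity> w) (at_left \<infinity>)"

lemma stieltjes_mono:
  assumes "\<And>s. f s \<le> g s"
  shows "stieltjes f x t \<le> stieltjes g x t"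
  unfolding stieltjes_def
  by (intro SUP_mono' nn_integral_mono mult_right_mono assms) simp_all

lemma (in density_pair) obtain_hellinger_pair:
  assumes h: "hellinger_process \<Omega> F Q z z' h"
  obtains M A where "hellinger_pair \<Omega> F \<mu> \<nu> Q z z' h M A (\<lambda>t w. sqrt (z t w * z' t w))"
proof -
  let ?Y = "\<lambda>t w. sqrt (z t w * z' t w)"
  let ?G = "{(w, t). 0 < left_limit (\<lambda>s. z s w) t \<and> 0 < left_limit (\<lambda>s. z' s w) t} \<union> UNIV \<times> {0}"
  from h obtain M A where *: "doob_meyer \<Omega> F Q ?Y M A" "predictable_process \<Omega> F h"
    "AE w in Q. increasing_path (\<lambda>t. h t w)"
    "AE w in Q. \<forall>t<\<infinity>. ennreal (A t w) =
      stieltjes (\<lambda>s. ennreal (left_limit (\<lambda>r. ?Y r w) s)) (\<lambda>s. h s w) t"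
    "AE w in Q. \<forall>t<\<infinity>. h t w =
      stieltjes (\<lambda>s. inverse (ennreal (left_limit (\<lambda>r. ?Y r w) s)) * indicator ?G (w, s)) (\<lambda>s. ennreal (A s w)) t"
    "AE w in Q. ((\<lambda>t. h t w) \<longlongrightarrow> h \<infinity> w) (at_left \<infinity>)"
    unfolding hellinger_process_def Let_def by (elim exE conjE) blast
  have "AE w in Q. \<forall>t<\<infinity>. h t w \<le>
      stieltjes (\<lambda>s. inverse (ennreal (left_limit (\<lambda>r. ?Y r w) s))) (\<lambda>s. ennreal (A s w)) t"
    using *(5)
  proof eventually_elim
    case (elim w)
    show ?case
    proof (intro allI impI)
      fix t :: ennreal assume "t < \<infinity>"
      with elim have "h t w = stieltjes (\<lambda>s. inverse (ennreal (left_limit (\<lambda>r. ?Y r w) s)) * indicator ?G (w, s)) (\<lambda>s. ennreal (A s w)) t"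
        by blast
      also have "\<dots> \<le> stieltjes (\<lambda>s. inverse (ennreal (left_limit (\<lambda>r. ?Y r w) s))) (\<lambda>s. ennreal (A s w)) t"
        by (intro stieltjes_mono) (simp add: indicator_def)
      finally show "h t w \<le> stieltjes (\<lambda>s. inverse (ennreal (left_limit (\<lambda>r. ?Y r w) s))) (\<lambda>s. ennreal (A s w)) t" .
    qed
  qed
  with * have "hellinger_pair \<Omega> F \<mu> \<nu> Q z z' h M A ?Y"
    by (intro hellinger_pair.intro density_pair_axioms hellinger_pair_axioms.intro refl)
  then show thesis by (rule that)
qed

sublocale hellinger_pair \<subseteq> s: density_pair \<Omega> F \<nu> \<mu> Q z' z
  by (rule swap)

context hellinger_pair
begin

lemma Y_Q [measurable]: "Y t \<in> borel_measurable Q"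
  unfolding Y[abs_def] using s.z_Q[of t] by measurable

lemma AE_Y_bounds: "AE w in Q. 0 \<le> Y t w \<and> Y t w \<le> 1"
  using AE_sum[of t] AE_z_nonneg[of t] s.AE_z_nonneg[of t]
proof eventually_elim
  case (elim w)
  have "0 \<le> (z t w - z' t w)\<^sup>2" by simp
  then have "4 * (z t w * z' t w) \<le> (z t w + z' t w)\<^sup>2" by (simp add: power2_eq_square algebra_simps)
  then have "z t w * z' t w \<le> 1" using elim by simp
  then show ?case using elim by (simp add: Y)
qed

lemma integrable_Y: "integrable Q (Y t)"
  by (rule Q.integrable_const_bound[where B = 1]) (use AE_Y_bounds[of t] in auto)

lemma M_props: "t < \<infinity> \<Longrightarrow> integrable Q (M t)"
  "s \<le> t \<Longrightarrow> t < \<infinity> \<Longrightarrow> AE w in Q. real_cond_exp Q (F s) (M t) w = M s w"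
  using dm by (simp_all add: doob_meyer_def martingale_def)

lemma A_F: "t < \<infinity> \<Longrightarrow> A t \<in> borel_measurable (F t)"
  by (rule predictable_process_measurable[OF filt]) (use dm in \<open>simp_all add: doob_meyer_def\<close>)

lemma A_Q: "t < \<infinity> \<Longrightarrow> A t \<in> borel_measurable Q"
  by (rule measurable_F_Q[OF A_F])

lemma A_inc: "AE w in Q. increasing_path (\<lambda>t. A t w)"
  using dm by (simp add: doob_meyer_def)

lemma A_dm: "t < \<infinity> \<Longrightarrow> AE w in Q. A t w = M t w - Y t w"
proof -
  assume t: "t < \<infinity>"
  have "AE w in Q. \<forall>t<\<infinity>. Y t w = M t w - A t w" using dm by (simp add: doob_meyer_def)
  then show "AE w in Q. A t w = M t w - Y t w"
  proof eventually_elim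
    case (elim w)
    then have "Y t w = M t w - A t w" using t by blast
    then show ?case by simp
  qed
qed

lemma integrable_A:
  assumes "t < \<infinity>"
  shows "integrable Q (A t)"
proof -
  have "integrable Q (\<lambda>w. M t w - Y t w)" by (intro Bochner_Integration.integrable_diff M_props(1) assms integrable_Y)
  then show ?thesis
    by (rule integrable_cong_AE_imp) (use A_Q[OF assms] A_dm[OF assms] in \<open>auto simp: eq_commute\<close>)
qed

lemma integral_M:
  assumes tu: "t \<le> u" "u < \<infinity>" and B: "B \<in> sets (F t)"
  shows "(\<integral>w. indicator B w * M u w \<partial>Q) = (\<integral>w. indicator B w * M t w \<partial>Q)"
proof -
  interpret finite_measure_subalgebra Q "F t"
    by (simp add: finite_measure_subalgebra_def finite_measure_subalgebra_axioms_def subalg_Q Q.finite_measure_axioms)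
  have t: "t < \<infinity>" using tu by simp
  note [measurable] = sets_F_QD[OF B] borel_measurable_integrable[OF M_props(1)[OF t]]
  have "(\<integral>w. indicator B w * M u w \<partial>Q) = (\<integral>w. indicator B w * real_cond_exp Q (F t) (M u) w \<partial>Q)"
    using real_cond_exp_intA[OF M_props(1)[OF tu(2)] B] by (simp add: set_lebesgue_integral_def)
  also have "\<dots> = (\<integral>w. indicator B w * M t w \<partial>Q)"
    by (rule integral_cong_AE) (use M_props(2)[OF tu] in auto)
  finally show ?thesis .
qed

text \<open>The martingale part has no mean increment over an event of the past, so what
  \<open>A\<close> gains there in the mean is exactly what \<open>Y\<close> loses.\<close>

lemma integral_A_increment:
  assumes tu: "t \<le> u" "u < \<infinity>" and B: "B \<in> sets (F t)"
  shows "(\<integral>w. indicator B w * (A u w - A t w) \<partial>Q) = (\<integral>w. indicator B w * (Y t w - Y u w) \<partial>Q)"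
proof -
  have t: "t < \<infinity>" using tu by simp
  note [measurable] = sets_F_QD[OF B] borel_measurable_integrable[OF M_props(1)[OF t]]
    borel_measurable_integrable[OF M_props(1)[OF tu(2)]] A_Q[OF t] A_Q[OF tu(2)]
  have i: "integrable Q (\<lambda>w. indicator B w * f w)" if "integrable Q f" for f :: "'a \<Rightarrow> real"
    using integrable_mult_indicator[OF sets_F_QD[OF B] that] by simp
  note ii = i[OF M_props(1)[OF t]] i[OF M_props(1)[OF tu(2)]] i[OF integrable_Y, of t] i[OF integrable_Y, of u]
  have "(\<integral>w. indicator B w * (A u w - A t w) \<partial>Q) =
      (\<integral>w. (indicator B w * M u w - indicator B w * M t w) + (indicator B w * Y t w - indicator B w * Y u w) \<partial>Q)"
  proof (rule integral_cong_AE)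
    show "AE w in Q. indicator B w * (A u w - A t w) =
        (indicator B w * M u w - indicator B w * M t w) + (indicator B w * Y t w - indicator B w * Y u w)"
      using A_dm[OF t] A_dm[OF tu(2)] by eventually_elim (auto simp: indicator_def)
  qed measurable
  also have "\<dots> = (\<integral>w. indicator B w * Y t w - indicator B w * Y u w \<partial>Q)"
    using ii integral_M[OF tu B] by simp
  finally show ?thesis by (simp add: right_diff_distrib)
qed

text \<open>A bound uniform in t is needed because h is also evaluated at \<infinity>, while
  \<open>A\<close> is controlled at finite times. As \<open>Y\<close> lies in [0,1], the means of
  \<open>A\<close> at integer times are at most 1, and monotone convergence applies.\<close>

lemma AE_A_bounded: "AE w in Q. \<exists>c. \<forall>t<\<infinity>. A t w \<le> c"
proof -
  have fin: "of_nat n < (\<infinity>::ennreal)" for n by (simp add: ennreal_of_nat_eq_real_of_nat)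
  have [measurable]: "A (of_nat n) \<in> borel_measurable Q" for n by (rule A_Q[OF fin])
  have pos: "AE w in Q. 0 \<le> A (of_nat n) w" for n using A_inc
  proof eventually_elim
    case (elim w)
    have "A 0 w \<le> A (of_nat n) w" by (rule increasing_path_mono[OF elim _ fin]) simp
    then show ?case using elim by (simp add: increasing_path_def)
  qed
  have le1: "(\<integral>\<^sup>+w. ennreal (A (of_nat n) w) \<partial>Q) \<le> 1" for n
  proof -
    have "(\<integral>w. A (of_nat n) w \<partial>Q) = (\<integral>w. indicator \<Omega> w * (A (of_nat n) w - A 0 w) \<partial>Q)"
    proof (rule integral_cong_AE)
      show "AE w in Q. A (of_nat n) w = indicator \<Omega> w * (A (of_nat n) w - A 0 w)"
        using A_inc AE_space by eventually_elim (simp add: space_Q increasing_path_def)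
      show "(\<lambda>w. indicator \<Omega> w * (A (of_nat n) w - A 0 w)) \<in> borel_measurable Q"
        using A_Q[of 0] sets.top[of Q] by (simp add: space_Q)
    qed measurable
    also have "\<dots> = (\<integral>w. indicator \<Omega> w * (Y 0 w - Y (of_nat n) w) \<partial>Q)"
      using sets.top[of "F 0"] by (intro integral_A_increment fin) (simp_all add: space_F)
    also have "\<dots> \<le> (\<integral>w. 1 \<partial>Q)"
    proof (rule integral_mono_AE)
      show "integrable Q (\<lambda>w. indicator \<Omega> w * (Y 0 w - Y (of_nat n) w))"
        using integrable_mult_indicator[of \<Omega> Q "\<lambda>w. Y 0 w - Y (of_nat n) w"] sets.top[of Q] integrable_Y
        by (simp add: space_Q)
      show "AE w in Q. indicator \<Omega> w * (Y 0 w - Y (of_nat n) w) \<le> 1"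
        using AE_Y_bounds[of 0] AE_Y_bounds[of "of_nat n"]
        by eventually_elim (auto simp: indicator_def)
    qed simp
    also have "\<dots> = 1" by (simp add: Q.prob_space)
    finally have "ennreal (\<integral>w. A (of_nat n) w \<partial>Q) \<le> 1" by (simp add: ennreal_le_1)
    then show ?thesis using nn_integral_eq_integral[OF integrable_A[OF fin] pos] by simp
  qed
  have "(\<integral>\<^sup>+w. (SUP n. ennreal (A (of_nat n) w)) \<partial>Q) = (SUP n. \<integral>\<^sup>+w. ennreal (A (of_nat n) w) \<partial>Q)"
  proof (rule nn_integral_monotone_convergence_SUP_AE)
    show "AE w in Q. ennreal (A (of_nat n) w) \<le> ennreal (A (of_nat (Suc n)) w)" for n
      using A_inc
    proof eventually_elim
      case (elim w)
      have "of_nat n \<le> (of_nat (Suc n) :: ennreal)" by (rule of_nat_mono) simp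
      then show ?case by (intro ennreal_leI increasing_path_mono[OF elim _ fin])
    qed
  qed measurable
  also have "\<dots> \<le> 1" using le1 by (intro SUP_least)
  finally have "(\<integral>\<^sup>+w. (SUP n. ennreal (A (of_nat n) w)) \<partial>Q) \<noteq> \<infinity>" by (auto simp: top_unique)
  then have "AE w in Q. (SUP n. ennreal (A (of_nat n) w)) \<noteq> \<infinity>"
    by (intro nn_integral_PInf_AE) measurable
  then show ?thesis using A_inc
  proof eventually_elim
    case (elim w)
    obtain c where c: "(SUP n. ennreal (A (of_nat n) w)) = ennreal c" "0 \<le> c"
      using elim(1) by (cases "SUP n. ennreal (A (of_nat n) w)") simp_all
    have "A t w \<le> c" if t: "t < \<infinity>" for t
    proof -
      obtain r where r: "t = ennreal r" "0 \<le> r" using t by (cases t) auto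
      obtain n where n: "r \<le> real n" using real_arch_simple by blast
      have "t \<le> of_nat n" unfolding r ennreal_of_nat_eq_real_of_nat using n by (rule ennreal_leI)
      then have "A t w \<le> A (of_nat n) w" by (intro increasing_path_mono[OF elim(2)] fin)
      moreover have "ennreal (A (of_nat n) w) \<le> (SUP n. ennreal (A (of_nat n) w))" by (rule SUP_upper) simp
      then have "A (of_nat n) w \<le> c" unfolding c(1) using c(2) by (simp add: ennreal_le_iff)
      ultimately show ?thesis by simp
    qed
    then show ?case by blast
  qed
qed

lemma AE_Y_cadlag: "AE w in Q. cadlag (\<lambda>t. Y t w)"
  using AE_z s.AE_z by eventually_elim (simp add: Y cadlag_sqrt_mult)

lemma increasing_path_ennreal:
  assumes "increasing_path (x :: ennreal \<Rightarrow> real)"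
  shows "increasing_path (\<lambda>t. ennreal (x t))"
  using assms unfolding increasing_path_def
  by (auto intro!: tendsto_ennrealI mono_onI ennreal_leI dest: mono_onD)

text \<open>The quantifiers over v and e stand inside the AE because v will be the random time
  \<open>T w\<close> and e will depend on the path. Lower bounds strictly before v suffice: the
  integrand at v is a left limit, so a jump of z at v itself does no harm.\<close>

lemma AE_h_finite:
  "AE w in Q. \<forall>v e. 0 < e \<longrightarrow> (\<forall>q\<in>rat_times. q < v \<longrightarrow> e \<le> z q w \<and> e \<le> z' q w) \<longrightarrow> h v w < \<infinity>"
  using AE_A_bounded A_inc AE_Y_cadlag h_inc h_le h_lim
proof eventually_elim
  case (elim w)
  from elim(1) obtain c where c: "\<And>t. t < \<infinity> \<Longrightarrow> A t w \<le> c" by blast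
  have inc: "increasing_path (\<lambda>t. ennreal (A t w))" by (rule increasing_path_ennreal[OF elim(2)])
  have bound: "h v w \<le> inverse (ennreal e) * ennreal c"
    if e: "0 < e" and v: "v < \<infinity>" "0 < v" and q: "\<And>q. q \<in> rat_times \<Longrightarrow> q < v \<Longrightarrow> e \<le> z q w \<and> e \<le> z' q w" for v e
  proof -
    obtain r where r: "v = ennreal r" "0 \<le> r" using v(1) by (cases v) auto
    have Ye: "Y q w \<in> {e..}" if "q \<in> rat_times" "q < v" for q
    proof -
      have "e = sqrt (e * e)" using e by simp
      also have "\<dots> \<le> Y q w" unfolding Y using q[OF that] e by (intro real_sqrt_le_mono mult_mono) auto
      finally show ?thesis by simp
    qed
    have ll: "left_limit (\<lambda>r. Y r w) s \<in> {e..}" if "s \<le> v" for s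
    proof (cases "s = 0")
      case True
      have "Y 0 w \<in> {e..}" by (rule cadlag_closed[OF elim(3) _ Ye, of 0 v]) (use v in auto)
      then show ?thesis using True by (simp add: left_limit_def)
    next
      case False
      show ?thesis
      proof (rule left_limit_closed[OF elim(3), of _ 0])
        show "s < \<infinity>" using that v(1) by (rule le_less_trans)
        show "Y q w \<in> {e..}" if "q \<in> rat_times" "q < s" for q
          using Ye that \<open>s \<le> v\<close> by (meson less_le_trans)
      qed (use False in \<open>auto simp: zero_less_iff_neq_zero\<close>)
    qed
    have "h v w \<le> stieltjes (\<lambda>s. inverse (ennreal (left_limit (\<lambda>r. Y r w) s))) (\<lambda>s. ennreal (A s w)) v"
      using elim(5) v(1) by blast
    also have "\<dots> \<le> inverse (ennreal e) * ennreal (A v w)"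
      unfolding r(1)
    proof (rule stieltjes_le[OF inc r(2)])
      fix s assume "0 \<le> s" "s \<le> r"
      then have "ennreal s \<le> v" unfolding r(1) by (intro ennreal_leI)
      then have "e \<le> left_limit (\<lambda>r. Y r w) (ennreal s)" using ll by simp
      then show "inverse (ennreal (left_limit (\<lambda>r. Y r w) (ennreal s))) \<le> inverse (ennreal e)"
        using e by (simp add: inverse_ennreal)
    qed
    also have "\<dots> \<le> inverse (ennreal e) * ennreal c" by (intro mult_left_mono ennreal_leI c v) simp
    finally show ?thesis .
  qed
  have fin: "inverse (ennreal e) * ennreal c < \<infinity>" if "0 < e" for e
    using that by (simp add: inverse_ennreal ennreal_mult_less_top)
  show ?case
  proof (intro allI impI)
    fix v e assume e: "0 < e" and q: "\<forall>q\<in>rat_times. q < v \<longrightarrow> e \<le> z q w \<and> e \<le> z' q w"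
    consider "v = 0" | "0 < v" "v < \<infinity>" | "v = \<infinity>" by (metis infinity_ennreal_def less_top not_gr_zero)
    then show "h v w < \<infinity>"
    proof cases
      case 1
      then show ?thesis using elim(4) by (simp add: increasing_path_def)
    next
      case 2
      then show ?thesis using bound[OF e] q fin[OF e] by (metis le_less_trans)
    next
      case 3
      \<comment> \<open>The estimate at finite times does not depend on the time, so it passes to
        the limit.\<close>
      have "h \<infinity> w \<le> inverse (ennreal e) * ennreal c"
      proof (rule tendsto_upperbound[OF elim(6)])
        show "at_left (\<infinity>::ennreal) \<noteq> bot" by (rule at_left_ennreal_neq_bot) simp
        have "eventually (\<lambda>x::ennreal. 0 < x \<and> x < \<infinity>) (at_left \<infinity>)"
          by (subst eventually_at_left[of 0]) (auto intro!: exI[of _ 0])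
        then show "\<forall>\<^sub>F v in at_left \<infinity>. h v w \<le> inverse (ennreal e) * ennreal c"
        proof eventually_elim
          case (elim v)
          then show ?case using e q 3 by (intro bound) auto
        qed
      qed
      then show ?thesis using fin[OF e] 3 by (simp add: le_less_trans)
    qed
  qed
qed

text \<open>The bound c is required on [r,v[ only: the mass that h puts at v is weighted with the
  left limit of \<open>Y\<close> there.\<close>

lemma AE_A_le:
  "AE w in Q. \<forall>r v c. 0 \<le> r \<longrightarrow> r \<le> v \<longrightarrow> (\<forall>q\<in>rat_times. ennreal r \<le> q \<longrightarrow> q < ennreal v \<longrightarrow> Y q w \<le> c) \<longrightarrow>
     h (ennreal v) w < \<infinity> \<longrightarrow>
     ennreal (A (ennreal v) w) \<le> ennreal (A (ennreal r) w) + ennreal c * (h (ennreal v) w - h (ennreal r) w)"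
  using AE_Y_cadlag h_inc A_eq
proof eventually_elim
  case (elim w)
  show ?case
  proof (intro allI impI)
    fix r v c :: real
    assume r: "0 \<le> r" "r \<le> v" and q: "\<forall>q\<in>rat_times. ennreal r \<le> q \<longrightarrow> q < ennreal v \<longrightarrow> Y q w \<le> c"
      and fin: "h (ennreal v) w < \<infinity>"
    let ?f = "\<lambda>s. ennreal (left_limit (\<lambda>r. Y r w) s)"
    have "stieltjes ?f (\<lambda>s. h s w) (ennreal v) \<le> stieltjes ?f (\<lambda>s. h s w) (ennreal r) +
      ennreal c * (h (ennreal v) w - h (ennreal r) w)"
    proof (rule stieltjes_le_add[OF elim(2) r fin])
      fix s assume s: "r < s" "s \<le> v"
      have "left_limit (\<lambda>r. Y r w) (ennreal s) \<in> {..c}"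
      proof (rule left_limit_closed[OF elim(1), of _ "ennreal r"])
        fix q' assume *: "q' \<in> rat_times" "ennreal r \<le> q'" "q' < ennreal s"
        then have "q' < ennreal v" using ennreal_leI[OF s(2)] by (meson less_le_trans)
        then show "Y q' w \<in> {..c}" using q * by simp
      qed (use s r in \<open>auto simp: ennreal_less_iff\<close>)
      then show "?f (ennreal s) \<le> ennreal c" by (intro ennreal_leI) simp
    qed
    then show "ennreal (A (ennreal v) w) \<le> ennreal (A (ennreal r) w) + ennreal c * (h (ennreal v) w - h (ennreal r) w)"
      using elim(3) by simp
  qed
qed

end

subsection \<open>Stopping along a grid\<close>

text \<open>The n-th grid has \<open>Suc n\<close> cells, numbered 0 to n; this avoids division by
  zero and makes n the index of the last cell.\<close>

definition grid :: "real \<Rightarrow> real \<Rightarrow> nat \<Rightarrow> nat \<Rightarrow> real" where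
  "grid t u n j = t + real j * ((u - t) / real (Suc n))"

lemma grid_0 [simp]: "grid t u n 0 = t"
  by (simp add: grid_def)

lemma grid_end [simp]: "grid t u n (Suc n) = u"
  by (simp add: grid_def field_simps)

lemma grid_mono: "t \<le> u \<Longrightarrow> i \<le> j \<Longrightarrow> grid t u n i \<le> grid t u n j"
  unfolding grid_def by (intro add_left_mono mult_right_mono) simp_all

lemma grid_step: "grid t u n (Suc j) - grid t u n j = (u - t) / real (Suc n)"
  unfolding grid_def by (simp only: of_nat_Suc distrib_right)

lemma grid_bounds: "t \<le> u \<Longrightarrow> j \<le> Suc n \<Longrightarrow> t \<le> grid t u n j \<and> grid t u n j \<le> u"
  using grid_mono[of t u 0 j n] grid_mono[of t u j "Suc n" n] by simp

text \<open>Compactness leaves finitely many of the \<open>W i\<close>, with a Lebesgue number d.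
  The index n must make the mesh smaller than d and also exceed the largest index used, because on
  the n-th grid only the sets numbered up to n are consulted.\<close>

lemma grid_cover:
  fixes W :: "nat \<Rightarrow> real set"
  assumes W: "\<And>i. open (W i)" and cov: "{t..u} \<subseteq> (\<Union>i. W i)" and tu: "t < u"
  shows "\<exists>n0. \<forall>n\<ge>n0. \<forall>j\<le>n. \<exists>i\<le>n. {grid t u n j..grid t u n (Suc j)} \<subseteq> W i"
proof -
  obtain I where I: "finite I" "{t..u} \<subseteq> (\<Union>i\<in>I. W i)"
    by (rule compactE_image[OF compact_Icc, of UNIV W t u]) (use W cov in auto)
  have "I \<noteq> {}" using I(2) tu by force
  obtain d where d: "0 < d" "\<And>T. T \<subseteq> {t..u} \<Longrightarrow> diameter T < d \<Longrightarrow> \<exists>B\<in>W ` I. T \<subseteq> B"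
    by (rule Lebesgue_number_lemma[of "{t..u}" "W ` I"]) (use I W \<open>I \<noteq> {}\<close> in auto)
  obtain k where k: "(u - t) / d < real k" using reals_Archimedean2 by blast
  obtain l where l: "\<And>i. i \<in> I \<Longrightarrow> i \<le> l" using I(1) by (meson finite_nat_set_iff_bounded_le)
  show ?thesis
  proof (rule exI[of _ "max k l"], intro allI impI)
    fix n j assume n: "max k l \<le> n" and j: "j \<le> n"
    let ?T = "{grid t u n j..grid t u n (Suc j)}"
    have "(u - t) < real k * d" using k d(1) by (simp add: field_simps)
    also have "\<dots> \<le> real (Suc n) * d" using n d(1) by (intro mult_right_mono) simp_all
    finally have "(u - t) / real (Suc n) < d" by (simp add: field_simps)
    moreover have "diameter ?T = (u - t) / real (Suc n)"
      using grid_mono[of t u j "Suc j" n] tu grid_step[of t u n j] by (simp add: diameter_closed_interval)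
    moreover have "?T \<subseteq> {t..u}"
      using grid_bounds[of t u j n] grid_bounds[of t u "Suc j" n] tu j by auto
    ultimately obtain i where "i \<in> I" "?T \<subseteq> W i" using d(2)[of ?T] by auto
    then show "\<exists>i\<le>n. {grid t u n j..grid t u n (Suc j)} \<subseteq> W i" using l[of i] n by (intro exI[of _ i]) simp
  qed
qed

text \<open>For decreasing C this is X stopped at the first k with w outside \<open>C k\<close>;
  membership in \<open>C k\<close> is the permission to pass from k to k + 1.\<close>

fun stop_val :: "(nat \<Rightarrow> 'a \<Rightarrow> real) \<Rightarrow> (nat \<Rightarrow> 'a set) \<Rightarrow> nat \<Rightarrow> 'a \<Rightarrow> real" where
  "stop_val X C 0 w = X 0 w"
| "stop_val X C (Suc k) w = (if w \<in> C k then X (Suc k) w else stop_val X C k w)"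

lemma stop_val_sum:
  assumes "\<And>k. C (Suc k) \<subseteq> C k"
  shows "stop_val X C n w = X 0 w + (\<Sum>k<n. indicator (C k) w * (X (Suc k) w - X k w))"
proof (induction n)
  case (Suc n)
  have "stop_val X C n w = X n w" if "w \<in> C n" for n
    using that assms by (cases n) auto
  then show ?case using Suc by (auto simp: indicator_def)
qed simp

text \<open>With the same C, several processes are stopped at the same index, so a pointwise
  relation between them survives stopping.\<close>

lemma stop_val_cases:
  assumes "\<And>k. k \<le> n \<Longrightarrow> P (X k w) (X' k w) (X'' k w)"
  shows "P (stop_val X C n w) (stop_val X' C n w) (stop_val X'' C n w)"
  using assms by (induction n) auto

text \<open>Such an S is ]t,v] or ]t,v[. In the open case the bound is taken from points inside and
  passed to the limit, so a jump of the measure at v is not charged. This is how a process is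
  stopped just before a large jump.\<close>

lemma emeasure_initial_segment:
  fixes \<iota> :: "real measure"
  assumes \<iota>: "sets \<iota> = sets borel" and S: "S \<subseteq> {t<..u}"
    and down: "\<And>v v'. v \<in> S \<Longrightarrow> t < v' \<Longrightarrow> v' \<le> v \<Longrightarrow> v' \<in> S"
    and K: "\<And>v. v \<in> S \<Longrightarrow> emeasure \<iota> {t<..v} \<le> K"
  shows "emeasure \<iota> S \<le> K"
proof (cases "S = {}")
  case False
  have bdd: "bdd_above S" using S by (intro bdd_aboveI[of _ u]) auto
  define v where "v = Sup S"
  have le: "s \<le> v" if "s \<in> S" for s unfolding v_def using that bdd by (rule cSup_upper)
  from False obtain s0 where s0: "s0 \<in> S" by blast
  have tv: "t < v" using le[OF s0] subsetD[OF S s0] by simp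
  show ?thesis
  proof (cases "v \<in> S")
    case True
    have "S = {t<..v}"
    proof (intro equalityI subsetI)
      show "x \<in> {t<..v}" if "x \<in> S" for x using le[OF that] subsetD[OF S that] by simp
      show "x \<in> S" if "x \<in> {t<..v}" for x using down[OF True] that by simp
    qed
    with K[OF True] show ?thesis by simp
  next
    case False
    \<comment> \<open>Starting at n + 2 keeps every \<open>w n\<close> strictly above t.\<close>
    define w where "w n = v - (v - t) / real (n + 2)" for n
    have wS: "w n \<in> S" for n
    proof -
      have "0 < (v - t) / real (n + 2)" using tv by simp
      then have "w n < Sup S" unfolding w_def v_def[symmetric] by linarith
      then obtain s where s: "s \<in> S" "w n < s" using less_cSup_iff[OF \<open>S \<noteq> {}\<close> bdd] by blast
      have "(v - t) / real (n + 2) < (v - t) / 1" using tv by (intro divide_strict_left_mono) simp_all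
      then have "t < w n" unfolding w_def div_by_1 by linarith
      then show ?thesis by (rule down[OF s(1)]) (use s(2) in simp)
    qed
    have inc: "incseq (\<lambda>n. {t<..w n})"
    proof (rule incseq_SucI)
      fix n
      have "(v - t) / real (Suc n + 2) \<le> (v - t) / real (n + 2)" using tv by (intro divide_left_mono) simp_all
      then show "{t<..w n} \<subseteq> {t<..w (Suc n)}" unfolding w_def by auto
    qed
    have "S \<subseteq> (\<Union>n. {t<..w n})"
    proof
      fix s assume s: "s \<in> S"
      have "s \<le> v" "s \<noteq> v" using le[OF s] s False by (simp, blast)
      then have "s < v" by simp
      then obtain n where n: "(v - t) / (v - s) < real n" using reals_Archimedean2 by blast
      then have "(v - t) < real n * (v - s)" using \<open>s < v\<close> by (simp add: field_simps)
      also have "\<dots> \<le> real (n + 2) * (v - s)" using \<open>s < v\<close> by (intro mult_right_mono) simp_all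
      finally have "s \<le> w n" unfolding w_def by (simp add: field_simps)
      then show "s \<in> (\<Union>n. {t<..w n})" using subsetD[OF S s] by (intro UN_I[of n]) simp_all
    qed
    then have "emeasure \<iota> S \<le> emeasure \<iota> (\<Union>n. {t<..w n})" using \<iota> by (intro emeasure_mono sets.countable_UN image_subsetI) simp_all
    also have "\<dots> = (SUP n. emeasure \<iota> {t<..w n})"
      using \<iota> by (intro SUP_emeasure_incseq[symmetric] inc image_subsetI) simp_all
    also have "\<dots> \<le> K" using K wS by (intro SUP_least) simp
    finally show ?thesis .
  qed
qed simp

section \<open>Vanishing in the mean on events with zero terminal density\<close>

context hellinger_pair
begin

lemma algebra_past: "algebra \<Omega> (\<Union>t\<in>{..<\<infinity>}. sets (F t))"
  unfolding algebra_iff_Un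
proof (intro conjI ballI)
  let ?\<A> = "\<Union>t\<in>{..<\<infinity>}. sets (F t)"
  have sub: "a \<subseteq> \<Omega>" if "a \<in> sets (F t)" for a t
    using sets.sets_into_space[OF that] by (simp add: space_F)
  show "?\<A> \<subseteq> Pow \<Omega>"
  proof (intro UN_least subsetI)
    show "a \<in> Pow \<Omega>" if "a \<in> sets (F t)" for a t using sub[OF that] by simp
  qed
  show "{} \<in> ?\<A>" by (rule UN_I[of 0]) simp_all
  show "\<Omega> - a \<in> ?\<A>" if a: "a \<in> ?\<A>" for a
  proof -
    from a obtain t where t: "t < \<infinity>" "a \<in> sets (F t)" by (elim UN_E) simp
    have "\<Omega> - a \<in> sets (F t)" using sets.compl_sets[OF t(2)] by (simp add: space_F)
    then show ?thesis using t(1) by (intro UN_I[of t]) simp_all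
  qed
  show "a \<union> b \<in> ?\<A>" if a: "a \<in> ?\<A>" and b: "b \<in> ?\<A>" for a b
  proof -
    from a obtain s where s: "s < \<infinity>" "a \<in> sets (F s)" by (elim UN_E) simp
    from b obtain t where t: "t < \<infinity>" "b \<in> sets (F t)" by (elim UN_E) simp
    have "a \<in> sets (F (max s t))" "b \<in> sets (F (max s t))"
      by (rule subsetD[OF sets_F_mono s(2)], simp, rule subsetD[OF sets_F_mono t(2)], simp)
    then have "a \<union> b \<in> sets (F (max s t))" by (rule sets.Un)
    then show ?thesis using s t by (intro UN_I[of "max s t"]) simp_all
  qed
qed

lemma approx_by_past:
  assumes N: "N \<in> sets Q" and e: "0 < e"
  obtains C t where "0 \<le> t" "C \<in> sets (F (ennreal t))" "measure Q ((N - C) \<union> (C - N)) < e"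
proof -
  have "sets Q = sigma_sets (space Q) (\<Union>t\<in>{..<\<infinity>}. sets (F t))"
    using fs unfolding sets_Q space_Q filtered_space_def by blast
  from Q.approx_by_algebra[OF _ this N e, unfolded space_Q, OF algebra_past] obtain C where
    C: "C \<in> (\<Union>t\<in>{..<\<infinity>}. sets (F t))" "measure Q ((N - C) \<union> (C - N)) < e" by (elim bexE)
  from C(1) obtain t where t: "t < \<infinity>" "C \<in> sets (F t)" by (elim UN_E) simp
  from t(1) obtain r where "t = ennreal r" "0 \<le> r" by (cases t) auto
  with C(2) t(2) show thesis by (intro that[of r C]) simp_all
qed

lemma integrable_indicator_mult:
  fixes f :: "'a \<Rightarrow> real"
  assumes "B \<in> sets Q" "integrable Q f"
  shows "integrable Q (\<lambda>w. indicator B w * f w)"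
  using integrable_mult_indicator[OF assms] by simp

lemma integrable_ind: "B \<in> sets Q \<Longrightarrow> integrable Q (indicator B :: 'a \<Rightarrow> real)"
  by (simp add: integrable_indicator_iff Q.emeasure_finite less_top[symmetric])

lemma AE_z_le: "AE w in Q. 0 \<le> z t w \<and> z t w \<le> 2 \<and> 0 \<le> z' t w \<and> z' t w \<le> 2"
  using AE_sum[of t] AE_z_nonneg[of t] s.AE_z_nonneg[of t] by eventually_elim simp

text \<open>N need not belong to any \<open>F t\<close>, so it is replaced by an event C of the
  past. \<mu> C is small because the terminal density vanishes on N, and the mean of z over C equals
  \<mu> C at all later times. Since z is at most 2, an error of e/4 in measure costs e/2 on each
  side.\<close>

lemma z_vanishes:
  assumes N: "N \<in> sets Q" and z0: "AE w in Q. w \<in> N \<longrightarrow> z \<infinity> w = 0" and e: "0 < e"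
  shows "\<exists>t\<ge>0. \<forall>u\<ge>t. (\<integral>w. indicator N w * z (ennreal u) w \<partial>Q) \<le> e"
proof -
  have "0 < e/4" using e by simp
  from approx_by_past[OF N this] obtain C t
    where C: "0 \<le> t" "C \<in> sets (F (ennreal t))" "measure Q ((N - C) \<union> (C - N)) < e/4" .
  have CQ: "C \<in> sets Q" by (rule sets_F_QD[OF C(2)])
  note [measurable] = N CQ
  note int = integrable_indicator_mult[OF _ integrable_z] integrable_ind
  have small: "measure Q (N - C) \<le> e/4" "measure Q (C - N) \<le> e/4"
    using C(3) Q.finite_measure_mono[of "N - C" "(N - C) \<union> (C - N)"]
      Q.finite_measure_mono[of "C - N" "(N - C) \<union> (C - N)"] by auto
  have "measure \<mu> C = (\<integral>w. indicator C w * z \<infinity> w \<partial>Q)"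
    using C(2) sets_F_mono[of "ennreal t" \<infinity>] by (intro measure_\<mu>[symmetric]) auto
  also have "\<dots> \<le> (\<integral>w. 2 * indicator (C - N) w \<partial>Q)"
  proof (rule integral_mono_AE)
    show "AE w in Q. indicator C w * z \<infinity> w \<le> 2 * indicator (C - N) w"
      using AE_z_le[of \<infinity>] z0 by eventually_elim (auto simp: indicator_def)
  qed (intro integrable_mult_right int; measurable)+
  also have "\<dots> \<le> e/2" using small by simp
  finally have \<mu>C: "measure \<mu> C \<le> e/2" .
  show ?thesis
  proof (intro exI[of _ t] conjI allI impI)
    fix u assume u: "t \<le> u"
    have "(\<integral>w. indicator N w * z (ennreal u) w \<partial>Q) \<le>
      (\<integral>w. indicator C w * z (ennreal u) w + 2 * indicator (N - C) w \<partial>Q)"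
    proof (rule integral_mono_AE)
      show "AE w in Q. indicator N w * z (ennreal u) w \<le> indicator C w * z (ennreal u) w + 2 * indicator (N - C) w"
        using AE_z_le[of "ennreal u"] by eventually_elim (auto simp: indicator_def)
    qed (intro Bochner_Integration.integrable_add integrable_mult_right int; measurable)+
    also have "\<dots> = (\<integral>w. indicator C w * z (ennreal u) w \<partial>Q) + 2 * measure Q (N - C)"
      by (subst Bochner_Integration.integral_add) (use int in \<open>auto intro!: integrable_mult_right\<close>)
    also have "(\<integral>w. indicator C w * z (ennreal u) w \<partial>Q) = measure \<mu> C"
      using C(2) sets_F_mono[OF ennreal_leI[OF u]] by (intro measure_\<mu>) auto
    finally show "(\<integral>w. indicator N w * z (ennreal u) w \<partial>Q) \<le> e" using \<mu>C small by simp
  qed (rule C(1))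
qed

text \<open>The inequality of arithmetic and geometric means with a free weight k. It is linear in z
  and z', so it can be integrated and stopped term by term; a suitable k recovers the strength of
  the Cauchy-Schwarz inequality.\<close>

lemma Y_le_weighted:
  assumes "0 \<le> z t w" "0 \<le> z' t w" "0 < k"
  shows "Y t w \<le> z t w / (4 * k) + k * z' t w"
proof -
  have "z t w * z' t w = 4 * ((z t w / (4 * k)) * (k * z' t w))" using assms by simp
  also have "\<dots> \<le> (z t w / (4 * k) + k * z' t w)\<^sup>2"
    using zero_le_power2[of "z t w / (4 * k) - k * z' t w"] by (simp add: power2_eq_square algebra_simps)
  finally show ?thesis unfolding Y using assms by (intro real_le_lsqrt) auto
qed

lemma Y_vanishes:
  assumes N: "N \<in> sets Q" and z0: "AE w in Q. w \<in> N \<longrightarrow> z \<infinity> w = 0" and e: "0 < e"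
  shows "\<exists>t\<ge>0. \<forall>u\<ge>t. (\<integral>w. indicator N w * Y (ennreal u) w \<partial>Q) \<le> e"
proof -
  \<comment> \<open>The weight will be e/4: as z' is at most 2 it contributes e/2, and z is
    multiplied by 1/e.\<close>
  have e2: "0 < e\<^sup>2 / 2" using e by simp
  obtain t where t: "0 \<le> t" "\<And>u. t \<le> u \<Longrightarrow> (\<integral>w. indicator N w * z (ennreal u) w \<partial>Q) \<le> e\<^sup>2 / 2"
    using z_vanishes[OF N z0 e2] by blast
  show ?thesis
  proof (intro exI[of _ t] conjI allI impI t(1))
    fix u assume u: "t \<le> u"
    have "(\<integral>w. indicator N w * Y (ennreal u) w \<partial>Q) \<le> (\<integral>w. (1/e) * (indicator N w * z (ennreal u) w) + e/2 \<partial>Q)"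
    proof (rule integral_mono_AE)
      show "AE w in Q. indicator N w * Y (ennreal u) w \<le> (1/e) * (indicator N w * z (ennreal u) w) + e/2"
        using AE_z_le[of "ennreal u"]
      proof eventually_elim
        case (elim w)
        have "Y (ennreal u) w \<le> z (ennreal u) w / (4 * (e/4)) + e/4 * z' (ennreal u) w"
          using elim e by (intro Y_le_weighted) auto
        also have "\<dots> \<le> (1/e) * z (ennreal u) w + e/2"
          using elim e mult_left_mono[of "z' (ennreal u) w" 2 "e/4"] by simp
        finally show ?case using e by (simp add: indicator_def)
      qed
    qed (intro Bochner_Integration.integrable_add integrable_mult_right integrable_indicator_mult N
        integrable_z integrable_Y Q.integrable_const)+
    also have "\<dots> = (1/e) * (\<integral>w. indicator N w * z (ennreal u) w \<partial>Q) + e/2"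
      by (subst Bochner_Integration.integral_add)
        (auto intro!: integrable_mult_right integrable_indicator_mult N integrable_z simp: Q.prob_space)
    also have "\<dots> \<le> (1/e) * (e\<^sup>2/2) + e/2" using e t(2)[OF u] by (intro add_right_mono mult_left_mono) simp_all
    also have "\<dots> = e" using e by (simp add: power2_eq_square)
    finally show "(\<integral>w. indicator N w * Y (ennreal u) w \<partial>Q) \<le> e" .
  qed
qed

end

section \<open>Stopping before the exit from a predictable set\<close>

context hellinger_pair
begin

text \<open>Replaces the announcing sequence of a predictable time: the predictable set \<open>H\<close> is covered by
  an open predictable set of almost the same measure, and the process is stopped on the \<open>n\<close>-th grid
  at the first grid point after which the first \<open>n\<close> rectangles of the cover are not seen to contain the
  path up to the next grid point.\<close>

lemma predictable_stopping:
  fixes t u k \<eta> :: real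
  assumes tu: "0 < t" "t < u" and G: "G \<in> sets (F (ennreal t))"
    and H: "H \<in> sets (predictable_sigma \<Omega> F)" and k: "0 \<le> k" and \<eta>: "0 < \<eta>"
    and down: "AE w in Q. w \<in> G \<longrightarrow>
      (\<forall>v v'. v \<le> u \<longrightarrow> t < v' \<longrightarrow> v' \<le> v \<longrightarrow> (w, ennreal v) \<in> H \<longrightarrow> (w, ennreal v') \<in> H)"
    and bound: "AE w in Q. w \<in> G \<longrightarrow>
      (\<forall>v. t < v \<longrightarrow> v \<le> u \<longrightarrow> (w, ennreal v) \<in> H \<longrightarrow> A (ennreal v) w - A (ennreal t) w \<le> k)"
  obtains C :: "nat \<Rightarrow> nat \<Rightarrow> 'a set" where
    "\<And>n j. C n j \<in> sets (F (ennreal (grid t u n j)))"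
    "\<And>n j. C n (Suc j) \<subseteq> C n j" "\<And>n j. C n j \<subseteq> G"
    "\<And>n. (\<Sum>j<Suc n. \<integral>w. indicator (C n j) w *
        (A (ennreal (grid t u n (Suc j))) w - A (ennreal (grid t u n j)) w) \<partial>Q) \<le> k * measure Q G + \<eta>"
    "\<And>w. w \<in> G \<Longrightarrow> (\<And>s. t \<le> s \<Longrightarrow> s \<le> u \<Longrightarrow> (w, ennreal s) \<in> H) \<Longrightarrow> \<exists>n0. \<forall>n\<ge>n0. w \<in> C n n"
proof -
  have G\<Omega>: "G \<subseteq> \<Omega>" using sets.sets_into_space[OF G] by (simp add: space_F)
  from A_inc obtain N0 where N0: "N0 \<in> null_sets Q" "{w\<in>space Q. \<not> increasing_path (\<lambda>t. A t w)} \<subseteq> N0"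
    unfolding eventually_ae_filter by blast
  have inc: "increasing_path (\<lambda>t. A t w)" if "w \<in> \<Omega>" "w \<notin> N0" for w
    using that N0(2) by (auto simp: space_Q)
  \<comment> \<open>Setting the path to zero on the null set makes every path of \<Omega> monotone
    and right-continuous, as the construction of the measure requires.\<close>
  define B where "B s w = (if w \<in> N0 then 0 else A (ennreal s) w)" for s w
  have BA: "AE w in Q. \<forall>s. B s w = A (ennreal s) w"
    using AE_not_in[OF N0(1)] by eventually_elim (simp add: B_def)
  have fin: "ennreal s < \<infinity>" for s by simp
  have Bmono: "mono (\<lambda>s. B s w)" if "w \<in> \<Omega>" for w
  proof (cases "w \<in> N0")
    case False
    then show ?thesis unfolding B_def
      by (auto intro!: monoI increasing_path_mono[OF inc[OF that]] ennreal_leI)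
  qed (simp add: B_def mono_def)
  have Brc: "continuous (at_right s) (\<lambda>s. B s w)" if "w \<in> \<Omega>" for w s
  proof (cases "w \<in> N0")
    case False
    then show ?thesis unfolding B_def continuous_within
      using increasing_path_continuous[OF inc[OF that]] by simp
  qed (simp add: B_def)
  have Bmeas [measurable]: "B s \<in> borel_measurable Q" for s
  proof -
    have [measurable]: "A (ennreal s) \<in> borel_measurable Q" by (rule A_Q[OF fin])
    have [measurable]: "N0 \<in> sets Q" using N0(1) by auto
    show ?thesis unfolding B_def by measurable
  qed
  have Ioc: "emeasure (path_measure B w) {a<..b} = ennreal (B b w - B a w)"
    if "w \<in> \<Omega>" "a \<le> b" for w a b
    using Bmono[OF that(1)] Brc[OF that(1)] that(2)
    by (intro emeasure_interval_measure_Ioc) (simp_all add: mono_def)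
  have intB: "integrable Q (\<lambda>w. A (ennreal b) w - A (ennreal a) w)" for a b
    by (intro Bochner_Integration.integrable_diff integrable_A fin)
  have "(\<integral>\<^sup>+w. ennreal (B u w - B t w) \<partial>Q) \<le> (\<integral>\<^sup>+w. ennreal (norm (A (ennreal u) w - A (ennreal t) w)) \<partial>Q)"
  proof (rule nn_integral_mono_AE)
    show "AE w in Q. ennreal (B u w - B t w) \<le> ennreal (norm (A (ennreal u) w - A (ennreal t) w))"
      using BA by eventually_elim (simp add: ennreal_leI)
  qed
  also have "\<dots> < \<infinity>" using intB[of u t] by (simp add: integrable_iff_bounded)
  finally have finB: "(\<integral>\<^sup>+w. ennreal (B u w - B t w) \<partial>Q) < \<infinity>" .
  obtain m where m: "sets m = sets (predictable_sigma \<Omega> F)" "finite_measure m"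
    "\<And>X. X \<in> sets m \<Longrightarrow> emeasure m X =
      (\<integral>\<^sup>+w. emeasure (path_measure B w) {s\<in>{t<..u}. (w, ennreal s) \<in> X} \<partial>Q)"
    by (rule stieltjes_kernel_measure[of \<Omega> F Q B t u, OF filt space_Q sets_F_Q Bmono Brc Bmeas _ _ finB])
      (use tu in simp_all)
  interpret m: finite_measure m by (rule m(2))
  have rect_sets: "C \<times> {ennreal a<..ennreal b} \<in> sets m" if "C \<in> sets (F (ennreal a))" for C a b
    using predictable_sigma_Ioc[OF filt that fin] m(1) by simp
  have rect: "measure m (C \<times> {ennreal a<..ennreal b}) =
      (\<integral>w. indicator C w * (A (ennreal b) w - A (ennreal a) w) \<partial>Q)"
    if C: "C \<in> sets (F (ennreal a))" and ab: "t \<le> a" "a \<le> b" "b \<le> u" for C a b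
  proof -
    have C\<Omega>: "C \<in> sets Q" by (rule sets_F_QD[OF C])
    have pos: "AE w in Q. 0 \<le> indicator C w * (A (ennreal b) w - A (ennreal a) w)"
      using A_inc
    proof eventually_elim
      case (elim w)
      have "A (ennreal a) w \<le> A (ennreal b) w" using ab(2) by (intro increasing_path_mono[OF elim] ennreal_leI) simp_all
      then show ?case by (simp add: indicator_def)
    qed
    have "emeasure m (C \<times> {ennreal a<..ennreal b}) =
      (\<integral>\<^sup>+w. emeasure (path_measure B w) {s\<in>{t<..u}. (w, ennreal s) \<in> C \<times> {ennreal a<..ennreal b}} \<partial>Q)"
      by (rule m(3)[OF rect_sets[OF C]])
    also have "\<dots> = (\<integral>\<^sup>+w. ennreal (indicator C w * (B b w - B a w)) \<partial>Q)"
    proof (rule nn_integral_cong)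
      fix w assume w: "w \<in> space Q"
      have "{s\<in>{t<..u}. (w, ennreal s) \<in> C \<times> {ennreal a<..ennreal b}} = (if w \<in> C then {a<..b} else {})"
        using tu ab by (auto simp: ennreal_less_iff ennreal_le_iff2)
      then show "emeasure (path_measure B w) {s\<in>{t<..u}. (w, ennreal s) \<in> C \<times> {ennreal a<..ennreal b}}
          = ennreal (indicator C w * (B b w - B a w))"
        using Ioc[of w a b] ab(2) w by (simp add: space_Q)
    qed
    also have "\<dots> = (\<integral>\<^sup>+w. ennreal (indicator C w * (A (ennreal b) w - A (ennreal a) w)) \<partial>Q)"
    proof (rule nn_integral_cong_AE)
      show "AE w in Q. ennreal (indicator C w * (B b w - B a w)) =
          ennreal (indicator C w * (A (ennreal b) w - A (ennreal a) w))"
        using BA by eventually_elim simp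
    qed
    also have "\<dots> = ennreal (\<integral>w. indicator C w * (A (ennreal b) w - A (ennreal a) w) \<partial>Q)"
      by (intro nn_integral_eq_integral integrable_indicator_mult C\<Omega> intB pos)
    finally have "emeasure m (C \<times> {ennreal a<..ennreal b}) =
      ennreal (\<integral>w. indicator C w * (A (ennreal b) w - A (ennreal a) w) \<partial>Q)" .
    then show ?thesis unfolding measure_def
      by (simp add: integral_nonneg_AE[OF pos])
  qed
  let ?G = "G \<times> {ennreal t<..ennreal u}"
  have Gm: "?G \<in> sets m" by (rule rect_sets[OF G])
  have Hm: "H \<in> sets m" using H m(1) by simp
  \<comment> \<open>Along almost every path of G the section of H is an initial segment of ]t,u] on
    which \<open>A\<close> grows by at most k.\<close>
  have HG: "measure m (H \<inter> ?G) \<le> k * measure Q G"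
  proof -
    have "emeasure m (H \<inter> ?G) =
      (\<integral>\<^sup>+w. emeasure (path_measure B w) {s\<in>{t<..u}. (w, ennreal s) \<in> H \<inter> ?G} \<partial>Q)"
      by (rule m(3)[OF sets.Int[OF Hm Gm]])
    also have "\<dots> \<le> (\<integral>\<^sup>+w. ennreal k * indicator G w \<partial>Q)"
    proof (rule nn_integral_mono_AE)
      show "AE w in Q. emeasure (path_measure B w) {s\<in>{t<..u}. (w, ennreal s) \<in> H \<inter> ?G}
          \<le> ennreal k * indicator G w"
        using down bound BA AE_space
      proof eventually_elim
        case (elim w)
        show ?case
        proof (cases "w \<in> G")
          case True
          let ?S = "{s\<in>{t<..u}. (w, ennreal s) \<in> H \<inter> ?G}"
          have S: "s \<in> ?S \<longleftrightarrow> t < s \<and> s \<le> u \<and> (w, ennreal s) \<in> H" for s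
            using True tu by (auto simp: ennreal_less_iff intro!: ennreal_leI)
          have "emeasure (path_measure B w) ?S \<le> ennreal k"
          proof (rule emeasure_initial_segment[of _ _ t u])
            show "?S \<subseteq> {t<..u}" by (rule subsetI) simp
            show "v' \<in> ?S" if "v \<in> ?S" "t < v'" "v' \<le> v" for v v'
            proof -
              have v: "v \<le> u" "(w, ennreal v) \<in> H" using that(1) by simp_all
              have "(w, ennreal v') \<in> H" using elim(1) True v that(2,3) by blast
              then show ?thesis using S[of v'] that(2,3) v(1) by simp
            qed
            fix v assume "v \<in> ?S"
            then have v: "t < v" "v \<le> u" "(w, ennreal v) \<in> H" unfolding S by simp_all
            then have "A (ennreal v) w - A (ennreal t) w \<le> k" using elim(2) True by blast
            then show "emeasure (path_measure B w) {t<..v} \<le> ennreal k"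
              using Ioc[of w t v] v(1) elim(3,4) by (simp add: space_Q ennreal_leI)
          qed simp
          then show ?thesis using True by simp
        next
          case False
          then have "{s\<in>{t<..u}. (w, ennreal s) \<in> H \<inter> ?G} = {}" by auto
          then show ?thesis by (simp only: emeasure_empty zero_le)
        qed
      qed
    qed
    also have "\<dots> = ennreal (k * measure Q G)"
      using sets_F_QD[OF G] k by (subst nn_integral_cmult_indicator) (simp_all add: Q.emeasure_eq_measure ennreal_mult)
    finally have "ennreal (measure m (H \<inter> ?G)) \<le> ennreal (k * measure Q G)" by (simp add: m.emeasure_eq_measure)
    then show ?thesis using k by (subst (asm) ennreal_le_iff) simp_all
  qed
  obtain U where U: "U \<in> open_predictable \<Omega> F" "H \<inter> (\<Omega> \<times> {0<..<\<infinity>}) \<subseteq> U" "measure m (U - H) < \<eta>"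
    using predictable_outer_regular[OF filt m(2,1) Hm \<eta>] by (elim bexE conjE)
  have Um: "U \<in> sets m" using open_predictable_sets[OF filt] U(1) m(1) by (simp add: subset_eq)
  obtain R where R: "countable R" "U = \<Union>R"
    "\<forall>X\<in>R. \<exists>A s t. X = A \<times> {s<..<t} \<and> s < \<infinity> \<and> A \<in> sets (F s)"
    using open_predictableE[OF U(1)] by metis
  \<comment> \<open>The empty rectangle is added so that the cover can be enumerated even when R is
    empty.\<close>
  define R' where "R' = insert ({} \<times> {0<..<0}) R"
  have R': "countable R'" "R' \<noteq> {}" "U = \<Union>R'"
    using R by (simp_all add: R'_def)
  have "\<exists>A s t. from_nat_into R' i = A \<times> {s<..<t} \<and> s < \<infinity> \<and> A \<in> sets (F s)" for i
  proof (cases "from_nat_into R' i \<in> R")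
    case True
    then show ?thesis using R(3) by blast
  next
    case False
    then have "from_nat_into R' i = {} \<times> {0<..<0}"
      using from_nat_into[OF R'(2), of i] by (simp only: R'_def insert_iff) simp
    then show ?thesis by (intro exI[of _ "{}"] exI[of _ 0]) simp
  qed
  then obtain a b e where abe: "\<And>i. from_nat_into R' i = a i \<times> {b i<..<e i}" "\<And>i. b i < (\<infinity>::ennreal)"
    "\<And>i. a i \<in> sets (F (b i))" by metis
  have Ueq: "U = (\<Union>i. a i \<times> {b i<..<e i})"
    using range_from_nat_into[OF R'(2,1)] unfolding R'(3) abe(1)[symmetric] by simp
  \<comment> \<open>The rectangles whose time interval contains the half-open cell j. The left
    condition makes \<open>a i\<close> known at the start of the cell; the right one is strict
    because the cell includes its right end.\<close>
  define I where "I n j = {i. i \<le> n \<and> b i \<le> ennreal (grid t u n j) \<and> ennreal (grid t u n (Suc j)) < e i}" for n j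
  have I: "finite (I n j)" for n j by (rule finite_subset[of _ "{..n}"]) (simp_all add: I_def subset_eq)
  \<comment> \<open>All cells up to j are certified by some rectangle at their own left ends, so
    continuing over cell j is a decision of that grid point. On \<open>C n n\<close> the last cell
    is passed and u is reached.\<close>
  define C where "C n j = G \<inter> (\<Inter>l\<in>{..j}. \<Union>i\<in>I n l. a i)" for n j
  have grid_t: "t \<le> grid t u n j" for n j using grid_mono[of t u 0 j n] tu by simp
  show thesis
  proof (rule that)
    show CF: "C n j \<in> sets (F (ennreal (grid t u n j)))" for n j
    proof -
      have "G \<in> sets (F (ennreal (grid t u n j)))" using subsetD[OF sets_F_mono G] grid_t by (simp add: ennreal_leI)
      moreover have "a i \<in> sets (F (ennreal (grid t u n j)))" if "i \<in> I n l" "l \<le> j" for i l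
      proof -
        have "b i \<le> ennreal (grid t u n l)" using that(1) by (simp add: I_def)
        also have "\<dots> \<le> ennreal (grid t u n j)" using grid_mono[of t u l j n] tu that(2) by (simp add: ennreal_leI)
        finally show ?thesis using subsetD[OF sets_F_mono abe(3)] by blast
      qed
      then have "(\<Inter>l\<in>{..j}. \<Union>i\<in>I n l. a i) \<in> sets (F (ennreal (grid t u n j)))"
        by (intro sets.finite_INT sets.finite_UN I) simp_all
      ultimately show ?thesis unfolding C_def by (rule sets.Int)
    qed
    show "C n (Suc j) \<subseteq> C n j" for n j unfolding C_def by (simp add: atMost_Suc) blast
    show CG: "C n j \<subseteq> G" for n j unfolding C_def by simp
    show "(\<Sum>j<Suc n. \<integral>w. indicator (C n j) w *
        (A (ennreal (grid t u n (Suc j))) w - A (ennreal (grid t u n j)) w) \<partial>Q) \<le> k * measure Q G + \<eta>" for n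
    proof -
      let ?g = "grid t u n"
      let ?X = "\<lambda>j. C n j \<times> {ennreal (?g j)<..ennreal (?g (Suc j))}"
      have X: "?X j \<in> sets m" for j by (rule rect_sets[OF CF])
      have "(\<Sum>j<Suc n. \<integral>w. indicator (C n j) w * (A (ennreal (?g (Suc j))) w - A (ennreal (?g j)) w) \<partial>Q)
        = (\<Sum>j<Suc n. measure m (?X j))"
      proof (intro sum.cong refl rect[symmetric] CF grid_t)
        fix j assume "j \<in> {..<Suc n}"
        then have j: "Suc j \<le> Suc n" by simp
        show "?g j \<le> ?g (Suc j)" using tu by (intro grid_mono) simp_all
        show "?g (Suc j) \<le> u" using grid_bounds[OF _ j, of t u] tu by simp
      qed
      also have "\<dots> = measure m (\<Union>j\<in>{..<Suc n}. ?X j)"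
      proof (rule m.finite_measure_finite_Union[symmetric])
        have "?X i \<inter> ?X j = {}" if "i < j" for i j
        proof -
          have "ennreal (?g (Suc i)) \<le> ennreal (?g j)" using that tu by (intro ennreal_leI grid_mono) simp_all
          then have "{ennreal (?g i)<..ennreal (?g (Suc i))} \<inter> {ennreal (?g j)<..ennreal (?g (Suc j))} = {}" by auto
          then show ?thesis by (simp only: Times_Int_Times Times_empty simp_thms)
        qed
        then show "disjoint_family_on ?X {..<Suc n}"
          unfolding disjoint_family_on_def by (metis Int_commute linorder_neqE_nat)
      qed (use X in auto)
      \<comment> \<open>Every cell that is passed lies in U, hence in H or in the small excess of
        the cover.\<close>
      also have "\<dots> \<le> measure m ((H \<inter> ?G) \<union> (U - H))"
      proof (intro m.finite_measure_mono subsetI)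
        fix p assume "p \<in> (\<Union>j\<in>{..<Suc n}. ?X j)"
        then obtain j where j: "j < Suc n" "p \<in> ?X j" by blast
        then obtain w s where p: "p = (w, s)" "w \<in> C n j" "ennreal (?g j) < s" "s \<le> ennreal (?g (Suc j))" by auto
        from p(2) obtain i where i: "i \<in> I n j" "w \<in> a i" unfolding C_def by blast
        have "b i < s" using i(1) p(3) unfolding I_def by (auto intro: le_less_trans)
        moreover have "s < e i" using i(1) p(4) unfolding I_def by (auto intro: le_less_trans)
        ultimately have "p \<in> U" unfolding Ueq p(1) using i(2) by (intro UN_I[of i]) simp_all
        moreover have "ennreal t < s" using grid_t[of n j] p(3) by (meson ennreal_leI le_less_trans)
        moreover have "s \<le> ennreal u"
        proof -
          have "?g (Suc j) \<le> u" using grid_bounds[of t u "Suc j" n] tu j(1) by simp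
          then show ?thesis using p(4) ennreal_leI order_trans by blast
        qed
        moreover have "w \<in> G" using p(2) CG by blast
        ultimately show "p \<in> (H \<inter> ?G) \<union> (U - H)" unfolding p(1) by simp
      qed (use Hm Gm Um in auto)
      also have "\<dots> \<le> measure m (H \<inter> ?G) + measure m (U - H)"
        using Hm Gm Um by (intro measure_Un_le) auto
      finally show ?thesis using HG U(3) by simp
    qed
    fix w assume w: "w \<in> G" and cov: "\<And>s. t \<le> s \<Longrightarrow> s \<le> u \<Longrightarrow> (w, ennreal s) \<in> H"
    \<comment> \<open>The time sections of the rectangles are open and cover the compact interval
      [t,u]. As U covers H at positive times only, this relies on t > 0.\<close>
    define W where "W i = (if w \<in> a i then ennreal -` {b i<..<e i} else {})" for i
    have W: "open (W i)" for i
      unfolding W_def using continuous_on_ennreal[OF continuous_on_id, of UNIV] by (auto intro: open_vimage)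
    have "{t..u} \<subseteq> (\<Union>i. W i)"
    proof
      fix s assume "s \<in> {t..u}"
      then have s: "t \<le> s" "s \<le> u" by simp_all
      have "(w, ennreal s) \<in> H \<inter> (\<Omega> \<times> {0<..<\<infinity>})" using cov[OF s] w G\<Omega> s tu by (auto simp: ennreal_zero_less_top)
      then have "(w, ennreal s) \<in> U" using U(2) by blast
      then obtain i where "(w, ennreal s) \<in> a i \<times> {b i<..<e i}" unfolding Ueq by blast
      then have "s \<in> W i" by (simp add: W_def)
      then show "s \<in> (\<Union>i. W i)" by blast
    qed
    from grid_cover[OF W this tu(2)] obtain n0
      where n0: "\<And>n j. n0 \<le> n \<Longrightarrow> j \<le> n \<Longrightarrow> \<exists>i\<le>n. {grid t u n j..grid t u n (Suc j)} \<subseteq> W i" by blast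
    have "w \<in> C n n" if n: "n0 \<le> n" for n
      unfolding C_def
    proof (intro IntI w INT_I)
      fix j assume "j \<in> {..n}"
      then obtain i where i: "i \<le> n" "{grid t u n j..grid t u n (Suc j)} \<subseteq> W i" using n0[OF n, of j] by auto
      have le: "grid t u n j \<le> grid t u n (Suc j)" using tu by (intro grid_mono) simp_all
      have "grid t u n j \<in> W i" "grid t u n (Suc j) \<in> W i" using i(2) le by (simp_all add: subset_eq)
      then have "w \<in> a i" "b i < ennreal (grid t u n j)" "ennreal (grid t u n (Suc j)) < e i"
        unfolding W_def by (simp_all split: if_splits)
      then show "w \<in> (\<Union>i\<in>I n j. a i)" using i(1) by (intro UN_I[of i]) (simp_all add: I_def)
    qed
    then show "\<exists>n0. \<forall>n\<ge>n0. w \<in> C n n" by blast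
  qed
qed

end

subsection \<open>A finite Hellinger process keeps the densities away from zero\<close>

context hellinger_pair
begin

text \<open>Optional stopping on a grid: the sum vanishes for a martingale, and for \<open>Y\<close>
  it is minus the mean growth of \<open>A\<close> up to the stop.\<close>

lemma integral_stop_val:
  fixes X :: "nat \<Rightarrow> 'a \<Rightarrow> real"
  assumes G: "G \<in> sets Q" and C: "\<And>k. C k \<in> sets Q" "\<And>k. C (Suc k) \<subseteq> C k" "\<And>k. C k \<subseteq> G"
    and X: "\<And>k. integrable Q (X k)"
  shows "integrable Q (\<lambda>w. indicator G w * stop_val X C n w)"
    and "(\<integral>w. indicator G w * stop_val X C n w \<partial>Q) =
      (\<integral>w. indicator G w * X 0 w \<partial>Q) + (\<Sum>k<n. \<integral>w. indicator (C k) w * (X (Suc k) w - X k w) \<partial>Q)"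
proof -
  have eq: "indicator G w * stop_val X C n w =
      indicator G w * X 0 w + (\<Sum>k<n. indicator (C k) w * (X (Suc k) w - X k w))" for w
  proof -
    have GC: "indicator G w * indicator (C k) w = (indicator (C k) w :: real)" for k
      using C(3)[of k] by (auto simp: indicator_def)
    have "indicator G w * stop_val X C n w = indicator G w * X 0 w +
        (\<Sum>k<n. (indicator G w * indicator (C k) w) * (X (Suc k) w - X k w))"
      unfolding stop_val_sum[where C = C, OF C(2)] by (simp only: distrib_left sum_distrib_left mult.assoc)
    then show ?thesis by (simp only: GC)
  qed
  have i0: "integrable Q (\<lambda>w. indicator G w * X 0 w)" by (intro integrable_indicator_mult G X)
  have ik: "integrable Q (\<lambda>w. indicator (C k) w * (X (Suc k) w - X k w))" for k
    by (intro integrable_indicator_mult C Bochner_Integration.integrable_diff X)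
  show "integrable Q (\<lambda>w. indicator G w * stop_val X C n w)"
    unfolding eq by (intro Bochner_Integration.integrable_add Bochner_Integration.integrable_sum i0 ik)
  show "(\<integral>w. indicator G w * stop_val X C n w \<partial>Q) =
      (\<integral>w. indicator G w * X 0 w \<partial>Q) + (\<Sum>k<n. \<integral>w. indicator (C k) w * (X (Suc k) w - X k w) \<partial>Q)"
    unfolding eq Bochner_Integration.integral_sum[of "{..<n}" Q, OF ik, symmetric]
    by (intro Bochner_Integration.integral_add Bochner_Integration.integrable_sum i0 ik)
qed

lemma AE_z_le_rat:
  "AE w in Q. \<forall>q\<in>rat_times. 0 \<le> z q w \<and> z q w \<le> 2 \<and> 0 \<le> z' q w \<and> z' q w \<le> 2"
  by (rule AE_ball_countable[THEN iffD2]) (use AE_z_le in auto)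

lemma h_diff_le:
  assumes "increasing_path (\<lambda>t. h t w)" "t \<le> v" "v < \<infinity>" "h v w \<le> ennreal a" "ennreal a \<le> h t w + d"
  shows "h v w - h t w \<le> d"
proof -
  have "h t w \<le> h v w" using increasing_path_mono[OF assms(1-3)] .
  \<comment> \<open>Cancellation in the extended reals requires the subtracted term to be
    finite.\<close>
  then have fin: "h t w \<noteq> top" using assms(4) by (metis ennreal_neq_top neq_top_trans order_trans)
  have "h v w - h t w \<le> (h t w + d) - h t w" using assms(4,5) by (intro ennreal_minus_mono) (rule order_trans, simp_all)
  also have "\<dots> = d" using fin by simp
  finally show ?thesis .
qed

text \<open>On \<open>G\<close>, where \<open>z\<close> is comparable to \<open>p\<^sup>2\<close>, the process \<open>Y\<close> loses at most a quarter of its mean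
  while \<open>h\<close> grows by less than \<open>1/64\<close> and \<open>z\<close> stays below \<open>32 p\<^sup>2\<close>; by the inequality of Cauchy and Schwarz
  the remaining mean cannot be carried by a set of small measure.\<close>

lemma mass_outside_le_layer:
  assumes t: "0 < t" and G: "G \<in> sets (F (ennreal t))" and p: "0 < p"
    and Gz: "\<And>w. w \<in> G \<Longrightarrow> p\<^sup>2 / 4 < z (ennreal t) w \<and> z (ennreal t) w \<le> p\<^sup>2 \<and> z (ennreal t) w \<le> 1/2"
    and Gh: "\<And>w. w \<in> G \<Longrightarrow> ennreal a \<le> h (ennreal t) w + ennreal (1/64)"
    and N: "N \<in> sets Q" and Nh: "AE w in Q. w \<in> N \<longrightarrow> (\<forall>s. h (ennreal s) w \<le> ennreal a)"
    and Nz: "AE w in Q. w \<in> N \<longrightarrow> z \<infinity> w = 0"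
  shows "measure Q G \<le> 32 * measure Q (G - N)"
proof -
  have G\<Omega>: "G \<subseteq> \<Omega>" using sets.sets_into_space[OF G] by (simp add: space_F)
  have GQ: "G \<in> sets Q" by (rule sets_F_QD[OF G])
  \<comment> \<open>The mean of z over G is at most p^2 times the mass of G, so z exceeds L on at
    most 1/32 of that mass.\<close>
  define L where "L = 32 * p\<^sup>2"
  define D where "D = {q\<in>rat_times. ennreal t \<le> q}"
  have D: "countable D" unfolding D_def by (rule countable_subset[OF _ countable_rat_times]) auto
  define E where "E = (\<Union>q\<in>D. {w\<in>G. L < z q w})"
  have EQ: "E \<in> sets Q"
  proof -
    have "{w\<in>G. L < z q w} = G \<inter> {w\<in>space Q. L < z q w}" for q using G\<Omega> by (auto simp: space_Q)
    then have "{w\<in>G. L < z q w} \<in> sets Q" for q using GQ by simp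
    then show ?thesis unfolding E_def by (intro sets.countable_UN'[OF D] image_subsetI)
  qed
  have \<mu>G: "measure \<mu> G \<le> p\<^sup>2 * measure Q G"
  proof -
    have "measure \<mu> G = (\<integral>w. indicator G w * z (ennreal t) w \<partial>Q)" by (rule measure_\<mu>[OF G, symmetric])
    also have "\<dots> \<le> (\<integral>w. p\<^sup>2 * indicator G w \<partial>Q)"
      by (intro integral_mono integrable_indicator_mult integrable_mult_right integrable_ind GQ integrable_z)
        (use Gz in \<open>auto simp: indicator_def\<close>)
    finally show ?thesis using sets.Int_space_eq2[OF GQ] by simp
  qed
  have QE: "32 * measure Q E \<le> measure Q G"
  proof -
    have "ennreal L * emeasure Q E \<le> emeasure \<mu> G"
      unfolding E_def by (rule high_values[OF D _ _ G]) (auto simp: D_def L_def)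
    then have "ennreal (L * measure Q E) \<le> ennreal (measure \<mu> G)"
      using finite_measure.emeasure_eq_measure[OF prob_space.finite_measure[OF \<mu>(1)]]
      by (simp add: Q.emeasure_eq_measure ennreal_mult L_def)
    then have "L * measure Q E \<le> measure \<mu> G" by (subst (asm) ennreal_le_iff) simp_all
    then have "p\<^sup>2 * (32 * measure Q E) \<le> p\<^sup>2 * measure Q G" using \<mu>G by (simp add: L_def)
    then show ?thesis using p by simp
  qed
  define W where "W = (G - N) \<union> E"
  have WQ: "W \<in> sets Q" unfolding W_def using GQ N EQ by auto
  \<comment> \<open>H treats the two conditions differently. The value of h at the current time must
    not exceed a, so a large jump of h is excluded, which is predictable because h is. An excess of
    z counts only strictly after it occurs: a jump of z at the final time is harmless, since
    \<open>A\<close> sees \<open>Y\<close> through left limits.\<close>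
  define H where "H = {x \<in> space (predictable_sigma \<Omega> F). (\<lambda>(w, s). h s w) x \<le> ennreal a} -
      (\<Union>q\<in>D. {w\<in>\<Omega>. L < z q w} \<times> {q<..<\<infinity>})"
  have H: "H \<in> sets (predictable_sigma \<Omega> F)"
  proof -
    have "(\<lambda>(w, s). h s w) -` {..ennreal a} \<inter> space (predictable_sigma \<Omega> F) \<in> sets (predictable_sigma \<Omega> F)"
      using h_pred unfolding predictable_process_def by (rule measurable_sets) simp
    also have "(\<lambda>(w, s). h s w) -` {..ennreal a} \<inter> space (predictable_sigma \<Omega> F)
        = {x \<in> space (predictable_sigma \<Omega> F). (\<lambda>(w, s). h s w) x \<le> ennreal a}" by blast
    finally have *: "\<dots> \<in> sets (predictable_sigma \<Omega> F)" .
    have "{w\<in>\<Omega>. L < z q w} \<in> sets (F q)" for q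
    proof -
      have "{w\<in>space (F q). L < z q w} \<in> sets (F q)" using z_F[of q] by measurable
      then show ?thesis by (simp add: space_F)
    qed
    then show ?thesis unfolding H_def
      by (intro sets.Diff * sets.countable_UN'[OF D] image_subsetI predictable_sigma_Ioo[OF filt])
  qed
  have H_iff: "(w, ennreal v) \<in> H \<longleftrightarrow> h (ennreal v) w \<le> ennreal a \<and> (\<forall>q\<in>D. q < ennreal v \<longrightarrow> z q w \<le> L)"
    if "w \<in> G" for w v
  proof -
    have "w \<in> \<Omega>" using that G\<Omega> by blast
    then show ?thesis unfolding H_def space_predictable_sigma[OF filt] by (auto simp: not_less)
  qed
  have key: "(p/4) * measure Q G \<le> 4 * p * measure Q W + 3 * \<eta>" if \<eta>: "0 < \<eta>" for \<eta>
  proof -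
    obtain t0 where t0: "0 \<le> t0" "\<And>u. t0 \<le> u \<Longrightarrow> (\<integral>w. indicator N w * Y (ennreal u) w \<partial>Q) \<le> \<eta>"
      using Y_vanishes[OF N Nz \<eta>] by blast
    define u where "u = max t0 (t + 1)"
    have tu: "t < u" and YN: "(\<integral>w. indicator N w * Y (ennreal u) w \<partial>Q) \<le> \<eta>"
      using t0(2)[of u] by (auto simp: u_def)
    have p8: "0 \<le> p / 8" using p by simp
    have down: "AE w in Q. w \<in> G \<longrightarrow>
        (\<forall>v v'. v \<le> u \<longrightarrow> t < v' \<longrightarrow> v' \<le> v \<longrightarrow> (w, ennreal v) \<in> H \<longrightarrow> (w, ennreal v') \<in> H)"
      using h_inc
    proof eventually_elim
      case (elim w)
      show ?case
      proof (intro impI allI)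
        fix v v' assume w: "w \<in> G" and v: "v' \<le> v" "(w, ennreal v) \<in> H"
        have le: "ennreal v' \<le> ennreal v" using v(1) by (rule ennreal_leI)
        have "h (ennreal v') w \<le> h (ennreal v) w" by (rule increasing_path_mono[OF elim le]) simp
        then have "h (ennreal v') w \<le> ennreal a"
          by (rule order_trans) (use v(2) H_iff[OF w, of v] in simp)
        moreover have "z q w \<le> L" if "q \<in> D" "q < ennreal v'" for q
          using v(2) H_iff[OF w] that le by (meson less_le_trans)
        ultimately show "(w, ennreal v') \<in> H" using H_iff[OF w] by blast
      qed
    qed
    have bound: "AE w in Q. w \<in> G \<longrightarrow>
        (\<forall>v. t < v \<longrightarrow> v \<le> u \<longrightarrow> (w, ennreal v) \<in> H \<longrightarrow> A (ennreal v) w - A (ennreal t) w \<le> p / 8)"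
      using h_inc A_inc AE_A_le AE_z_le_rat
    proof eventually_elim
      case (elim w)
      show ?case
      proof (intro impI allI)
        fix v assume w: "w \<in> G" and v: "t < v" "(w, ennreal v) \<in> H"
        have hv: "h (ennreal v) w \<le> ennreal a" and zq: "\<And>q. q \<in> D \<Longrightarrow> q < ennreal v \<Longrightarrow> z q w \<le> L"
          using v(2) H_iff[OF w] by auto
        have le: "ennreal t \<le> ennreal v" using v(1) by (intro ennreal_leI) simp
        have "Y q w \<le> 8 * p" if q: "q \<in> rat_times" "ennreal t \<le> q" "q < ennreal v" for q
        proof -
          have "z q w * z' q w \<le> L * 2"
            using elim(4) q zq[of q] by (intro mult_mono) (auto simp: D_def L_def)
          also have "\<dots> = (8 * p)\<^sup>2" by (simp add: L_def power2_eq_square)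
          finally show ?thesis unfolding Y using p by (intro real_le_lsqrt) simp_all
        qed
        moreover have "h (ennreal v) w < \<infinity>" using hv by (rule le_less_trans) simp
        ultimately have "ennreal (A (ennreal v) w) \<le>
            ennreal (A (ennreal t) w) + ennreal (8 * p) * (h (ennreal v) w - h (ennreal t) w)"
          using elim(3) t v(1) by (meson less_imp_le)
        also have "\<dots> \<le> ennreal (A (ennreal t) w) + ennreal (8 * p) * ennreal (1/64)"
          by (intro add_left_mono mult_left_mono h_diff_le[OF elim(1) le _ hv Gh[OF w]]) simp_all
        also have "\<dots> = ennreal (A (ennreal t) w + p / 8)"
        proof -
          have "0 \<le> A (ennreal t) w"
            using increasing_path_mono[OF elim(2), of 0 "ennreal t"] elim(2) by (simp add: increasing_path_def)
          moreover have "ennreal (8 * p) * ennreal (1/64) = ennreal (p / 8)"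
            using p by (subst ennreal_mult[symmetric]) simp_all
          ultimately show ?thesis using p by (simp add: ennreal_plus)
        qed
        finally have "A (ennreal v) w \<le> A (ennreal t) w + p / 8"
          using increasing_path_mono[OF elim(2), of 0 "ennreal t"] elim(2) p
          by (subst (asm) ennreal_le_iff) (simp_all add: increasing_path_def)
        then show "A (ennreal v) w - A (ennreal t) w \<le> p / 8" by simp
      qed
    qed
    obtain C where CF: "\<And>n j. C n j \<in> sets (F (ennreal (grid t u n j)))"
      and Cdec: "\<And>n j. C n (Suc j) \<subseteq> C n j" and CG: "\<And>n j. C n j \<subseteq> G"
      and Csum: "\<And>n. (\<Sum>j<Suc n. \<integral>w. indicator (C n j) w *
        (A (ennreal (grid t u n (Suc j))) w - A (ennreal (grid t u n j)) w) \<partial>Q) \<le> p / 8 * measure Q G + \<eta>"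
      and Cev: "\<And>w. w \<in> G \<Longrightarrow> (\<And>s. t \<le> s \<Longrightarrow> s \<le> u \<Longrightarrow> (w, ennreal s) \<in> H) \<Longrightarrow> \<exists>n0. \<forall>n\<ge>n0. w \<in> C n n"
      by (rule predictable_stopping[OF t tu G H p8 \<eta> down bound]) blast
    have CQ: "C n j \<in> sets Q" for n j by (rule sets_F_QD[OF CF])
    \<comment> \<open>On G - W the sample lies in N and z never exceeds L at a rational time from t
      on, so the whole path stays in H and fine grids do not stop it. \<open>bad n\<close> collects
      the samples that the n-th grid still stops too early.\<close>
    define bad where "bad n = (G - W) - C n n" for n
    have badQ: "bad n \<in> sets Q" for n unfolding bad_def using GQ WQ CQ by auto
    have "(\<lambda>n. \<integral>w. indicator (bad n) w \<partial>Q) \<longlonglongrightarrow> (\<integral>w. 0 \<partial>Q :: real)"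
    proof (rule integral_dominated_convergence[where w = "\<lambda>_. 1"])
      show "AE w in Q. (\<lambda>n. indicator (bad n) w :: real) \<longlonglongrightarrow> 0"
        using Nh AE_z_le_rat
      proof eventually_elim
        case (elim w)
        show ?case
        proof (cases "w \<in> G - W")
          case True
          then have w: "w \<in> G" "w \<in> N" "w \<notin> E" by (auto simp: W_def)
          have "z q w \<le> L" if "q \<in> D" for q using w(1,3) that by (auto simp: E_def not_less)
          then have "(w, ennreal s) \<in> H" for s using H_iff[OF w(1)] elim(1) w(2) by blast
          then obtain n0 where "\<forall>n\<ge>n0. w \<in> C n n" using Cev[OF w(1)] by blast
          then have "\<forall>\<^sub>F n in sequentially. (indicator (bad n) w :: real) = 0"
            unfolding eventually_sequentially by (intro exI[of _ n0]) (simp add: bad_def)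
          then show ?thesis by (rule tendsto_eventually)
        next
          case False
          then show ?thesis by (simp add: bad_def)
        qed
      qed
      show "indicator (bad n) \<in> borel_measurable Q" for n using badQ by simp
      show "AE w in Q. norm (indicator (bad n) w :: real) \<le> 1" for n by (simp add: indicator_def)
    qed simp_all
    then have "(\<lambda>n. measure Q (bad n)) \<longlonglongrightarrow> 0" using sets.Int_space_eq2[OF badQ] by simp
    from order_tendstoD(2)[OF this \<eta>] obtain n where n: "measure Q (bad n) < \<eta>"
      by (auto simp: eventually_sequentially)
    let ?g = "\<lambda>j. ennreal (grid t u n j)"
    let ?s = "\<lambda>X. stop_val (\<lambda>j. X (?g j)) (C n) (Suc n)"
    note intG = integral_stop_val[where G = G and C = "C n", OF GQ CQ Cdec CG]
    \<comment> \<open>At time t, z > p^2/4 and z' \<ge> 1 give \<open>Y\<close> at least p/2; the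
      growth of \<open>A\<close> takes away p/8 and the error \<eta> of the cover.\<close>
    have Yl: "(3/8 * p) * measure Q G - \<eta> \<le> (\<integral>w. indicator G w * ?s Y w \<partial>Q)"
    proof -
      have "(\<Sum>j<Suc n. \<integral>w. indicator (C n j) w * (Y (?g (Suc j)) w - Y (?g j) w) \<partial>Q)
          = (\<Sum>j<Suc n. - (\<integral>w. indicator (C n j) w * (A (?g (Suc j)) w - A (?g j) w) \<partial>Q))"
      proof (intro sum.cong refl)
        fix j
        have le: "?g j \<le> ?g (Suc j)"
          using tu by (intro ennreal_leI grid_mono) simp_all
        have "(\<integral>w. indicator (C n j) w * (A (?g (Suc j)) w - A (?g j) w) \<partial>Q)
          = (\<integral>w. indicator (C n j) w * (Y (?g j) w - Y (?g (Suc j)) w) \<partial>Q)"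
          by (rule integral_A_increment[OF le _ CF]) simp
        also have "\<dots> = (\<integral>w. - (indicator (C n j) w * (Y (?g (Suc j)) w - Y (?g j) w)) \<partial>Q)"
          by (intro Bochner_Integration.integral_cong refl) (simp add: algebra_simps)
        finally show "(\<integral>w. indicator (C n j) w * (Y (?g (Suc j)) w - Y (?g j) w) \<partial>Q)
          = - (\<integral>w. indicator (C n j) w * (A (?g (Suc j)) w - A (?g j) w) \<partial>Q)"
          by simp
      qed
      moreover have "p / 2 * measure Q G \<le> (\<integral>w. indicator G w * Y (ennreal t) w \<partial>Q)"
      proof -
        have "(\<integral>w. p / 2 * indicator G w \<partial>Q) \<le> (\<integral>w. indicator G w * Y (ennreal t) w \<partial>Q)"
        proof (rule integral_mono_AE)
          show "AE w in Q. p / 2 * indicator G w \<le> indicator G w * Y (ennreal t) w"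
            using AE_sum[of "ennreal t"]
          proof eventually_elim
            case (elim w)
            have "p / 2 \<le> Y (ennreal t) w" if "w \<in> G"
            proof -
              have "1 \<le> z' (ennreal t) w" using elim Gz[OF that] by linarith
              then have "(p/2)\<^sup>2 * 1 \<le> z (ennreal t) w * z' (ennreal t) w"
                using Gz[OF that] by (intro mult_mono) (auto simp: power2_eq_square)
              then show ?thesis unfolding Y by (intro real_le_rsqrt) simp
            qed
            then show ?case by (simp add: indicator_def)
          qed
        qed (intro integrable_indicator_mult integrable_mult_right integrable_ind GQ integrable_Y)+
        then show ?thesis using sets.Int_space_eq2[OF GQ] by simp
      qed
      ultimately show ?thesis unfolding intG(2)[OF integrable_Y] using Csum[of n] by (simp add: sum_negf)
    qed
    \<comment> \<open>Stopping does not change the mean of the martingale z.\<close>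
    have zs: "(\<integral>w. indicator G w * ?s z w \<partial>Q) \<le> p\<^sup>2 * measure Q G"
    proof -
      have "(\<integral>w. indicator (C n j) w * (z (?g (Suc j)) w - z (?g j) w) \<partial>Q) = 0" for j
      proof -
        have le: "?g j \<le> ?g (Suc j)"
          using tu by (intro ennreal_leI grid_mono) simp_all
        have C': "C n j \<in> sets (F (?g (Suc j)))" using CF sets_F_mono[OF le] by blast
        show ?thesis unfolding right_diff_distrib
          by (subst Bochner_Integration.integral_diff)
            (simp_all add: integrable_indicator_mult CQ integrable_z measure_\<mu>[OF CF] measure_\<mu>[OF C'])
      qed
      then show ?thesis unfolding intG(2)[OF integrable_z] using \<mu>G measure_\<mu>[OF G] by simp
    qed
    \<comment> \<open>A sample of G outside W and \<open>bad n\<close> lies in N and is never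
      stopped, so its value is \<open>Y\<close> at u, small in the mean. On \<open>bad n\<close> the
      bound 1 suffices. On W the weighted inequality with k = 2 p is used, which gives the
      coefficient 1/(8 p) for z and 4 p for the rest.\<close>
    have "(\<integral>w. indicator G w * ?s Y w \<partial>Q) \<le>
      (\<integral>w. (indicator N w * Y (ennreal u) w + indicator (bad n) w) +
        ((1 / (8 * p)) * (indicator G w * ?s z w) + 4 * p * indicator W w) \<partial>Q)"
    proof (rule integral_mono_AE)
      have AEg: "AE w in Q. \<forall>j. 0 \<le> z (?g j) w \<and> 0 \<le> z' (?g j) w \<and>
          z' (?g j) w \<le> 2 \<and> 0 \<le> Y (?g j) w \<and> Y (?g j) w \<le> 1"
        unfolding AE_all_countable
      proof
        fix j show "AE w in Q. 0 \<le> z (?g j) w \<and> 0 \<le> z' (?g j) w \<and>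
          z' (?g j) w \<le> 2 \<and> 0 \<le> Y (?g j) w \<and> Y (?g j) w \<le> 1"
          using AE_z_le[of "?g j"] AE_Y_bounds[of "?g j"]
          by eventually_elim simp
      qed
      then show "AE w in Q. indicator G w * ?s Y w \<le>
        (indicator N w * Y (ennreal u) w + indicator (bad n) w) +
        ((1 / (8 * p)) * (indicator G w * ?s z w) + 4 * p * indicator W w)"
        using AE_Y_bounds[of "ennreal u"]
      proof eventually_elim
        case (elim w)
        have b: "0 \<le> ?s z w \<and> ?s Y w \<le> 1 \<and> ?s Y w \<le> ?s z w / (8 * p) + 4 * p"
        proof (rule stop_val_cases[of "Suc n" "\<lambda>a b _. 0 \<le> a \<and> b \<le> 1 \<and> b \<le> a / (8 * p) + 4 * p"])
          fix j
          have "Y (?g j) w \<le> z (?g j) w / (4 * (2 * p)) + 2 * p * z' (?g j) w"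
            using elim(1) p by (intro Y_le_weighted) auto
          also have "2 * p * z' (?g j) w \<le> 2 * p * 2" using elim(1) p by (intro mult_left_mono) auto
          finally show "0 \<le> z (?g j) w \<and> Y (?g j) w \<le> 1 \<and>
              Y (?g j) w \<le> z (?g j) w / (8 * p) + 4 * p"
            using elim(1) by simp
        qed
        have last: "?s Y w = Y (ennreal u) w" if "w \<in> C n n" using that by simp
        have zp: "0 \<le> ?s z w / (8 * p)" using b p by simp
        consider "w \<notin> G" | "w \<in> G" "w \<in> W" | "w \<in> G" "w \<notin> W" "w \<in> N" "w \<in> C n n" | "w \<in> bad n" "w \<in> G"
          by (auto simp: W_def bad_def)
        then show ?case
        proof cases
          case 1
          then show ?thesis using elim(2) p by (simp add: indicator_def)
        next
          case 2
          then show ?thesis using elim(2) b p by (simp add: indicator_def del: stop_val.simps)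
        next
          case 3
          then show ?thesis using elim(2) zp p last by (simp add: indicator_def del: stop_val.simps)
        next
          case 4
          have y1: "?s Y w \<le> 1" using b by blast
          from 4 show ?thesis using elim(2) zp y1 p by (auto simp: indicator_def simp del: stop_val.simps)
        qed
      qed
    qed (intro Bochner_Integration.integrable_add integrable_mult_right integrable_indicator_mult
        integrable_ind intG(1) integrable_Y integrable_z N badQ WQ)+
    also have "\<dots> = ((\<integral>w. indicator N w * Y (ennreal u) w \<partial>Q) + measure Q (bad n)) +
        ((1 / (8 * p)) * (\<integral>w. indicator G w * ?s z w \<partial>Q) + 4 * p * measure Q W)"
    proof -
      note i = integrable_indicator_mult[OF N integrable_Y] integrable_ind[OF badQ] integrable_ind[OF WQ]
        intG(1)[OF integrable_z]
      show ?thesis using i sets.Int_space_eq2[OF badQ] sets.Int_space_eq2[OF WQ] by (simp del: stop_val.simps)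
    qed
    also have "\<dots> \<le> (\<eta> + \<eta>) + ((1 / (8 * p)) * (p\<^sup>2 * measure Q G) + 4 * p * measure Q W)"
      using YN n zs p by (intro add_mono mult_left_mono) simp_all
    also have "(1 / (8 * p)) * (p\<^sup>2 * measure Q G) = p / 8 * measure Q G"
      using p by (simp add: power2_eq_square)
    finally show ?thesis using Yl by (simp add: algebra_simps)
  qed
  have "(p/4) * measure Q G \<le> 4 * p * measure Q W"
  proof (rule field_le_epsilon)
    fix e :: real assume "0 < e"
    then show "(p/4) * measure Q G \<le> 4 * p * measure Q W + e" using key[of "e/3"] by simp
  qed
  then have "p * measure Q G \<le> p * (16 * measure Q W)" by simp
  then have "measure Q G \<le> 16 * measure Q W" using p by simp
  \<comment> \<open>The overshoot event contributes 16/32, one half of the mass of G, and is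
    absorbed on the left; this doubles 16 to 32.\<close>
  also have "measure Q W \<le> measure Q (G - N) + measure Q E"
    unfolding W_def using GQ N EQ by (intro measure_Un_le) auto
  finally show ?thesis using QE by simp
qed

end

section \<open>Summation over layers and divergence of h at infinity\<close>

lemma dyadic_layer:
  fixes x :: real
  assumes "0 < x" "x \<le> 1"
  shows "\<exists>k::nat. ((1/2)^k)\<^sup>2 / 4 < x \<and> x \<le> ((1/2)^k)\<^sup>2"
proof -
  have sq: "((1/2::real)^k)\<^sup>2 = (1/4)^k" for k
    by (simp add: power_mult[symmetric] mult.commute power_divide power2_eq_square) (simp add: power_mult_distrib[symmetric])
  obtain n where "(1/4::real)^n < x" using real_arch_pow_inv[OF assms(1), of "1/4"] by auto
  then have ex: "(1/4::real)^(Suc n) < x" using assms by simp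
  define k where "k = (LEAST k. (1/4::real)^(Suc k) < x)"
  have k1: "(1/4::real)^(Suc k) < x" unfolding k_def using ex by (rule LeastI)
  have "x \<le> (1/4)^k"
  proof (cases k)
    case 0
    then show ?thesis using assms by simp
  next
    case (Suc j)
    then have "\<not> (1/4::real)^(Suc j) < x" using not_less_Least[of j "\<lambda>k. (1/4::real)^(Suc k) < x"] by (simp add: k_def)
    then show ?thesis using Suc by simp
  qed
  with k1 show ?thesis unfolding sq by (intro exI[of _ k]) simp
qed

context hellinger_pair
begin

text \<open>The constant in the estimate for one layer is independent of p, so the estimates add up
  over the disjoint layers of z at time t, with p running through the powers of 1/2.\<close>

lemma mass_outside_le:
  assumes t: "0 < t" and G: "G \<in> sets (F (ennreal t))"
    and Gz: "\<And>w. w \<in> G \<Longrightarrow> 0 < z (ennreal t) w \<and> z (ennreal t) w \<le> 1/2"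
    and Gh: "\<And>w. w \<in> G \<Longrightarrow> ennreal a \<le> h (ennreal t) w + ennreal (1/64)"
    and N: "N \<in> sets Q" and Nh: "AE w in Q. w \<in> N \<longrightarrow> (\<forall>s. h (ennreal s) w \<le> ennreal a)"
    and Nz: "AE w in Q. w \<in> N \<longrightarrow> z \<infinity> w = 0"
  shows "measure Q G \<le> 32 * measure Q (G - N)"
proof -
  define p where "p k = (1/2::real)^k" for k :: nat
  have p: "0 < p k" for k by (simp add: p_def)
  have pS: "(p (Suc k))\<^sup>2 = (p k)\<^sup>2 / 4" for k by (simp add: p_def power2_eq_square)
  have pmono: "(p l)\<^sup>2 \<le> (p k)\<^sup>2 / 4" if "k < l" for k l
  proof -
    have "p l \<le> p (Suc k)" using that unfolding p_def by (intro power_decreasing) simp_all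
    then have "(p l)\<^sup>2 \<le> (p (Suc k))\<^sup>2" using p[of l] by (intro power_mono) simp_all
    then show ?thesis by (simp only: pS)
  qed
  define L where "L k = {w\<in>G. (p k)\<^sup>2 / 4 < z (ennreal t) w \<and> z (ennreal t) w \<le> (p k)\<^sup>2}" for k
  have LF: "L k \<in> sets (F (ennreal t))" for k
  proof -
    have G\<Omega>: "G \<subseteq> \<Omega>" using sets.sets_into_space[OF G] by (simp add: space_F)
    have "L k = G \<inter> (z (ennreal t) -` {(p k)\<^sup>2 / 4<..(p k)\<^sup>2} \<inter> space (F (ennreal t)))"
      using G\<Omega> by (auto simp: L_def space_F)
    also have "\<dots> \<in> sets (F (ennreal t))" by (rule sets.Int[OF G measurable_sets[OF z_F]]) simp
    finally show ?thesis .
  qed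
  have LQ: "L k \<in> sets Q" for k by (rule sets_F_QD[OF LF])
  have "L k \<inter> L l = {}" if "k < l" for k l
    using pmono[OF that] by (auto simp: L_def)
  then have disj: "disjoint_family L" unfolding disjoint_family_on_def by (metis Int_commute linorder_neqE_nat)
  have GU: "G = (\<Union>k. L k)"
  proof (intro equalityI subsetI)
    fix w assume w: "w \<in> G"
    then obtain k where "(p k)\<^sup>2 / 4 < z (ennreal t) w \<and> z (ennreal t) w \<le> (p k)\<^sup>2"
      using dyadic_layer[of "z (ennreal t) w"] Gz[OF w] unfolding p_def by auto
    then show "w \<in> (\<Union>k. L k)" using w by (intro UN_I[of k]) (simp_all add: L_def)
  qed (simp add: L_def)
  have GNU: "G - N = (\<Union>k. L k - N)" unfolding GU by blast
  have disj': "disjoint_family (\<lambda>k. L k - N)" using disj unfolding disjoint_family_on_def by blast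
  have s1: "(\<lambda>k. measure Q (L k)) sums measure Q G"
    unfolding GU by (rule Q.finite_measure_UNION[OF _ disj]) (use LQ in auto)
  have s2: "(\<lambda>k. measure Q (L k - N)) sums measure Q (G - N)"
    unfolding GNU by (rule Q.finite_measure_UNION[OF _ disj']) (use LQ N in auto)
  have "measure Q (L k) \<le> 32 * measure Q (L k - N)" for k
  proof (rule mass_outside_le_layer[OF t LF p _ _ N Nh Nz])
    fix w assume "w \<in> L k"
    then show "(p k)\<^sup>2 / 4 < z (ennreal t) w \<and> z (ennreal t) w \<le> (p k)\<^sup>2 \<and> z (ennreal t) w \<le> 1 / 2"
      "ennreal a \<le> h (ennreal t) w + ennreal (1 / 64)"
      using Gz Gh by (auto simp: L_def)
  qed
  from sums_le[OF this s1 sums_mult[OF s2]] show ?thesis .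
qed

text \<open>If N had positive mass, then at a late time n it would nearly coincide with an event of
  the past that satisfies the hypotheses of \<open>mass_outside_le\<close>. Such an event must miss
  N in a fixed fraction of its mass, which contradicts the approximation. Integer times keep N
  measurable.\<close>

lemma null_bounded_hellinger:
  fixes a :: real
  defines "N \<equiv> {w\<in>space Q. z \<infinity> w = 0 \<and> (\<forall>n::nat. 0 < z (ennreal n) w) \<and> (\<forall>n::nat. h (ennreal n) w \<le> ennreal a) \<and>
    (\<exists>n::nat. ennreal a \<le> h (ennreal n) w + ennreal (1/64))}"
  shows "N \<in> null_sets Q"
proof -
  have hF: "h (ennreal s) \<in> borel_measurable (F (ennreal s))" for s
    by (rule predictable_process_measurable[OF filt h_pred]) simp
  have [measurable]: "h (ennreal s) \<in> borel_measurable Q" for s by (rule measurable_F_Q[OF hF])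
  have N: "N \<in> sets Q" unfolding N_def by measurable
  have Nz: "AE w in Q. w \<in> N \<longrightarrow> z \<infinity> w = 0" by (simp add: N_def)
  have Nh: "AE w in Q. w \<in> N \<longrightarrow> (\<forall>s. h (ennreal s) w \<le> ennreal a)"
    using h_inc
  proof eventually_elim
    case (elim w)
    show ?case
    proof (intro impI allI)
      fix s :: real assume w: "w \<in> N"
      obtain n :: nat where "s \<le> real n" using real_arch_simple by blast
      then have "h (ennreal s) w \<le> h (ennreal (real n)) w" by (intro increasing_path_mono[OF elim] ennreal_leI) simp_all
      then show "h (ennreal s) w \<le> ennreal a" using w unfolding N_def by (auto intro: order_trans)
    qed
  qed
  have "measure Q N = 0"
  proof (rule ccontr)
    assume "measure Q N \<noteq> 0"
    then have pos: "0 < measure Q N" by (simp add: zero_less_measure_iff)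
    \<comment> \<open>Any divisor above 35 would serve: 32 comes from
      \<open>mass_outside_le\<close>, and N - C, \<open>V n\<close> and Z contribute one e
      each.\<close>
    define e where "e = measure Q N / 200"
    have e: "0 < e" using pos by (simp add: e_def)
    obtain C t0 where C: "0 \<le> t0" "C \<in> sets (F (ennreal t0))" "measure Q ((N - C) \<union> (C - N)) < e"
      by (rule approx_by_past[OF N e])
    have CQ: "C \<in> sets Q" by (rule sets_F_QD[OF C(2)])
    have NC: "measure Q (N - C) \<le> e" "measure Q (C - N) \<le> e"
      using C(3) N CQ Q.finite_measure_mono[of "N - C" "(N - C) \<union> (C - N)"]
        Q.finite_measure_mono[of "C - N" "(N - C) \<union> (C - N)"] by auto
    have e2: "0 < e / 2" using e by simp
    obtain t1 where t1: "\<And>u. t1 \<le> u \<Longrightarrow> (\<integral>w. indicator N w * z (ennreal u) w \<partial>Q) \<le> e / 2"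
      using z_vanishes[OF N Nz e2] by blast
    define V where "V n = {w\<in>space Q. w \<in> N \<and> \<not> ennreal a \<le> h (ennreal (real n)) w + ennreal (1/64)}" for n :: nat
    have V [measurable]: "V n \<in> sets Q" for n unfolding V_def using N by measurable
    have "(\<lambda>n. \<integral>w. indicator (V n) w \<partial>Q) \<longlonglongrightarrow> (\<integral>w. 0 \<partial>Q :: real)"
    proof (rule integral_dominated_convergence[where w = "\<lambda>_. 1"])
      show "AE w in Q. (\<lambda>n. indicator (V n) w :: real) \<longlonglongrightarrow> 0"
        using h_inc
      proof eventually_elim
        case (elim w)
        show ?case
        proof (cases "w \<in> N")
          case True
          then obtain m :: nat where m: "ennreal a \<le> h (ennreal m) w + ennreal (1/64)" by (auto simp: N_def)
          have "ennreal a \<le> h (ennreal n) w + ennreal (1/64)" if "m \<le> n" for n :: nat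
          proof -
            have "h (ennreal m) w \<le> h (ennreal n) w"
              using that by (intro increasing_path_mono[OF elim] ennreal_leI) simp_all
            then have "h (ennreal m) w + ennreal (1/64) \<le> h (ennreal n) w + ennreal (1/64)" by (rule add_right_mono)
            with m show ?thesis by (rule order_trans)
          qed
          then have "\<forall>\<^sub>F n in sequentially. (indicator (V n) w :: real) = 0"
            unfolding eventually_sequentially by (intro exI[of _ m]) (simp add: V_def)
          then show ?thesis by (rule tendsto_eventually)
        next
          case False
          then show ?thesis by (simp add: V_def)
        qed
      qed
      show "AE w in Q. norm (indicator (V n) w :: real) \<le> 1" for n by (simp add: indicator_def)
    qed simp_all
    then have "(\<lambda>n. measure Q (V n)) \<longlonglongrightarrow> 0" using sets.Int_space_eq2[OF V] by simp
    from order_tendstoD(2)[OF this e] obtain n1 where n1: "\<And>n. n1 \<le> n \<Longrightarrow> measure Q (V n) < e"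
      by (auto simp: eventually_sequentially)
    obtain n2 :: nat where n2: "max t0 t1 \<le> real n2" using real_arch_simple by blast
    define n where "n = max (max n1 n2) 1"
    have n: "t0 \<le> real n" "t1 \<le> real n" "n1 \<le> n" "0 < real n" using n2 by (auto simp: n_def)
    \<comment> \<open>D is an event of time n. A sample of N can only miss it if h has not yet come
      close to a, which puts it into \<open>V n\<close>, or if z is still above 1/2, which puts it
      into Z.\<close>
    define D where "D = {w\<in>space (F (ennreal (real n))). (0 < z (ennreal (real n)) w \<and> z (ennreal (real n)) w \<le> 1/2) \<and>
      ennreal a \<le> h (ennreal (real n)) w + ennreal (1/64)}"
    have D: "D \<in> sets (F (ennreal (real n)))"
    proof -
      note [measurable] = z_F[of "ennreal (real n)"] hF[of "real n"]
      show ?thesis unfolding D_def by measurable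
    qed
    have CD: "C \<inter> D \<in> sets (F (ennreal (real n)))"
      using D subsetD[OF sets_F_mono C(2)] n(1) by (intro sets.Int) (simp_all add: ennreal_leI)
    have "measure Q (C \<inter> D) \<le> 32 * measure Q (C \<inter> D - N)"
      by (rule mass_outside_le[OF n(4) CD _ _ N Nh Nz]) (auto simp: D_def)
    also have "measure Q (C \<inter> D - N) \<le> measure Q (C - N)"
      using CQ N by (intro Q.finite_measure_mono) auto
    finally have le: "measure Q (C \<inter> D) \<le> 32 * e" using NC by simp
    define Z where "Z = {w\<in>space Q. w \<in> N \<and> 1/2 < z (ennreal (real n)) w}"
    have Z: "Z \<in> sets Q" unfolding Z_def using N by measurable
    have "measure Q Z \<le> (\<integral>w. 2 * (indicator N w * z (ennreal (real n)) w) \<partial>Q)"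
    proof -
      have "(\<integral>w. indicator Z w \<partial>Q) \<le> (\<integral>w. 2 * (indicator N w * z (ennreal (real n)) w) \<partial>Q)"
      proof (rule integral_mono_AE)
        show "AE w in Q. indicator Z w \<le> 2 * (indicator N w * z (ennreal (real n)) w)"
          using AE_z_nonneg[of "ennreal (real n)"] by eventually_elim (auto simp: Z_def indicator_def)
      qed (intro integrable_ind Z integrable_mult_right integrable_indicator_mult N integrable_z)+
      then show ?thesis using sets.Int_space_eq2[OF Z] by simp
    qed
    also have "\<dots> \<le> e" using t1[OF n(2)] by simp
    finally have Ze: "measure Q Z \<le> e" .
    have "N \<subseteq> (C \<inter> D) \<union> ((N - C) \<union> (V n \<union> Z))"
    proof
      fix w assume w: "w \<in> N"
      then have "0 < z (ennreal (real n)) w" "w \<in> space Q" by (auto simp: N_def)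
      then show "w \<in> (C \<inter> D) \<union> ((N - C) \<union> (V n \<union> Z))"
        using w by (auto simp: D_def V_def Z_def space_Q space_F)
    qed
    then have "measure Q N \<le> measure Q ((C \<inter> D) \<union> ((N - C) \<union> (V n \<union> Z)))"
      using sets_F_QD[OF CD] N CQ V Z by (intro Q.finite_measure_mono) auto
    also have "\<dots> \<le> measure Q (C \<inter> D) + measure Q ((N - C) \<union> (V n \<union> Z))"
      using sets_F_QD[OF CD] N CQ V Z by (intro measure_Un_le) auto
    also have "measure Q ((N - C) \<union> (V n \<union> Z)) \<le> measure Q (N - C) + measure Q (V n \<union> Z)"
      using N CQ V Z by (intro measure_Un_le) auto
    also have "measure Q (V n \<union> Z) \<le> measure Q (V n) + measure Q Z"
      using V Z by (intro measure_Un_le) auto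
    finally have "measure Q N \<le> 35 * e" using le NC(1) n1[OF n(3)] Ze by simp
    then show False using pos by (simp add: e_def)
  qed
  then show ?thesis using N by (simp add: null_sets_def Q.emeasure_eq_measure)
qed

lemma h_le_infinity:
  assumes "increasing_path (\<lambda>t. h t w)" "((\<lambda>t. h t w) \<longlongrightarrow> h \<infinity> w) (at_left \<infinity>)" "s < \<infinity>"
  shows "h s w \<le> h \<infinity> w"
proof (rule tendsto_lowerbound[OF assms(2)])
  show "at_left (\<infinity>::ennreal) \<noteq> bot" by (rule at_left_ennreal_neq_bot) simp
  have "\<forall>\<^sub>F t in at_left (\<infinity>::ennreal). s < t \<and> t < \<infinity>"
    unfolding eventually_at_left[OF assms(3)] using assms(3) by (intro exI[of _ s]) simp
  then show "\<forall>\<^sub>F t in at_left \<infinity>. h s w \<le> h t w"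
    by eventually_elim (intro increasing_path_mono[OF assms(1)], auto)
qed

text \<open>Restricting the level a to rationals leaves countably many null sets, and the tolerance
  1/64 provides a rational level just above any finite limit of h.\<close>

lemma AE_hellinger_infinite:
  "AE w in Q. z \<infinity> w = 0 \<longrightarrow> (\<forall>t<\<infinity>. 0 < z t w) \<longrightarrow> h \<infinity> w = \<infinity>"
proof -
  define N where "N a = {w\<in>space Q. z \<infinity> w = 0 \<and> (\<forall>n::nat. 0 < z (ennreal n) w) \<and> (\<forall>n::nat. h (ennreal n) w \<le> ennreal a) \<and>
    (\<exists>n::nat. ennreal a \<le> h (ennreal n) w + ennreal (1/64))}" for a
  have "AE w in Q. \<forall>r::rat. w \<notin> N (real_of_rat r)"
    unfolding AE_all_countable N_def using AE_not_in[OF null_bounded_hellinger] by blast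
  then show ?thesis using AE_space h_inc h_lim
  proof eventually_elim
    case (elim w)
    show ?case
    proof (intro impI, rule ccontr)
      assume z0: "z \<infinity> w = 0" and zp: "\<forall>t<\<infinity>. 0 < z t w" and hf: "h \<infinity> w \<noteq> \<infinity>"
      define s where "s = (SUP n::nat. h (ennreal n) w)"
      have "s \<le> h \<infinity> w" unfolding s_def by (intro SUP_least h_le_infinity[OF elim(3,4)]) simp
      then obtain r where r: "s = ennreal r" "0 \<le> r" using hf by (cases s) (auto simp: top_unique)
      obtain x where x: "r < real_of_rat x" "real_of_rat x < r + 1/64" using of_rat_dense[of r "r + 1/64"] by auto
      have up: "h (ennreal n) w \<le> ennreal (real_of_rat x)" for n :: nat
      proof -
        have "h (ennreal n) w \<le> s" unfolding s_def by (rule SUP_upper) simp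
        also have "\<dots> \<le> ennreal (real_of_rat x)" unfolding r using x(1) by (intro ennreal_leI) simp
        finally show ?thesis .
      qed
      have "\<exists>n::nat. ennreal (real_of_rat x) \<le> h (ennreal n) w + ennreal (1/64)"
      proof (cases "real_of_rat x \<le> 1/64")
        case True
        then have "ennreal (real_of_rat x) \<le> ennreal (1/64)" by (rule ennreal_leI)
        also have "\<dots> \<le> h (ennreal 0) w + ennreal (1/64)" by simp
        finally show ?thesis by (intro exI[of _ 0]) simp
      next
        case False
        then have "ennreal (real_of_rat x - 1/64) < s" unfolding r using x r(2) by (subst ennreal_less_iff) simp_all
        then obtain n :: nat where n: "ennreal (real_of_rat x - 1/64) < h (ennreal n) w"
          unfolding s_def less_SUP_iff by blast
        have "ennreal (real_of_rat x) = ennreal (real_of_rat x - 1/64) + ennreal (1/64)"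
          using False by (subst ennreal_plus[symmetric]) simp_all
        also have "\<dots> \<le> h (ennreal n) w + ennreal (1/64)" using n by (intro add_right_mono) simp
        finally show ?thesis by blast
      qed
      then have "w \<in> N (real_of_rat x)" unfolding N_def using z0 zp up elim(2) by simp
      with elim(1) show False by blast
    qed
  qed
qed

end

subsection \<open>Equivalence and singularity before a stopping time\<close>

context density_pair
begin

lemma inf_zero_mono: "s \<le> t \<Longrightarrow> inf_zero s \<subseteq> inf_zero t"
  unfolding inf_zero_def by (fastforce intro: order_trans)

lemma stopped_before_F:
  assumes T: "stopping_time F T" and B: "B \<in> sets (pre_sigma T)"
  shows "{w\<in>B. T w < q} \<in> sets (F q)"
proof -
  have "{w\<in>B. T w < q} = (\<Union>r\<in>rat_times \<inter> {..<q}. {w\<in>B. T w \<le> r})"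
    using rat_times_dense by (fastforce intro: less_imp_le le_less_trans)
  also have "\<dots> \<in> sets (F q)"
  proof (intro sets.countable_UN' image_subsetI)
    fix r assume "r \<in> rat_times \<inter> {..<q}"
    then have "r \<le> q" by auto
    then show "{w\<in>B. T w \<le> r} \<in> sets (F q)" using sets_pre_sigmaD[OF T B] sets_F_mono by blast
  qed (rule countable_subset[OF Int_lower1 countable_rat_times])
  finally show ?thesis .
qed

text \<open>Transfers nullity from \<mu> to Q, hence to \<nu>. The first alternative yields
  countably many events of \<open>F q\<close> on which z at q is positive, so that a \<mu>-null
  event is Q-null. E occurs again in the second alternative because it need not be measurable; there
  a \<mu>-null set covering B \<inter> E is used together with the terminal density.\<close>

lemma before_stop_null:
  assumes T: "stopping_time F T" and B: "B \<in> sets (pre_sigma T)"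
    and E: "AE w in Q. w \<in> E \<longleftrightarrow> (\<exists>q\<in>rat_times. T w < q \<and> 0 < z q w \<and> 0 < z' q w) \<or>
      (w \<in> E \<and> 0 < z \<infinity> w \<and> 0 < z' \<infinity> w)"
    and null: "AE w in \<mu>. w \<notin> B \<inter> E"
  shows "AE w in Q. w \<notin> B \<inter> E"
proof -
  interpret s: density_pair \<Omega> F \<nu> \<mu> Q z' z by (rule swap)
  have "AE w in Q. w \<notin> {w\<in>B. T w < q} \<or> \<not> 0 < z q w \<or> \<not> 0 < z' q w" if "q \<in> rat_times" for q
  proof -
    define Bq where "Bq = {w\<in>B. T w < q} \<inter> {w\<in>space (F q). 0 < z q w \<and> 0 < z' q w}"
    have "{w\<in>space (F q). 0 < z q w \<and> 0 < z' q w} \<in> sets (F q)"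
      using z_F[of q] s.z_F[of q] by measurable
    then have Bq: "Bq \<in> sets (F q)" unfolding Bq_def by (intro sets.Int stopped_before_F[OF T B])
    have "AE w in \<mu>. w \<notin> Bq"
      using null AE_Q_\<mu>[OF E]
    proof eventually_elim
      case (elim w)
      then show ?case using that by (auto simp: Bq_def)
    qed
    then have "emeasure \<mu> Bq = 0"
      using Bq sets_F_Q[of q] sets_Q \<mu>(2) by (subst (asm) AE_iff_null_sets[symmetric]) auto
    from null_\<mu>_z[OF Bq this] AE_space show ?thesis
      by eventually_elim (auto simp: Bq_def space_Q space_F)
  qed
  then have 1: "AE w in Q. \<forall>q\<in>rat_times. w \<notin> {w\<in>B. T w < q} \<or> \<not> 0 < z q w \<or> \<not> 0 < z' q w"
    by (intro AE_ball_countable[THEN iffD2] ballI countable_rat_times)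
  from null obtain N where N: "N \<in> null_sets \<mu>" "{w\<in>space \<mu>. \<not> w \<notin> B \<inter> E} \<subseteq> N"
    unfolding eventually_ae_filter by blast
  have "AE w in Q. w \<in> N \<longrightarrow> z \<infinity> w \<le> 0"
    using N(1) \<mu>(2) by (intro null_\<mu>_z) auto
  with 1 E AE_space show ?thesis
  proof eventually_elim
    case (elim w)
    show ?case
    proof
      assume w: "w \<in> B \<inter> E"
      then have "w \<in> N" using N(2) elim(3) by (auto simp: space_Q space_\<mu>)
      then show False using w elim by auto
    qed
  qed
qed

lemma first_zero_ge:
  assumes cad: "cadlag (\<lambda>t. z t w)" "cadlag (\<lambda>t. z' t w)" and e: "0 < e" "0 < e'"
    and z1: "\<And>q. q \<in> rat_times \<Longrightarrow> q < v \<Longrightarrow> e \<le> z q w" and z1': "\<And>q. q \<in> rat_times \<Longrightarrow> q < v \<Longrightarrow> e' \<le> z' q w"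
  shows "v \<le> first_zero z z' w"
  unfolding first_zero_def
proof (rule Inf_greatest)
  fix t assume "t \<in> {t. t < \<infinity> \<and> (z t w = 0 \<or> z' t w = 0)}"
  then have t: "z t w = 0 \<or> z' t w = 0" by simp
  show "v \<le> t"
  proof (rule ccontr)
    assume "\<not> v \<le> t"
    then have tv: "t < v" by simp
    have "z t w \<in> {e..}" by (rule cadlag_closed[OF cad(1), of _ 0 v]) (use z1 tv in auto)
    moreover have "z' t w \<in> {e'..}" by (rule cadlag_closed[OF cad(2), of _ 0 v]) (use z1' tv in auto)
    ultimately show False using t e by auto
  qed
qed

lemma less_first_zero:
  assumes "t < first_zero z z' w" "t < \<infinity>"
  shows "z t w \<noteq> 0" "z' t w \<noteq> 0"
proof -
  have "t \<notin> {t. t < \<infinity> \<and> (z t w = 0 \<or> z' t w = 0)}"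
  proof
    assume "t \<in> {t. t < \<infinity> \<and> (z t w = 0 \<or> z' t w = 0)}"
    then have "first_zero z z' w \<le> t" unfolding first_zero_def by (rule Inf_lower)
    with assms(1) show False by simp
  qed
  then show "z t w \<noteq> 0" "z' t w \<noteq> 0" using assms(2) by auto
qed

end

context hellinger_pair
begin

lemma swap_hellinger: "hellinger_pair \<Omega> F \<nu> \<mu> Q z' z h M A Y"
  using dm h_pred h_inc A_eq h_le h_lim Y
  by (intro hellinger_pair.intro s.density_pair_axioms hellinger_pair_axioms.intro) (simp_all add: mult.commute)

text \<open>If T < S, any rational time in between has both densities positive. If T = S =
  \<infinity>, finiteness of h makes both terminal densities positive. Conversely, a density that is
  positive at a rational q > T was bounded away from zero up to q, which gives q \<le> S and a
  finite h at T.\<close>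

lemma AE_equivalence_set:
  defines "S \<equiv> first_zero z z'"
  assumes E: "E = ({w\<in>\<Omega>. T w < S w} \<union> {w\<in>\<Omega>. T w = S w \<and> T w = \<infinity>}) \<inter> {w\<in>\<Omega>. h (T w) w < \<infinity>}"
  shows "AE w in Q. w \<in> E \<longleftrightarrow> (\<exists>q\<in>rat_times. T w < q \<and> 0 < z q w \<and> 0 < z' q w) \<or>
      (w \<in> E \<and> 0 < z \<infinity> w \<and> 0 < z' \<infinity> w)"
proof -
  interpret sh: hellinger_pair \<Omega> F \<nu> \<mu> Q z' z h M A Y by (rule swap_hellinger)
  have inf: "AE w in Q. \<forall>q\<in>rat_times. 0 < z q w \<longrightarrow> (\<exists>e>0. \<forall>r\<in>rat_times. r \<le> q \<longrightarrow> e \<le> z r w)"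
    "AE w in Q. \<forall>q\<in>rat_times. 0 < z' q w \<longrightarrow> (\<exists>e>0. \<forall>r\<in>rat_times. r \<le> q \<longrightarrow> e \<le> z' r w)"
    by (intro AE_ball_countable[THEN iffD2] ballI countable_rat_times AE_inf_pos s.AE_inf_pos)+
  show ?thesis
    using AE_z s.AE_z inf AE_h_finite AE_hellinger_infinite sh.AE_hellinger_infinite AE_space
  proof eventually_elim
    case (elim w)
    have w: "w \<in> \<Omega>" using elim(8) by (simp add: space_Q)
    have pos: "0 < z t w" "0 < z' t w" if "t < S w" "t < \<infinity>" for t
      using less_first_zero[OF that[unfolded S_def]] elim(1,2) by (metis order_le_imp_less_or_eq)+
    have "(\<exists>q\<in>rat_times. T w < q \<and> 0 < z q w \<and> 0 < z' q w) \<or> (0 < z \<infinity> w \<and> 0 < z' \<infinity> w)"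
      if "w \<in> E"
    proof (cases "T w < S w")
      case True
      from rat_times_dense[OF this] obtain q where q: "q \<in> rat_times" "T w < q" "q < S w" by blast
      then show ?thesis using pos[OF q(3) rat_times_finite[OF q(1)]] by blast
    next
      case False
      then have ST: "S w = \<infinity>" "h \<infinity> w < \<infinity>" using that unfolding E by auto
      have p: "0 < z t w" "0 < z' t w" if "t < \<infinity>" for t using pos[of t] that ST(1) by simp_all
      have "z \<infinity> w \<noteq> 0" "z' \<infinity> w \<noteq> 0" using elim(6,7) p ST(2) by auto
      moreover have "0 \<le> z \<infinity> w" "0 \<le> z' \<infinity> w" using elim(1,2) by simp_all
      ultimately show ?thesis by (simp add: less_le)
    qed
    moreover have "w \<in> E" if q: "q \<in> rat_times" "T w < q" "0 < z q w" "0 < z' q w" for q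
    proof -
      obtain e where e: "0 < e" "\<forall>r\<in>rat_times. r \<le> q \<longrightarrow> e \<le> z r w" using elim(3) q by blast
      obtain e' where e': "0 < e'" "\<forall>r\<in>rat_times. r \<le> q \<longrightarrow> e' \<le> z' r w" using elim(4) q by blast
      have "q \<le> S w" unfolding S_def
        by (rule first_zero_ge[of w e e']) (use elim(1,2) e e' in auto)
      moreover have "h (T w) w < \<infinity>"
      proof -
        have "min e e' \<le> z r w \<and> min e e' \<le> z' r w" if "r \<in> rat_times" "r < T w" for r
        proof -
          have "r \<le> q" using that(2) q(2) by simp
          then show ?thesis using e(2) e'(2) that(1) by (simp add: min.coboundedI1 min.coboundedI2)
        qed
        moreover have "0 < min e e'" using e(1) e'(1) by simp
        ultimately show ?thesis using elim(5) by blast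
      qed
      ultimately show ?thesis unfolding E using w q(2) by auto
    qed
    ultimately show ?case by blast
  qed
qed

lemma equivalent_before_zero:
  defines "S \<equiv> first_zero z z'"
  assumes T: "stopping_time F T"
    and E: "E = ({w\<in>\<Omega>. T w < S w} \<union> {w\<in>\<Omega>. T w = S w \<and> T w = \<infinity>}) \<inter> {w\<in>\<Omega>. h (T w) w < \<infinity>}"
  shows "equivalent_on \<mu> \<nu> (pre_sigma T) E"
  unfolding equivalent_on_def
proof (intro ballI iffI)
  fix B assume B: "B \<in> sets (pre_sigma T)"
  note E1 = AE_equivalence_set[OF E[unfolded S_def]]
  have E2: "AE w in Q. w \<in> E \<longleftrightarrow> (\<exists>q\<in>rat_times. T w < q \<and> 0 < z' q w \<and> 0 < z q w) \<or>
      (w \<in> E \<and> 0 < z' \<infinity> w \<and> 0 < z \<infinity> w)"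
    using E1 by eventually_elim (metis (no_types))
  show "AE w in \<nu>. w \<notin> B \<inter> E" if "AE w in \<mu>. w \<notin> B \<inter> E"
    by (rule s.AE_Q_\<mu>[OF before_stop_null[OF T B E1 that]])
  show "AE w in \<mu>. w \<notin> B \<inter> E" if "AE w in \<nu>. w \<notin> B \<inter> E"
    by (rule AE_Q_\<mu>[OF s.before_stop_null[OF T B E2 that]])
qed

text \<open>The separating set is the event that the infimum of \<open>z\<close> up to a time slightly later than \<open>T\<close>
  is zero; right-continuity of the filtration puts it into the sigma-algebra of \<open>T\<close>.\<close>

lemma separating_set:
  assumes T: "stopping_time F T"
  shows "{w\<in>inf_zero \<infinity>. \<forall>q\<in>rat_times. T w < q \<longrightarrow> w \<in> inf_zero q} \<in> sets (pre_sigma T)"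
    (is "?A \<in> _")
proof (rule sets_pre_sigmaI[OF T])
  fix t :: ennreal
  have Tle: "{w\<in>\<Omega>. T w \<le> r} \<in> sets (F r)" for r
    using stopping_timeD[OF T, of r] by (simp add: pred_def space_F)
  have Tlt: "{w\<in>\<Omega>. T w < q} \<in> sets (F q)" for q
  proof -
    have "\<Omega> \<in> sets (pre_sigma T)" using sets.top[of "pre_sigma T"] by (simp add: space_pre_sigma)
    from stopped_before_F[OF T this] show ?thesis .
  qed
  have imp: "{w\<in>\<Omega>. T w < q \<longrightarrow> w \<in> inf_zero q} \<in> sets (F q)" for q
  proof -
    have "{w\<in>\<Omega>. T w < q \<longrightarrow> w \<in> inf_zero q} = (\<Omega> - {w\<in>\<Omega>. T w < q}) \<union> inf_zero q"
      using sets.sets_into_space[OF inf_zero_F[of q]] by (auto simp: space_F)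
    also have "\<dots> \<in> sets (F q)"
      using sets.compl_sets[OF Tlt[of q]] inf_zero_F by (intro sets.Un) (simp_all add: space_F)
    finally show ?thesis .
  qed
  have inter: "(\<Inter>q\<in>rat_times \<inter> {..<s}. {w\<in>\<Omega>. T w < q \<longrightarrow> w \<in> inf_zero q}) \<in> sets (F s)" if "0 < s" for s
  proof (rule sets.countable_INT')
    show "countable (rat_times \<inter> {..<s})" by (rule countable_subset[OF Int_lower1 countable_rat_times])
    show "rat_times \<inter> {..<s} \<noteq> {}" using rat_times_dense[OF that] by blast
    show "(\<lambda>q. {w\<in>\<Omega>. T w < q \<longrightarrow> w \<in> inf_zero q}) ` (rat_times \<inter> {..<s}) \<subseteq> sets (F s)"
    proof (rule image_subsetI)
      fix q assume "q \<in> rat_times \<inter> {..<s}"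
      then have "sets (F q) \<subseteq> sets (F s)" by (intro sets_F_mono) auto
      then show "{w\<in>\<Omega>. T w < q \<longrightarrow> w \<in> inf_zero q} \<in> sets (F s)" using imp by blast
    qed
  qed
  have in\<Omega>: "w \<in> \<Omega>" if "w \<in> inf_zero q" for w q using that by (simp add: inf_zero_def)
  show "{w\<in>?A. T w \<le> t} \<in> sets (F t)"
  proof (cases "t = \<infinity>")
    \<comment> \<open>At t = \<infinity> there is no later time to borrow from, but the full
      sigma-algebra contains every event involved. The condition on
      \<open>inf_zero \<infinity>\<close> takes effect when T is infinite and the quantifier over q
      is void.\<close>
    case True
    have "{w\<in>?A. T w \<le> t} = inf_zero \<infinity> \<inter> (\<Inter>q\<in>rat_times \<inter> {..<\<infinity>}. {w\<in>\<Omega>. T w < q \<longrightarrow> w \<in> inf_zero q})"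
      using True rat_times_finite in\<Omega> by auto
    also have "\<dots> \<in> sets (F \<infinity>)" by (intro sets.Int inf_zero_F inter) simp
    finally show ?thesis unfolding True .
  next
    case False
    then have t: "t < \<infinity>" by (simp add: less_top)
    have "{w\<in>?A. T w \<le> t} \<in> sets (F s)" if s: "t < s" "s < \<infinity>" for s
    proof -
      have s0: "0 < s" using s(1) by (rule le_less_trans[rotated]) simp
      have "{w\<in>?A. T w \<le> t} = {w\<in>\<Omega>. T w \<le> t} \<inter> (\<Inter>q\<in>rat_times \<inter> {..<s}. {w\<in>\<Omega>. T w < q \<longrightarrow> w \<in> inf_zero q})"
        (is "?L = ?R")
      proof (intro equalityI subsetI)
        fix w assume "w \<in> ?L"
        then show "w \<in> ?R" using in\<Omega> by auto
      next
        fix w assume "w \<in> ?R"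
        then have w: "w \<in> \<Omega>" "T w \<le> t" "\<And>q. q \<in> rat_times \<Longrightarrow> q < s \<Longrightarrow> T w < q \<Longrightarrow> w \<in> inf_zero q" by auto
        \<comment> \<open>One rational time between t and s suffices: \<open>inf_zero\<close> grows
          with time, so the conditions at times from s on follow from the one at q0, and the event
          is visible at s.\<close>
        obtain q0 where q0: "q0 \<in> rat_times" "t < q0" "q0 < s" using rat_times_dense[OF s(1)] by blast
        have "w \<in> inf_zero q0" using w q0 by (meson le_less_trans)
        then have "w \<in> inf_zero q" if "q0 \<le> q" for q using inf_zero_mono[OF that] by blast
        then have "w \<in> inf_zero q" if "q \<in> rat_times" "T w < q" for q
          using w(3)[OF that(1) _ that(2)] q0(3) by (cases "q < s") auto
        moreover have "w \<in> inf_zero \<infinity>" using inf_zero_mono[of q0 \<infinity>] \<open>w \<in> inf_zero q0\<close> by auto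
        ultimately show "w \<in> ?L" using w(2) by blast
      qed
      also have "\<dots> \<in> sets (F s)"
        by (intro sets.Int inter s0 subsetD[OF sets_F_mono Tle]) (use s(1) in simp)
      finally show ?thesis .
    qed
    moreover have "sets (F t) = (\<Inter>s\<in>{t<..<\<infinity>}. sets (F s))"
      using fs t unfolding filtered_space_def by blast
    ultimately show ?thesis by simp
  qed
qed

lemma singular_after_zero:
  defines "S \<equiv> first_zero z z'"
  assumes T: "stopping_time F T"
    and Ec: "Ec = ({w\<in>\<Omega>. S w < T w} \<union> {w\<in>\<Omega>. S w \<le> T w \<and> T w < \<infinity>}) \<union> {w\<in>\<Omega>. h (T w) w = \<infinity>}"
  shows "singular_on \<mu> \<nu> (pre_sigma T) Ec"
  unfolding singular_on_def
proof (intro bexI conjI)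
  let ?A = "{w\<in>inf_zero \<infinity>. \<forall>q\<in>rat_times. T w < q \<longrightarrow> w \<in> inf_zero q}"
  show "?A \<in> sets (pre_sigma T)" by (rule separating_set[OF T])
  show "AE w in \<mu>. w \<notin> ?A \<inter> Ec"
    using AE_not_inf_zero[of \<infinity>] by eventually_elim simp
  show "AE w in \<nu>. w \<notin> Ec - ?A"
    using s.AE_\<mu>_inf_pos s.AE_Q_\<mu>[OF AE_z] s.AE_Q_\<mu>[OF s.AE_z] s.AE_Q_\<mu>[OF AE_h_finite]
  proof eventually_elim
    case (elim w)
    obtain e' where e': "0 < e'" "\<And>q. q \<in> rat_times \<Longrightarrow> e' \<le> z' q w" using elim(1) by blast
    show ?case
    proof
      assume "w \<in> Ec - ?A"
      then have w: "w \<in> \<Omega>" "w \<in> Ec" "w \<notin> ?A" unfolding Ec by auto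
      \<comment> \<open>Off the separating set z is bounded below up to a time v strictly later than
        T, unless v is infinite. The strictness matters because a finite T equal to S belongs to
        \<open>Ec\<close>; under \<nu> the bound for z' holds at all rational times.\<close>
      obtain v e where v: "T w < v \<or> v = \<infinity>" and e: "0 < e" "\<And>q. q \<in> rat_times \<Longrightarrow> q \<le> v \<Longrightarrow> e \<le> z q w"
      proof -
        from w(3) consider "w \<notin> inf_zero \<infinity>" | q where "T w < q" "w \<notin> inf_zero q" by blast
        then show thesis
          using that not_inf_zero[OF w(1)] by cases blast+
      qed
      have "v \<le> S w" unfolding S_def
        by (rule first_zero_ge[of w e e']) (use elim(2,3) e e' in auto)
      moreover have "h (T w) w < \<infinity>"
      proof -
        have "min e e' \<le> z r w \<and> min e e' \<le> z' r w" if "r \<in> rat_times" "r < T w" for r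
        proof -
          have "r \<le> v" using that(2) v by auto
          then show ?thesis using e(2)[OF that(1)] e'(2)[OF that(1)] by (simp add: min.coboundedI1 min.coboundedI2)
        qed
        moreover have "0 < min e e'" using e(1) e'(1) by simp
        ultimately show ?thesis using elim(4) by blast
      qed
      ultimately show False using w(2) v unfolding Ec by (auto simp: top_unique)
    qed
  qed
qed

end

theorem theorem1:
  fixes \<Omega> :: "'a set" and F :: "ennreal \<Rightarrow> 'a measure" and \<mu> \<nu> Q :: "'a measure"
    and z z' :: "ennreal \<Rightarrow> 'a \<Rightarrow> real" and h :: "ennreal \<Rightarrow> 'a \<Rightarrow> ennreal"
    and S T :: "'a \<Rightarrow> ennreal" and E Ec :: "'a set"
  assumes "filtered_space \<Omega> F"
    and "prob_space \<mu>" and "sets \<mu> = sets (F \<infinity>)"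
    and "prob_space \<nu>" and "sets \<nu> = sets (F \<infinity>)"
    and "Q = mean_measure \<mu> \<nu>"
    and "density_process F Q \<mu> z"
    and "density_process F Q \<nu> z'"
    and "S = first_zero z z'"
    and "hellinger_process \<Omega> F Q z z' h"
    and "stopping_time F T"
    and "E = ({\<omega>\<in>\<Omega>. T \<omega> < S \<omega>} \<union> {\<omega>\<in>\<Omega>. T \<omega> = S \<omega> \<and> T \<omega> = \<infinity>})
               \<inter> {\<omega>\<in>\<Omega>. h (T \<omega>) \<omega> < \<infinity>}"
    and "Ec = ({\<omega>\<in>\<Omega>. S \<omega> < T \<omega>} \<union> {\<omega>\<in>\<Omega>. S \<omega> \<le> T \<omega> \<and> T \<omega> < \<infinity>})
               \<union> {\<omega>\<in>\<Omega>. h (T \<omega>) \<omega> = \<infinity>}"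
  shows "equivalent_on \<mu> \<nu> (filtration.pre_sigma \<Omega> F T) E \<and>
         singular_on \<mu> \<nu> (filtration.pre_sigma \<Omega> F T) Ec"
proof -
  interpret density_pair \<Omega> F \<mu> \<nu> Q z z'
    using assms(1-8) by (rule density_pair.intro)
  obtain M A where "hellinger_pair \<Omega> F \<mu> \<nu> Q z z' h M A (\<lambda>t \<omega>. sqrt (z t \<omega> * z' t \<omega>))"
    by (rule obtain_hellinger_pair[OF assms(10)])
  then interpret hellinger_pair \<Omega> F \<mu> \<nu> Q z z' h M A "\<lambda>t \<omega>. sqrt (z t \<omega> * z' t \<omega>)" .
  show ?thesis
    using equivalent_before_zero[OF assms(11,12)[unfolded assms(9)]]
      singular_after_zero[OF assms(11,13)[unfolded assms(9)]] ..
qed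

end
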